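(* Let $\mathbb C[H_-\backslash B_-]_q$ be the associative algebra over $\mathbb C[q,q^{-1}]$ given by generators $u_i,m_i$ ($i>0$) and the (quadratic) relations $$\bigl(\lambda^{-1}u(\lambda)-\mu^{-1}u(\mu)\bigr)\bigl(u(\lambda)-u(\mu)\bigr)=q\bigl(u(\lambda)-u(\mu)\bigr)\bigl(\lambda^{-1}u(\lambda)-\mu^{-1}u(\mu)\bigr),$$ $$\bigl(\lambda^{-1}m(\lambda)-\mu^{-1}m(\mu)\bigr)\bigl(m(\lambda)-m(\mu)\bigr)=q^{-1}\bigl(m(\lambda)-m(\mu)\bigr)\bigl(\lambda^{-1}m(\lambda)-\mu^{-1}m(\mu)\bigr),$$ $$u(\lambda)m(\mu)=q^{-1}m(\mu)u(\lambda),$$ where $u(\lambda)=\sum_{i\ge0}(-1)^iu_{i+1}\lambda^{-i}$, $m(\lambda)=\sum_{i\ge0}(-1)^im_{i+1}\lambda^{-i}$ and $\lambda,\mu$ are commuting central formal variables (the relations are imposed coefficientwise). Then $\mathbb C[H_-\backslash B_-]_q$ is a quantum deformation of the algebra of functions on the Poisson homogeneous space $(H_-\backslash B_-,P_\infty)$, with $u_i,m_i$ deforming the coordinate functions $u_{i,\mathrm{cl}},m_{i,\mathrm{cl}}$.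
   Context: Classical objects. $G=SL_2(\mathbb C((\lambda^{-1})))$. $B_-\subset SL_2(\mathbb C[[\lambda^{-1}]])$ is the subgroup of matrices whose value at $\lambda^{-1}=0$ is lower triangular; $N_+\subset SL_2(\mathbb C[\lambda])$ is the subgroup of matrices whose value at $\lambda=0$ is upper unipotent; $H_-\subset B_-$ is the subgroup of matrices $\mathrm{diag}(a,a^{-1})$, $a\in\mathbb C[[\lambda^{-1}]]^*$. The Poisson structure on $H_-\backslash B_-$ is the one induced by the bivector $P_\infty=r^L-r_\infty^R$ on $G$, in such a way that $H_-\backslash B_-\hookrightarrow H_-\backslash G/N_+$ is a Poisson map. Here $r^L$ (resp. $r_\infty^R$) is the left (resp. right) translate on $G$ of $r$ (resp. $r_\infty$), $r$ is the standard $r$-matrix, and $r_\infty$ is the $r$-matrix of Drinfeld's "new realizations" (the conjugate of $r$ by an element of infinite length of the Weyl group). With $e,f,h$ the standard basis of $\mathfrak{sl}_2$, $X\wedge Y=X\otimes Y-Y\otimes X$, and $\{\varphi,\psi\}(g)=\langle d\varphi\otimes d\psi,P_\infty(g)\rangle$: $$r=\tfrac12\Big[\sum_{k\ge0}e\lambda^k\wedge f\lambda^{-k}+\sum_{k\ge1}f\lambda^k\wedge e\lambda^{-k}+\tfrac12\sum_{k\ge1}h\lambda^k\wedge h\lambda^{-k}\Big],$$ $$r_\infty=\tfrac12\Big[\sum_{k\in\mathbb Z}e\lambda^k\wedge f\lambda^{-k}+\tfrac12\sum_{k\ge1}h\lambda^k\wedge h\lambda^{-k}\Big].$$ Every $\bar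 x\in H_-\backslash B_-$ is uniquely the class of $$\begin{pmatrix}1&v_{\mathrm{cl}}(\lambda)\\ 0&1\end{pmatrix}\begin{pmatrix}1&0\\ u_{\mathrm{cl}}(\lambda)&1\end{pmatrix},\qquad u_{\mathrm{cl}}\in\mathbb C[[\lambda^{-1}]],\ v_{\mathrm{cl}}\in\lambda^{-1}\mathbb C[[\lambda^{-1}]].$$ Put $m_{\mathrm{cl}}(\lambda)=-\lambda v_{\mathrm{cl}}(\lambda)(1+u_{\mathrm{cl}}(\lambda)v_{\mathrm{cl}}(\lambda))^{-1}$, and write $u_{\mathrm{cl}}(\lambda)=\sum_{i\ge0}(-1)^iu_{i+1,\mathrm{cl}}\lambda^{-i}$, $m_{\mathrm{cl}}(\lambda)=\sum_{i\ge0}(-1)^im_{i+1,\mathrm{cl}}\lambda^{-i}$. The functions $u_{i,\mathrm{cl}},m_{i,\mathrm{cl}}$ are algebraically independent and $\mathbb C[H_-\backslash B_-]=\mathbb C[u_{i,\mathrm{cl}},m_{i,\mathrm{cl}},\,i>0]$. Quantum deformation. A $\mathbb C[q,q^{-1}]$-algebra $\mathcal U$ is a quantum deformation of a commutative Poisson algebra $R$ if it is a flat deformation ($\mathcal U$ is free as a $\mathbb C[q,q^{-1}]$-module and $\mathcal U/(q-1)\mathcal U\simeq R$ as algebras) and under this identification the bracket $\{\bar a,\bar b\}=\overline{(ab-ba)/(q-1)}$ is the Poisson bracket of $R$. *)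

theory Defs
  imports
    "HOL-Analysis.Analysis"
    "HOL-Computational_Algebra.Formal_Laurent_Series"
    "HOL-Library.Poly_Mapping"
begin

unbundle no fps_syntax

text \<open>
  Laurent series in \<open>\<lambda>\<^sup>-\<^sup>1\<close>: the variable of \<^typ>\<open>complex fls\<close> stands for the inverse of
  the loop parameter, so \<^term>\<open>fls_nth f k\<close> is the coefficient of \<open>\<lambda>\<^sup>-\<^sup>k\<close>.
\<close>

type_synonym loop = "complex fls"
type_synonym loop_mat = "complex fls ^ 2 ^ 2"

abbreviation lam_pow :: "int \<Rightarrow> loop" where
  "lam_pow k \<equiv> fls_X_intpow (- k)"

definition mat22 :: "loop \<Rightarrow> loop \<Rightarrow> loop \<Rightarrow> loop \<Rightarrow> loop_mat" where
  "mat22 a b c d = vector [vector [a, b], vector [c, d]]"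

definition power_series :: "loop set" where
  "power_series = {f. \<forall>k<0. fls_nth f k = 0}"

definition polys :: "loop set" where
  "polys = {f. \<forall>k>0. fls_nth f k = 0}"

definition SL2_loop :: "loop_mat set" where
  "SL2_loop = {g. det g = 1}"

definition B_minus :: "loop_mat set" where
  "B_minus = {g \<in> SL2_loop. (\<forall>i j. g $ i $ j \<in> power_series) \<and> fls_nth (g $ 1 $ 2) 0 = 0}"

definition N_plus :: "loop_mat set" where
  "N_plus = {g \<in> SL2_loop. (\<forall>i j. g $ i $ j \<in> polys) \<and>
     fls_nth (g $ 1 $ 1) 0 = 1 \<and> fls_nth (g $ 2 $ 2) 0 = 1 \<and> fls_nth (g $ 2 $ 1) 0 = 0}"

definition H_minus :: "loop_mat set" where
  "H_minus = {mat22 a 0 0 (inverse a) | a. a \<in> power_series \<and> fls_nth a 0 \<noteq> 0}"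

text \<open>
  Functions on \<open>H\<^sub>-\B\<^sub>-\<close> are represented as left \<open>H\<^sub>-\<close>-invariant regular functions on the
  pro-algebraic group \<open>B\<^sub>-\<close>, extensional in the sense of \<^const>\<open>restrict\<close>.
\<close>

inductive_set regular_functions :: "(loop_mat \<Rightarrow> complex) set" where
  const: "(\<lambda>b\<in>B_minus. c) \<in> regular_functions"
| coeff: "(\<lambda>b\<in>B_minus. fls_nth (b $ i $ j) k) \<in> regular_functions"
| add: "\<phi> \<in> regular_functions \<Longrightarrow> \<psi> \<in> regular_functions \<Longrightarrow>
    (\<lambda>b\<in>B_minus. \<phi> b + \<psi> b) \<in> regular_functions"
| mult: "\<phi> \<in> regular_functions \<Longrightarrow> \<psi> \<in> regular_functions \<Longrightarrow>
    (\<lambda>b\<in>B_minus. \<phi> b * \<psi> b) \<in> regular_functions"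

definition quotient_functions :: "(loop_mat \<Rightarrow> complex) set" where
  "quotient_functions =
     {\<phi> \<in> regular_functions. \<forall>h\<in>H_minus. \<forall>b\<in>B_minus. \<phi> (h ** b) = \<phi> b}"

definition uv_cl :: "loop_mat \<Rightarrow> loop \<times> loop" where
  "uv_cl b = (THE (u, v). u \<in> power_series \<and> v \<in> power_series \<and> fls_nth v 0 = 0 \<and>
     (\<exists>h\<in>H_minus. b = h ** (mat22 1 v 0 1 ** mat22 1 0 u 1)))"

definition u_cl :: "loop_mat \<Rightarrow> loop" where
  "u_cl b = fst (uv_cl b)"

definition v_cl :: "loop_mat \<Rightarrow> loop" where
  "v_cl b = snd (uv_cl b)"

definition m_cl :: "loop_mat \<Rightarrow> loop" where
  "m_cl b = - lam_pow 1 * v_cl b * inverse (1 + u_cl b * v_cl b)"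

text \<open>
  Indices are shifted by one, here and for the generators of the deformed algebra below:
  \<open>u_coord i\<close> is the coordinate function \<open>u\<^sub>i\<^sub>+\<^sub>1\<close>.
\<close>

definition u_coord :: "nat \<Rightarrow> loop_mat \<Rightarrow> complex" where
  "u_coord i = (\<lambda>b\<in>B_minus. (- 1) ^ i * fls_nth (u_cl b) (int i))"

definition m_coord :: "nat \<Rightarrow> loop_mat \<Rightarrow> complex" where
  "m_coord i = (\<lambda>b\<in>B_minus. (- 1) ^ i * fls_nth (m_cl b) (int i))"

text \<open>
  \<open>H\<^sub>-\B\<^sub>-\<close> sits in \<open>H\<^sub>-\G/N\<^sub>+\<close> as the image of the cell \<open>B\<^sub>- N\<^sub>+\<close>; a function on it is pulled
  back to the right \<open>N\<^sub>+\<close>-invariant function \<open>bn \<mapsto> \<phi>(b)\<close> on this cell of \<open>G\<close>.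
\<close>

definition lift_fun :: "(loop_mat \<Rightarrow> complex) \<Rightarrow> loop_mat \<Rightarrow> complex" where
  "lift_fun \<phi> g = \<phi> (THE b. b \<in> B_minus \<and> (\<exists>n\<in>N_plus. g = b ** n))"

definition has_velocity :: "(complex \<Rightarrow> loop_mat) \<Rightarrow> loop_mat \<Rightarrow> bool" where
  "has_velocity \<gamma> V \<longleftrightarrow> (\<forall>i j k.
     ((\<lambda>t. fls_nth (\<gamma> t $ i $ j) k) has_field_derivative fls_nth (V $ i $ j) k) (at 0))"

text \<open>
  Curves \<open>t \<mapsto> \<beta>(t)\<nu>(t)\<close> in the cell.  The degree bound reflects the ind-group structure of
  \<open>N\<^sub>+\<close>; it makes every coefficient of the product a fixed finite expression in those of the
  factors.
\<close>

definition cell_curve :: "(complex \<Rightarrow> loop_mat) \<Rightarrow> (complex \<Rightarrow> loop_mat) \<Rightarrow> bool" where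
  "cell_curve \<beta> \<nu> \<longleftrightarrow>
     (\<forall>t. \<beta> t \<in> B_minus \<and> \<nu> t \<in> N_plus) \<and>
     (\<exists>V. has_velocity \<beta> V) \<and> (\<exists>W. has_velocity \<nu> W) \<and>
     (\<exists>d. \<forall>t i j. \<forall>k < - d. fls_nth (\<nu> t $ i $ j) k = 0)"

text \<open>
  The differential at \<open>g\<close> of the pullback of \<open>\<phi>\<close>, applied to a tangent vector \<open>V\<close> of \<open>G\<close> at \<open>g\<close>
  (so \<open>V = gX\<close> or \<open>V = Xg\<close> with \<open>X\<close> of trace zero).
\<close>

definition cell_deriv :: "(loop_mat \<Rightarrow> complex) \<Rightarrow> loop_mat \<Rightarrow> loop_mat \<Rightarrow> complex" where
  "cell_deriv \<phi> g V = (THE D. \<forall>\<beta> \<nu>.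
     cell_curve \<beta> \<nu> \<and> \<beta> 0 ** \<nu> 0 = g \<and> has_velocity (\<lambda>t. \<beta> t ** \<nu> t) V \<longrightarrow>
     ((\<lambda>t. lift_fun \<phi> (\<beta> t ** \<nu> t)) has_field_derivative D) (at 0))"

definition E_loop :: "int \<Rightarrow> loop_mat" where "E_loop k = mat22 0 (lam_pow k) 0 0"
definition F_loop :: "int \<Rightarrow> loop_mat" where "F_loop k = mat22 0 0 (lam_pow k) 0"
definition H_loop :: "int \<Rightarrow> loop_mat" where "H_loop k = mat22 (lam_pow k) 0 0 (- lam_pow k)"

text \<open>
  The two \<open>r\<close>-matrices, evaluated against a function \<open>w\<close> of two Lie algebra elements: each
  summand \<open>X \<and> Y\<close> contributes \<open>w X Y\<close>.
\<close>

definition r_std :: "(loop_mat \<Rightarrow> loop_mat \<Rightarrow> complex) \<Rightarrow> complex" where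
  "r_std w = 1/2 *
     ((\<Sum>\<^sub>\<infinity>k\<in>{0..}. w (E_loop k) (F_loop (- k))) +
      (\<Sum>\<^sub>\<infinity>k\<in>{1..}. w (F_loop k) (E_loop (- k))) +
      1/2 * (\<Sum>\<^sub>\<infinity>k\<in>{1..}. w (H_loop k) (H_loop (- k))))"

definition r_infty :: "(loop_mat \<Rightarrow> loop_mat \<Rightarrow> complex) \<Rightarrow> complex" where
  "r_infty w = 1/2 *
     ((\<Sum>\<^sub>\<infinity>k\<in>UNIV. w (E_loop k) (F_loop (- k))) +
      1/2 * (\<Sum>\<^sub>\<infinity>k\<in>{1..}. w (H_loop k) (H_loop (- k))))"

definition wedge_pairing ::
  "(loop_mat \<Rightarrow> complex) \<Rightarrow> (loop_mat \<Rightarrow> complex) \<Rightarrow> loop_mat \<Rightarrow> loop_mat \<Rightarrow> loop_mat \<Rightarrow> complex"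
where
  "wedge_pairing \<phi> \<psi> g V W =
     cell_deriv \<phi> g V * cell_deriv \<psi> g W - cell_deriv \<phi> g W * cell_deriv \<psi> g V"

definition P_infty ::
  "(loop_mat \<Rightarrow> complex) \<Rightarrow> (loop_mat \<Rightarrow> complex) \<Rightarrow> loop_mat \<Rightarrow> complex"
where
  "P_infty \<phi> \<psi> g =
     r_std (\<lambda>X Y. wedge_pairing \<phi> \<psi> g (g ** X) (g ** Y)) -
     r_infty (\<lambda>X Y. wedge_pairing \<phi> \<psi> g (X ** g) (Y ** g))"

definition bracket_infty ::
  "(loop_mat \<Rightarrow> complex) \<Rightarrow> (loop_mat \<Rightarrow> complex) \<Rightarrow> loop_mat \<Rightarrow> complex"
where
  "bracket_infty \<phi> \<psi> = (\<lambda>b\<in>B_minus. P_infty \<phi> \<psi> b)"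

text \<open>A set \<open>R\<close> of functions on \<open>S\<close> as a commutative Poisson algebra under pointwise operations.\<close>

definition poisson_algebra ::
  "'p set \<Rightarrow> ('p \<Rightarrow> complex) set \<Rightarrow>
   (('p \<Rightarrow> complex) \<Rightarrow> ('p \<Rightarrow> complex) \<Rightarrow> 'p \<Rightarrow> complex) \<Rightarrow> bool"
where
  "poisson_algebra S R br \<longleftrightarrow>
     R \<subseteq> extensional S \<and>
     (\<forall>c. (\<lambda>s\<in>S. c) \<in> R) \<and>
     (\<forall>\<phi>\<in>R. \<forall>\<psi>\<in>R. (\<lambda>s\<in>S. \<phi> s + \<psi> s) \<in> R \<and> (\<lambda>s\<in>S. \<phi> s * \<psi> s) \<in> R \<and> br \<phi> \<psi> \<in> R) \<and>
     (\<forall>\<phi>\<in>R. \<forall>\<psi>\<in>R. \<forall>\<rho>\<in>R. \<forall>c. \<forall>s\<in>S.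
        br \<phi> \<psi> s = - br \<psi> \<phi> s \<and>
        br (\<lambda>s\<in>S. \<phi> s + \<psi> s) \<rho> s = br \<phi> \<rho> s + br \<psi> \<rho> s \<and>
        br (\<lambda>s\<in>S. c * \<phi> s) \<rho> s = c * br \<phi> \<rho> s \<and>
        br (\<lambda>s\<in>S. \<phi> s * \<psi> s) \<rho> s = \<phi> s * br \<psi> \<rho> s + br \<phi> \<rho> s * \<psi> s \<and>
        br \<phi> (br \<psi> \<rho>) s + br \<psi> (br \<rho> \<phi>) s + br \<rho> (br \<phi> \<psi>) s = 0)"

text \<open>\<open>\<complex>[q, q\<^sup>-\<^sup>1]\<close> as the group algebra of the integers.\<close>

type_synonym laurent = "int \<Rightarrow>\<^sub>0 complex"

definition qpow :: "int \<Rightarrow> laurent" where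
  "qpow k = Poly_Mapping.single k 1"

definition laurent_const :: "complex \<Rightarrow> laurent" where
  "laurent_const c = Poly_Mapping.single 0 c"

definition laurent_algebra :: "(laurent \<Rightarrow> 'u \<Rightarrow> 'u::ring_1) \<Rightarrow> bool" where
  "laurent_algebra sc \<longleftrightarrow> module sc \<and>
     (\<forall>c x y. sc c x * y = sc c (x * y) \<and> x * sc c y = sc c (x * y))"

definition free_module :: "(laurent \<Rightarrow> 'u \<Rightarrow> 'u::ring_1) \<Rightarrow> bool" where
  "free_module sc \<longleftrightarrow> (\<exists>B. \<not> module.dependent sc B \<and> module.span sc B = UNIV)"

definition cong_q1 :: "(laurent \<Rightarrow> 'u \<Rightarrow> 'u::ring_1) \<Rightarrow> ('u \<times> 'u) set" where
  "cong_q1 sc = {(x, y). \<exists>z. x - y = sc (qpow 1 - 1) z}"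

definition class_q1 :: "(laurent \<Rightarrow> 'u \<Rightarrow> 'u::ring_1) \<Rightarrow> 'u \<Rightarrow> 'u set" where
  "class_q1 sc x = cong_q1 sc `` {x}"

definition specialization_iso ::
  "(laurent \<Rightarrow> 'u \<Rightarrow> 'u::ring_1) \<Rightarrow> 'p set \<Rightarrow> ('p \<Rightarrow> complex) set \<Rightarrow>
   ('u set \<Rightarrow> 'p \<Rightarrow> complex) \<Rightarrow> bool"
where
  "specialization_iso sc S R \<theta> \<longleftrightarrow>
     bij_betw \<theta> (UNIV // cong_q1 sc) R \<and>
     \<theta> (class_q1 sc 1) = (\<lambda>s\<in>S. 1) \<and>
     (\<forall>x y. \<theta> (class_q1 sc (x + y)) = (\<lambda>s\<in>S. \<theta> (class_q1 sc x) s + \<theta> (class_q1 sc y) s)) \<and>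
     (\<forall>x y. \<theta> (class_q1 sc (x * y)) = (\<lambda>s\<in>S. \<theta> (class_q1 sc x) s * \<theta> (class_q1 sc y) s)) \<and>
     (\<forall>c x. \<theta> (class_q1 sc (sc (laurent_const c) x)) = (\<lambda>s\<in>S. c * \<theta> (class_q1 sc x) s))"

text \<open>
  The element \<open>c\<close> in the last clause exists since the specialization is commutative, and is
  unique since the module is free.
\<close>

definition quantum_deformation ::
  "(laurent \<Rightarrow> 'u \<Rightarrow> 'u::ring_1) \<Rightarrow> 'p set \<Rightarrow> ('p \<Rightarrow> complex) set \<Rightarrow>
   (('p \<Rightarrow> complex) \<Rightarrow> ('p \<Rightarrow> complex) \<Rightarrow> 'p \<Rightarrow> complex) \<Rightarrow>
   ('u set \<Rightarrow> 'p \<Rightarrow> complex) \<Rightarrow> bool"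
where
  "quantum_deformation sc S R br \<theta> \<longleftrightarrow>
     poisson_algebra S R br \<and>
     laurent_algebra sc \<and> free_module sc \<and> specialization_iso sc S R \<theta> \<and>
     (\<forall>a b c. a * b - b * a = sc (qpow 1 - 1) c \<longrightarrow>
        br (\<theta> (class_q1 sc a)) (\<theta> (class_q1 sc b)) = \<theta> (class_q1 sc c))"

datatype gen = GenU nat | GenM nat

text \<open>Words form the free monoid, so \<open>word \<Rightarrow>\<^sub>0 laurent\<close> with convolution is the free algebra.\<close>

datatype word = Word (letters: "gen list")

instantiation word :: monoid_add
begin
definition zero_word :: word where "0 = Word []"
definition plus_word :: "word \<Rightarrow> word \<Rightarrow> word" where
  "v + w = Word (letters v @ letters w)"
instance by standard (simp_all add: zero_word_def plus_word_def)
end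

type_synonym free_algebra = "word \<Rightarrow>\<^sub>0 laurent"

definition free_gen :: "gen \<Rightarrow> free_algebra" where
  "free_gen x = Poly_Mapping.single (Word [x]) 1"

definition free_scalar :: "laurent \<Rightarrow> free_algebra" where
  "free_scalar c = Poly_Mapping.single 0 c"

text \<open>
  The relations live in formal power series in two commuting central variables, the outer one
  being \<open>\<lambda>\<^sup>-\<^sup>1\<close> and the inner one \<open>\<mu>\<^sup>-\<^sup>1\<close>.  The series \<open>ser_lam s\<close> and \<open>ser_mu s\<close> are
  \<open>\<Sum>\<^sub>i (-1)\<^sup>i s\<^sub>i \<lambda>\<^sup>-\<^sup>i\<close> and \<open>\<Sum>\<^sub>i (-1)\<^sup>i s\<^sub>i \<mu>\<^sup>-\<^sup>i\<close>.
\<close>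

type_synonym series2 = "free_algebra fps fps"

definition ser_lam :: "(nat \<Rightarrow> free_algebra) \<Rightarrow> series2" where
  "ser_lam s = Abs_fps (\<lambda>i. fps_const ((- 1) ^ i * s i))"

definition ser_mu :: "(nat \<Rightarrow> free_algebra) \<Rightarrow> series2" where
  "ser_mu s = fps_const (Abs_fps (\<lambda>i. (- 1) ^ i * s i))"

definition lam_inv :: series2 where "lam_inv = fps_X"
definition mu_inv :: series2 where "mu_inv = fps_const fps_X"

definition series_scalar :: "laurent \<Rightarrow> series2" where
  "series_scalar c = fps_const (fps_const (free_scalar c))"

definition quadratic_relator :: "laurent \<Rightarrow> (nat \<Rightarrow> free_algebra) \<Rightarrow> series2" where
  "quadratic_relator c s =
     (lam_inv * ser_lam s - mu_inv * ser_mu s) * (ser_lam s - ser_mu s) -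
     series_scalar c * (ser_lam s - ser_mu s) * (lam_inv * ser_lam s - mu_inv * ser_mu s)"

definition exchange_relator ::
  "laurent \<Rightarrow> (nat \<Rightarrow> free_algebra) \<Rightarrow> (nat \<Rightarrow> free_algebra) \<Rightarrow> series2"
where
  "exchange_relator c s s' = ser_lam s * ser_mu s' - series_scalar c * ser_mu s' * ser_lam s"

definition relator_series :: "series2 set" where
  "relator_series =
     {quadratic_relator (qpow 1) (\<lambda>i. free_gen (GenU i)),
      quadratic_relator (qpow (- 1)) (\<lambda>i. free_gen (GenM i)),
      exchange_relator (qpow (- 1)) (\<lambda>i. free_gen (GenU i)) (\<lambda>i. free_gen (GenM i))}"

definition relators :: "free_algebra set" where
  "relators = {fps_nth (fps_nth r i) j | r i j. r \<in> relator_series}"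

inductive_set relation_ideal :: "free_algebra set" where
  zero: "0 \<in> relation_ideal"
| step: "a \<in> relation_ideal \<Longrightarrow> r \<in> relators \<Longrightarrow> a + x * r * y \<in> relation_ideal"

lemma relation_ideal_add:
  assumes "a \<in> relation_ideal" "b \<in> relation_ideal"
  shows "a + b \<in> relation_ideal"
  using assms(2)
proof (induction b rule: relation_ideal.induct)
  case (step b r x y)
  then show ?case using relation_ideal.step[of "a + b" r x y] by (simp add: add.assoc)
qed (simp add: assms(1))

lemma relation_ideal_mult_left: "a \<in> relation_ideal \<Longrightarrow> z * a \<in> relation_ideal"
proof (induction a rule: relation_ideal.induct)
  case (step a r x y)
  then show ?case using relation_ideal.step[of "z * a" r "z * x" y]
    by (simp add: distrib_left mult.assoc)
qed (simp add: relation_ideal.zero)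

lemma relation_ideal_mult_right: "a \<in> relation_ideal \<Longrightarrow> a * z \<in> relation_ideal"
proof (induction a rule: relation_ideal.induct)
  case (step a r x y)
  then show ?case using relation_ideal.step[of "a * z" r x "y * z"]
    by (simp add: distrib_right mult.assoc)
qed (simp add: relation_ideal.zero)

lemma relation_ideal_uminus: "a \<in> relation_ideal \<Longrightarrow> - a \<in> relation_ideal"
  using relation_ideal_mult_left[of a "- 1"] by simp

lemma relation_ideal_diff:
  "a \<in> relation_ideal \<Longrightarrow> b \<in> relation_ideal \<Longrightarrow> a - b \<in> relation_ideal"
  using relation_ideal_add[of a "- b"] relation_ideal_uminus[of b] by simp

text \<open>The constant term is multiplicative and kills all relators, so \<open>1\<close> is not in the ideal.\<close>

lemma plus_word_eq_0_iff: "v + w = 0 \<longleftrightarrow> v = 0 \<and> w = (0 :: word)"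
  by (cases v; cases w) (simp add: zero_word_def plus_word_def)

lemma const_term_mult:
  fixes x y :: free_algebra
  shows "Poly_Mapping.lookup (x * y) 0 = Poly_Mapping.lookup x 0 * Poly_Mapping.lookup y 0"
proof -
  have "(\<Sum>w. Poly_Mapping.lookup y w when 0 = v + w) = (Poly_Mapping.lookup y 0 when v = 0)"
    for v :: word
    using plus_word_eq_0_iff[of v]
    by (cases "v = 0") (auto simp: when_def eq_commute[of 0] cong: if_cong)
  then show ?thesis
    by (simp add: lookup_mult mult_when)
qed

definition no_const_term :: "series2 \<Rightarrow> bool" where
  "no_const_term f \<longleftrightarrow> (\<forall>i j. Poly_Mapping.lookup (fps_nth (fps_nth f i) j) 0 = 0)"

lemma no_const_term_diff: "no_const_term f \<Longrightarrow> no_const_term g \<Longrightarrow> no_const_term (f - g)"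
  by (simp add: no_const_term_def lookup_minus)

lemma no_const_term_mult: "no_const_term g \<Longrightarrow> no_const_term (f * g)"
  by (simp add: no_const_term_def fps_mult_nth fps_sum_nth lookup_sum const_term_mult)

lemma no_const_term_ser:
  assumes "\<And>i. Poly_Mapping.lookup (s i) 0 = 0"
  shows "no_const_term (ser_lam s)" "no_const_term (ser_mu s)"
  using assms by (simp_all add: no_const_term_def ser_lam_def ser_mu_def const_term_mult)

lemma const_term_relator:
  assumes "r \<in> relators"
  shows "Poly_Mapping.lookup r 0 = 0"
proof -
  have gen: "Poly_Mapping.lookup (free_gen x) 0 = 0" for x
    by (simp add: free_gen_def lookup_single zero_word_def when_def)
  have "no_const_term f" if "f \<in> relator_series" for f
    using that unfolding relator_series_def quadratic_relator_def exchange_relator_def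
    by (auto intro!: no_const_term_diff no_const_term_mult no_const_term_ser gen)
  then show ?thesis
    using assms by (auto simp: relators_def no_const_term_def)
qed

lemma one_notin_relation_ideal: "1 \<notin> relation_ideal"
proof -
  have "Poly_Mapping.lookup a 0 = 0" if "a \<in> relation_ideal" for a
    using that by induction (simp_all add: lookup_add const_term_mult const_term_relator)
  then show ?thesis by (metis lookup_one_zero zero_neq_one)
qed

definition relation_eq :: "free_algebra \<Rightarrow> free_algebra \<Rightarrow> bool" where
  "relation_eq x y \<longleftrightarrow> x - y \<in> relation_ideal"

lemma equivp_relation_eq: "equivp relation_eq"
proof (rule equivpI)
  show "reflp relation_eq"
    by (simp add: reflp_def relation_eq_def relation_ideal.zero)
  show "symp relation_eq"
  proof (rule sympI)
    fix x y assume "relation_eq x y"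
    then show "relation_eq y x"
      using relation_ideal_uminus[of "x - y"] by (simp add: relation_eq_def)
  qed
  show "transp relation_eq"
  proof (rule transpI)
    fix x y z assume "relation_eq x y" "relation_eq y z"
    then show "relation_eq x z"
      using relation_ideal_add[of "x - y" "y - z"] by (simp add: relation_eq_def)
  qed
qed

quotient_type qfun = "free_algebra" / relation_eq
  by (rule equivp_relation_eq)

instantiation qfun :: ring_1
begin

lift_definition zero_qfun :: qfun is 0 .

lift_definition one_qfun :: qfun is 1 .

lift_definition plus_qfun :: "qfun \<Rightarrow> qfun \<Rightarrow> qfun" is "(+)"
proof -
  fix a b c d assume "relation_eq a b" "relation_eq c d"
  then show "relation_eq (a + c) (b + d)"
    using relation_ideal_add[of "a - b" "c - d"] by (simp add: relation_eq_def add_diff_add)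
qed

lift_definition uminus_qfun :: "qfun \<Rightarrow> qfun" is uminus
proof -
  fix a b assume "relation_eq a b"
  then show "relation_eq (- a) (- b)"
    using relation_ideal_uminus[of "a - b"] by (simp add: relation_eq_def)
qed

lift_definition minus_qfun :: "qfun \<Rightarrow> qfun \<Rightarrow> qfun" is "(-)"
proof -
  fix a b c d assume "relation_eq a b" "relation_eq c d"
  then have "(a - b) - (c - d) \<in> relation_ideal"
    unfolding relation_eq_def by (rule relation_ideal_diff)
  then show "relation_eq (a - c) (b - d)"
    by (simp add: relation_eq_def algebra_simps)
qed

lift_definition times_qfun :: "qfun \<Rightarrow> qfun \<Rightarrow> qfun" is "(*)"
proof -
  fix a b c d assume "relation_eq a b" "relation_eq c d"
  then have "(a - b) * c + b * (c - d) \<in> relation_ideal"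
    unfolding relation_eq_def
    by (intro relation_ideal_add relation_ideal_mult_left relation_ideal_mult_right)
  then show "relation_eq (a * c) (b * d)"
    by (simp add: relation_eq_def algebra_simps)
qed

instance
proof
  show "(0 :: qfun) \<noteq> 1"
  proof transfer
    show "\<not> relation_eq 0 1"
      using one_notin_relation_ideal relation_ideal_uminus[of "- 1"]
      by (auto simp: relation_eq_def)
  qed
qed (transfer; simp add: relation_eq_def relation_ideal.zero algebra_simps)+

end

lift_definition qscale :: "laurent \<Rightarrow> qfun \<Rightarrow> qfun" is "\<lambda>c x. free_scalar c * x"
proof -
  fix c x y assume "relation_eq x y"
  then show "relation_eq (free_scalar c * x) (free_scalar c * y)"
    using relation_ideal_mult_left[of "x - y" "free_scalar c"]
    by (simp add: relation_eq_def right_diff_distrib)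
qed

lift_definition q_gen :: "gen \<Rightarrow> qfun" is free_gen .

end

theory Submission
  imports Defs "HOL-Library.Multiset_Order"
begin

unbundle no Formal_Power_Series.fps_syntax

text \<open>
  The quadratic relations straighten every word into words with decreasing letters.  Vertex
      operators
  for Hall-Littlewood functions represent the algebra on a polynomial ring, where
      the decreasing words
  applied to \<open>1\<close> have distinct leading monomials; so these words form a basis and \<open>q -
      1\<close> is not a zero
  divisor.  At \<open>q = 1\<close> one gets the polynomial algebra in the coordinates \<open>u\<^sub>i\<close>, \<open>m\<^sub>i\<close>, which take
  arbitrary values on \<open>H\<^sub>-\B\<^sub>-\<close> and generate its functions.

  The commutator divided by \<open>q - 1\<close> and the geometric bracket are biderivations,
      hence it is enough to
  compare them on generators.  In the geometric bracket \<open>r\<close> does not contribute,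
      and neither do the Cartan
  terms of \<open>r\<^sub>\<infinity>\<close>.  For the remaining sum of \<open>e \<lambda>\<^sup>k \<and> f \<lambda>\<^sup>-\<^sup>k\<close> over all integers \<open>k\<close>, the truncations
  coming from the splitting into lower and upper parts convolve to divided differences,
      which leaves an
  identity in the matrix entries at \<open>\<lambda>\<close> and \<open>\<mu>\<close>.  The Jacobi identity is inherited from
      associativity.
\<close>

section \<open>Linear extensions and the coefficients of the relators\<close>

text \<open>Straightening leaves open whether ordered words satisfy further linear relations, and
  settling this by rewriting would mean resolving all overlaps of three letters. The representation
  avoids that: read coefficientwise, the quadratic relation is the exchange rule of Hall-Littlewood
  vertex operators, with parameter \<open>q\<close> for the u_i and \<open>q^-1\<close> for the m_i,
  so both families can act on one polynomial ring.

  Within one family the relation does not give a commutator outright. It links the index pair (k,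
  l+1) to (k+1, l), and antisymmetry closes the recursion near the diagonal. On the geometric side
  the same recursion arises by multiplying the generating series of the bracket by \<lambda>^-1 -
  \<mu>^-1, which clears the divided differences. The two brackets are therefore compared through
  this recursion and not through closed formulas.

  Invertibility of 2 enters because the relation with k = l has every term twice.\<close>

lemma poly_mapping_eq_sum_single:
  fixes f :: "'k \<Rightarrow>\<^sub>0 'c::comm_monoid_add"
  shows "f = (\<Sum>k\<in>Poly_Mapping.keys f. Poly_Mapping.single k (Poly_Mapping.lookup f k))"
proof (rule poly_mapping_eqI)
  fix k
  show "Poly_Mapping.lookup f k = Poly_Mapping.lookup
      (\<Sum>k\<in>Poly_Mapping.keys f. Poly_Mapping.single k (Poly_Mapping.lookup f k)) k"
    by (simp add: lookup_sum lookup_single when_def in_keys_iff if_distrib)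
qed

lemma poly_mapping_add_induct [case_names zero single add]:
  fixes f :: "'k \<Rightarrow>\<^sub>0 'c::comm_monoid_add"
  assumes "P 0" "\<And>k c. P (Poly_Mapping.single k c)" "\<And>f g. P f \<Longrightarrow> P g \<Longrightarrow> P (f + g)"
  shows "P f"
proof -
  have "P (\<Sum>k\<in>K. Poly_Mapping.single k (Poly_Mapping.lookup f k))" if "finite K" for K
    using that by (induction K rule: finite_induct) (simp_all add: assms)
  from this[OF finite_keys] show ?thesis using poly_mapping_eq_sum_single[of f] by metis
qed

text \<open>The coefficient is an argument of \<open>F\<close> instead of a scalar acting on its
  value. One construction thus serves maps into rings over different scalars, with
  \<open>at_one\<close> or \<open>fock_const\<close> applied to the coefficient on the way.\<close>

definition lin_ext :: "('k \<Rightarrow> 'c \<Rightarrow> 'b) \<Rightarrow> ('k \<Rightarrow>\<^sub>0 'c::zero) \<Rightarrow> 'b::comm_monoid_add" where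
  "lin_ext F f = (\<Sum>k\<in>Poly_Mapping.keys f. F k (Poly_Mapping.lookup f k))"

lemma lin_ext_zero [simp]: "lin_ext F 0 = 0"
  by (simp add: lin_ext_def)

lemma lin_ext_single: "(\<And>k. F k 0 = 0) \<Longrightarrow> lin_ext F (Poly_Mapping.single k c) = F k c"
  by (cases "c = 0") (simp_all add: lin_ext_def)

lemma lin_ext_add:
  assumes "\<And>k. F k 0 = 0" "\<And>k a b. F k (a + b) = F k a + F k b"
  shows "lin_ext F (f + g) = lin_ext F f + lin_ext F g"
  unfolding lin_ext_def by (rule setsum_keys_plus_distrib) (simp_all add: assms)

lemma lin_ext_mult:
  fixes F :: "'k::monoid_add \<Rightarrow> 'c::semiring_0 \<Rightarrow> 'b::semiring_0"
  assumes 0: "\<And>k. F k 0 = 0" and add: "\<And>k a b. F k (a + b) = F k a + F k b"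
    and mult: "\<And>k l a b. F (k + l) (a * b) = F k a * F l b"
  shows "lin_ext F (f * g) = lin_ext F f * lin_ext F g"
proof (induction f rule: poly_mapping_add_induct)
  case (single k c)
  show ?case
    by (induction g rule: poly_mapping_add_induct)
      (simp_all add: lin_ext_single lin_ext_add 0 add mult mult_single distrib_left)
qed (simp_all add: lin_ext_add 0 add distrib_right)

section \<open>Coefficients of the defining relations\<close>

lemma ser_lam_mult_nth:
  "fps_nth (fps_nth (ser_lam s * ser_lam s') i) j =
     (if j = 0 then \<Sum>k\<le>i. ((- 1) ^ k * s k) * ((- 1) ^ (i - k) * s' (i - k)) else 0)"
  "fps_nth (fps_nth (ser_lam s * ser_mu s') i) j = ((- 1) ^ i * s i) * ((- 1) ^ j * s' j)"
  "fps_nth (fps_nth (ser_mu s * ser_lam s') i) j = ((- 1) ^ j * s j) * ((- 1) ^ i * s' i)"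
  "fps_nth (fps_nth (ser_mu s * ser_mu s') i) j =
     (if i = 0 then \<Sum>k\<le>j. ((- 1) ^ k * s k) * ((- 1) ^ (j - k) * s' (j - k)) else 0)"
proof -
  show "fps_nth (fps_nth (ser_lam s * ser_lam s') i) j =
     (if j = 0 then \<Sum>k\<le>i. ((- 1) ^ k * s k) * ((- 1) ^ (i - k) * s' (i - k)) else 0)"
    "fps_nth (fps_nth (ser_mu s * ser_mu s') i) j =
     (if i = 0 then \<Sum>k\<le>j. ((- 1) ^ k * s k) * ((- 1) ^ (j - k) * s' (j - k)) else 0)"
    by (auto simp: ser_lam_def ser_mu_def fps_mult_nth fps_sum_nth atLeast0AtMost)
qed (simp_all add: ser_lam_def ser_mu_def)

text \<open>
  The sign makes \<open>\<lambda>\<^sup>-\<^sup>1 s(\<lambda>)\<close> the series of the shifted sequence, because \<^const>\<open>ser_lam\<close> inserts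
  alternating signs.
\<close>

definition shift_seq :: "(nat \<Rightarrow> free_algebra) \<Rightarrow> nat \<Rightarrow> free_algebra" where
  "shift_seq s i = (if i = 0 then 0 else - s (i - 1))"

lemma lam_inv_ser_lam: "lam_inv * ser_lam s = ser_lam (shift_seq s)"
  by (rule fps_ext) (auto simp: lam_inv_def ser_lam_def shift_seq_def gr0_conv_Suc)

lemma mu_inv_ser_mu: "mu_inv * ser_mu s = ser_mu (shift_seq s)"
  unfolding mu_inv_def ser_mu_def fps_const_mult
  by (rule arg_cong[where f = fps_const], rule fps_ext) (auto simp: shift_seq_def gr0_conv_Suc)

lemma series_scalar_mult_nth:
  "fps_nth (fps_nth (series_scalar c * f) i) j = free_scalar c * fps_nth (fps_nth f i) j"
  by (simp add: series_scalar_def)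

lemma quadratic_relator_expand:
  "quadratic_relator c s =
    (ser_lam (shift_seq s) * ser_lam s - ser_lam (shift_seq s) * ser_mu s
      - ser_mu (shift_seq s) * ser_lam s + ser_mu (shift_seq s) * ser_mu s)
    - series_scalar c * (ser_lam s * ser_lam (shift_seq s) - ser_lam s * ser_mu (shift_seq s)
      - ser_mu s * ser_lam (shift_seq s) + ser_mu s * ser_mu (shift_seq s))"
  unfolding quadratic_relator_def lam_inv_ser_lam mu_inv_ser_mu
  by (simp add: algebra_simps)

lemma neg_one_power_mult_mult:
  fixes x y :: "'a::ring_1"
  shows "((- 1) ^ i * x) * ((- 1) ^ j * y) = (- 1) ^ (i + j) * (x * y)"
  by (cases "even i"; cases "even j") auto

text \<open>With both indices positive, products in \<lambda> alone or \<mu> alone contribute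
  nothing. The mixed products remain, and the factor \<lambda>^-1 or \<mu>^-1 lowers one of their
  indices.\<close>

lemma quadratic_relator_nth_Suc_Suc:
  "fps_nth (fps_nth (quadratic_relator c s) (Suc i)) (Suc j) =
     (- 1) ^ Suc (i + j) * (free_scalar c * (s (Suc i) * s j + s (Suc j) * s i)
        - (s i * s (Suc j) + s j * s (Suc i)))"
  unfolding quadratic_relator_expand
  by (cases "even i"; cases "even j")
    (simp_all add: ser_lam_mult_nth series_scalar_mult_nth shift_seq_def algebra_simps)

lemma exchange_relator_nth:
  "fps_nth (fps_nth (exchange_relator c s s') i) j =
     (- 1) ^ (i + j) * (s i * s' j - free_scalar c * (s' j * s i))"
  unfolding exchange_relator_def mult.assoc
  by (cases "even i"; cases "even j")
    (simp_all add: ser_lam_mult_nth series_scalar_mult_nth algebra_simps)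

text \<open>On the boundary the products in \<lambda> alone enter as convolutions;
  \<open>s i * s 0\<close> and \<open>s 0 * s i\<close> are the mixed products that survive
  there.\<close>

lemma quadratic_relator_nth_Suc_0:
  "fps_nth (fps_nth (quadratic_relator c s) (Suc i)) 0 =
     (- 1) ^ i * (((\<Sum>k\<le>i. s k * s (i - k)) - s i * s 0)
        - free_scalar c * ((\<Sum>k\<le>i. s k * s (i - k)) - s 0 * s i))"
proof -
  have 1: "(\<Sum>k\<le>Suc i. ((- 1) ^ k * shift_seq s k) * ((- 1) ^ (Suc i - k) * s (Suc i - k))) =
      (- 1) ^ i * (\<Sum>k\<le>i. s k * s (i - k))"
    unfolding sum.atMost_Suc_shift
    by (simp add: shift_seq_def neg_one_power_mult_mult sum_distrib_left)
  have 2: "(\<Sum>k\<le>Suc i. ((- 1) ^ k * s k) * ((- 1) ^ (Suc i - k) * shift_seq s (Suc i - k))) =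
      (- 1) ^ i * (\<Sum>k\<le>i. s k * s (i - k))"
    by (simp add: shift_seq_def neg_one_power_mult_mult sum_distrib_left Suc_diff_le)
  show ?thesis
    unfolding quadratic_relator_expand fps_sub_nth fps_add_nth series_scalar_mult_nth
      ser_lam_mult_nth 1 2
    by (cases "even i") (simp_all add: shift_seq_def algebra_simps del: sum.atMost_Suc)
qed

section \<open>Straightening\<close>

lemma free_scalar_add: "free_scalar (a + b) = free_scalar a + free_scalar b"
  by (simp add: free_scalar_def single_add)

lemma free_scalar_mult: "free_scalar (a * b) = free_scalar a * free_scalar b"
  by (simp add: free_scalar_def mult_single)

lemma free_scalar_1 [simp]: "free_scalar 1 = 1"
  by (simp add: free_scalar_def)

lemma free_scalar_commute: "free_scalar c * x = x * free_scalar c"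
  unfolding free_scalar_def
  by (induction x rule: poly_mapping_add_induct)
    (simp_all add: mult_single distrib_left distrib_right mult.commute)

lemma abs_qfun_add: "abs_qfun (x + y) = abs_qfun x + abs_qfun y"
  by (simp add: plus_qfun.abs_eq)

lemma abs_qfun_mult: "abs_qfun (x * y) = abs_qfun x * abs_qfun y"
  by (simp add: times_qfun.abs_eq)

lemma abs_qfun_diff: "abs_qfun (x - y) = abs_qfun x - abs_qfun y"
  by (simp add: minus_qfun.abs_eq)

lemma abs_qfun_0: "abs_qfun 0 = 0"
  by (simp add: zero_qfun_def)

lemma abs_qfun_1: "abs_qfun 1 = 1"
  by (simp add: one_qfun_def)

lemma abs_qfun_scalar_mult: "abs_qfun (free_scalar c * x) = qscale c (abs_qfun x)"
  by (simp add: qscale.abs_eq)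

lemma abs_qfun_gen: "abs_qfun (free_gen g) = q_gen g"
  by (simp add: q_gen_def)

lemma abs_qfun_eq_0_iff: "abs_qfun x = 0 \<longleftrightarrow> x \<in> relation_ideal"
  by (simp add: zero_qfun_def qfun.abs_eq_iff relation_eq_def)

lemma laurent_algebra_qscale: "laurent_algebra qscale"
  unfolding laurent_algebra_def
proof (intro conjI allI)
  have scale: "qscale c (abs_qfun x) = abs_qfun (free_scalar c * x)" for c x
    by (simp add: abs_qfun_scalar_mult)
  show "module qscale"
  proof (rule module.intro)
    fix a b x y
    obtain x' y' where [simp]: "x = abs_qfun x'" "y = abs_qfun y'"
      by (metis Quotient_abs_rep Quotient_qfun)
    show "qscale a (x + y) = qscale a x + qscale a y"
      by (simp add: scale distrib_left flip: abs_qfun_add)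
    show "qscale (a + b) x = qscale a x + qscale b x"
      by (simp add: scale distrib_right free_scalar_add flip: abs_qfun_add)
    show "qscale a (qscale b x) = qscale (a * b) x"
      by (simp add: scale free_scalar_mult mult.assoc)
    show "qscale 1 x = x"
      by (simp add: scale)
  qed
  fix c x y
  obtain x' y' where [simp]: "x = abs_qfun x'" "y = abs_qfun y'"
    by (metis Quotient_abs_rep Quotient_qfun)
  show "qscale c x * y = qscale c (x * y)"
    by (simp add: scale mult.assoc flip: abs_qfun_mult)
  have "x' * (free_scalar c * y') = free_scalar c * (x' * y')"
    by (simp add: free_scalar_commute[of c] mult.assoc)
  then show "x * qscale c y = qscale c (x * y)"
    by (simp add: scale flip: abs_qfun_mult)
qed

interpretation qmod: module qscale
  using laurent_algebra_qscale by (simp add: laurent_algebra_def)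

lemma qscale_mult_left [simp]: "qscale c x * y = qscale c (x * y)"
  and qscale_mult_right [simp]: "x * qscale c y = qscale c (x * y)"
  using laurent_algebra_qscale by (simp_all add: laurent_algebra_def)

lemma abs_qfun_scalar: "abs_qfun (free_scalar c) = qscale c 1"
  using abs_qfun_scalar_mult[of c 1] by (simp add: abs_qfun_1)

lemma laurent_half: "laurent_const (1/2) + laurent_const (1/2) = 1"
  by (simp add: laurent_const_def flip: single_add)

text \<open>For \<open>l = k\<close> the two summands on each side of the quadratic relation
  coincide; halving yields the relation between neighbouring indices.\<close>

lemma qfun_double_cancel:
  fixes x y :: qfun
  assumes "x + x = y + y"
  shows "x = y"
proof -
  have *: "qscale (laurent_const (1/2)) (z + z) = z" for z
    by (simp add: laurent_half qmod.scale_right_distrib flip: qmod.scale_left_distrib)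
  show ?thesis using *[of x] *[of y] assms by metis
qed

text \<open>\<open>True\<close> stands for the u_i and \<open>False\<close> for the m_i. The two
  families obey the same quadratic relation with inverse parameters, so each argument is made once
  for a flag \<open>c\<close> and the parameter \<open>quad_par c\<close>.\<close>

fun gen_of :: "bool \<Rightarrow> nat \<Rightarrow> gen" where
  "gen_of True = GenU"
| "gen_of False = GenM"

fun quad_par :: "bool \<Rightarrow> laurent" where
  "quad_par True = qpow 1"
| "quad_par False = qpow (- 1)"

lemma relatorI: "r \<in> relator_series \<Longrightarrow> abs_qfun (fps_nth (fps_nth r i) j) = 0"
proof -
  assume "r \<in> relator_series"
  then have "fps_nth (fps_nth r i) j \<in> relators" by (auto simp: relators_def)
  from relation_ideal.step[OF relation_ideal.zero this, of 1 1] show ?thesis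
    by (simp add: abs_qfun_eq_0_iff)
qed

lemma quadratic_relator_in:
  "quadratic_relator (quad_par c) (\<lambda>i. free_gen (gen_of c i)) \<in> relator_series"
  by (cases c) (simp_all add: relator_series_def)

lemma abs_qfun_sign_eq_0: "abs_qfun ((- 1) ^ n * x) = 0 \<longleftrightarrow> abs_qfun x = 0"
  by (cases "even n") (auto simp: uminus_qfun.abs_eq[symmetric])

lemma q_quadratic:
  "q_gen (gen_of c k) * q_gen (gen_of c (Suc l)) + q_gen (gen_of c l) * q_gen (gen_of c (Suc k)) =
   qscale (quad_par c) (q_gen (gen_of c (Suc k)) * q_gen (gen_of c l) +
     q_gen (gen_of c (Suc l)) * q_gen (gen_of c k))"
  using relatorI[OF quadratic_relator_in, of c "Suc k" "Suc l"]
  unfolding quadratic_relator_nth_Suc_Suc abs_qfun_sign_eq_0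
  by (simp add: abs_qfun_diff abs_qfun_add abs_qfun_mult abs_qfun_scalar abs_qfun_gen)

lemma qpow_add: "qpow (a + b) = qpow a * qpow b"
  by (simp add: qpow_def mult_single)

lemma qpow_0 [simp]: "qpow 0 = 1"
  by (simp add: qpow_def)

lemma q_exchange:
  "q_gen (GenM j) * q_gen (GenU i) = qscale (qpow 1) (q_gen (GenU i) * q_gen (GenM j))"
proof -
  have "exchange_relator (qpow (- 1)) (\<lambda>i. free_gen (GenU i)) (\<lambda>i. free_gen (GenM i))
      \<in> relator_series"
    by (simp add: relator_series_def)
  from relatorI[OF this, of i j]
  have "q_gen (GenU i) * q_gen (GenM j) = qscale (qpow (- 1)) (q_gen (GenM j) * q_gen (GenU i))"
    unfolding exchange_relator_nth abs_qfun_sign_eq_0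
    by (simp add: abs_qfun_diff abs_qfun_add abs_qfun_mult abs_qfun_scalar abs_qfun_gen)
  then show ?thesis
    by (simp flip: qpow_add)
qed

lemma q_exchange_left:
  "q_gen (GenM j) * (q_gen (GenU i) * x) = qscale (qpow 1) (q_gen (GenU i) * (q_gen (GenM j) * x))"
  by (simp only: mult.assoc[symmetric] q_exchange qscale_mult_left)

definition qword :: "gen list \<Rightarrow> qfun" where
  "qword ws = prod_list (map q_gen ws)"

lemma qword_append: "qword (us @ vs) = qword us * qword vs"
  by (simp add: qword_def)

lemma qword_Cons: "qword (g # ws) = q_gen g * qword ws"
  by (simp add: qword_def)

lemma qword_Nil [simp]: "qword [] = 1"
  by (simp add: qword_def)

lemma abs_qfun_single: "abs_qfun (Poly_Mapping.single (Word ws) c) = qscale c (qword ws)"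
proof -
  have word: "abs_qfun (Poly_Mapping.single (Word ws) 1) = qword ws"
  proof (induction ws)
    case Nil
    then show ?case by (simp add: abs_qfun_1 flip: zero_word_def)
  next
    case (Cons g ws)
    have "Poly_Mapping.single (Word (g # ws)) 1 =
        free_gen g * Poly_Mapping.single (Word ws) (1 :: laurent)"
      by (simp add: free_gen_def mult_single plus_word_def)
    then show ?case using Cons by (simp add: abs_qfun_mult abs_qfun_gen qword_Cons)
  qed
  have "Poly_Mapping.single (Word ws) c = free_scalar c * Poly_Mapping.single (Word ws) 1"
    by (simp add: free_scalar_def mult_single)
  then show ?thesis by (simp only: abs_qfun_scalar_mult word)
qed

lemma qfun_word_induct [case_names word add]:
  assumes "\<And>c ws. P (qscale c (qword ws))" "\<And>x y. P x \<Longrightarrow> P y \<Longrightarrow> P (x + y)"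
  shows "P x"
proof -
  obtain f where x: "x = abs_qfun f"
    by (metis Quotient_abs_rep Quotient_qfun)
  have "P (abs_qfun f)"
  proof (induction f rule: poly_mapping_add_induct)
    case zero
    then show ?case using assms(1)[of 0] by (simp add: abs_qfun_0)
  next
    case (single w c)
    then show ?case using assms(1) by (cases w) (simp add: abs_qfun_single)
  qed (simp add: abs_qfun_add assms(2))
  then show ?thesis by (simp add: x)
qed

section \<open>Order on the generators and termination of the rewriting\<close>

instantiation gen :: linorder
begin

text \<open>Every m lies below every u, so a decreasing word lists the u's before the m's, each with
  falling index. Within a kind larger indices are larger, which is what makes the terms of a vertex
  operator comparable later.\<close>

definition less_eq_gen :: "gen \<Rightarrow> gen \<Rightarrow> bool" where
  "g \<le> h \<longleftrightarrow> (case (g, h) of (GenM i, GenM j) \<Rightarrow> i \<le> j | (GenU i, GenU j) \<Rightarrow> i \<le> j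
     | (GenM _, GenU _) \<Rightarrow> True | (GenU _, GenM _) \<Rightarrow> False)"

definition less_gen :: "gen \<Rightarrow> gen \<Rightarrow> bool" where
  "g < h \<longleftrightarrow> g \<le> h \<and> \<not> h \<le> g" for g h :: gen

instance
  by standard (auto simp: less_eq_gen_def less_gen_def split: gen.splits)

end

lemma gen_le_simps [simp]:
  "GenM i \<le> GenM j \<longleftrightarrow> i \<le> j" "GenU i \<le> GenU j \<longleftrightarrow> i \<le> j" "GenM i \<le> GenU j" "\<not> GenU i \<le> GenM j"
  "GenM i < GenM j \<longleftrightarrow> i < j" "GenU i < GenU j \<longleftrightarrow> i < j" "GenM i < GenU j" "\<not> GenU i < GenM j"
  by (auto simp: less_eq_gen_def less_gen_def)

abbreviation "decreasing \<equiv> sorted_wrt (\<lambda>g h :: gen. h \<le> g)"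

lemma not_decreasingD:
  "\<not> decreasing ws \<Longrightarrow> \<exists>us g h vs. ws = us @ g # h # vs \<and> g < h"
proof (induction ws)
  case (Cons g ws)
  show ?case
  proof (cases "decreasing ws")
    case True
    with Cons.prems obtain h hs where h: "ws = h # hs" "\<not> h \<le> g"
      by (cases ws) (auto intro: order_trans)
    then have "g # ws = [] @ g # h # hs \<and> g < h" by simp
    then show ?thesis by blast
  next
    case False
    with Cons.IH obtain us x y vs where "ws = us @ x # y # vs" "x < y" by blast
    then have "g # ws = (g # us) @ x # y # vs \<and> x < y" by simp
    then show ?thesis by blast
  qed
qed simp

text \<open>This is the sum of i * f(x_i) with positions counted from 0: prepending a letter moves
  every later one by one place.\<close>

fun pos_sum :: "('a \<Rightarrow> nat) \<Rightarrow> 'a list \<Rightarrow> nat" where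
  "pos_sum f [] = 0"
| "pos_sum f (x # xs) = sum_list (map f xs) + pos_sum f xs"

lemma pos_sum_append:
  "pos_sum f (us @ vs) = pos_sum f us + pos_sum f vs + length us * sum_list (map f vs)"
  by (induction us) (auto simp: algebra_simps)

fun gen_kind :: "gen \<Rightarrow> bool" where
  "gen_kind (GenU i) = True" | "gen_kind (GenM i) = False"

fun gen_index :: "gen \<Rightarrow> nat" where
  "gen_index (GenU i) = i" | "gen_index (GenM i) = i"

lemma gen_kind_index [simp]:
  "gen_kind (gen_of c i) = c" "gen_index (gen_of c i) = i" "gen_of (gen_kind g) (gen_index g) = g"
proof -
  show "gen_kind (gen_of c i) = c" "gen_index (gen_of c i) = i" by (cases c; simp)+
  show "gen_of (gen_kind g) (gen_index g) = g" by (cases g) simp_all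
qed

text \<open>The order is lexicographic because an exchange of m and u may increase the second sum
  while it moves a u to the left. The quadratic steps keep the first sum and lower the
  second.\<close>

definition word_measure :: "(gen list \<times> gen list) set" where
  "word_measure = measures [pos_sum (\<lambda>g. of_bool (gen_kind g)), pos_sum gen_index]"

lemma pos_sum_replace_pair:
  assumes "f g + f h = f g' + f h'"
  shows "pos_sum f (us @ g' # h' # vs) + f h = pos_sum f (us @ g # h # vs) + f h'"
proof -
  have "f g' + (f h' + s) = f g + (f h + s)" for s
    using assms by simp
  then show ?thesis by (simp add: pos_sum_append)
qed

lemma gen_less_cases:
  assumes "g < h"
  obtains j i where "g = GenM j" "h = GenU i"
  | c k l where "g = gen_of c k" "h = gen_of c l" "k < l"
  using assms that(1) that(2)[of True] that(2)[of False] by (cases g; cases h) auto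

text \<open>
  Each rewriting step replaces a factor \<open>g h\<close> with \<open>g < h\<close> by factors of the same total index
  whose right entry is smaller, so the position-weighted sums decrease.
\<close>

lemma qword_in_span: "qword ws \<in> qmod.span (qword ` Collect decreasing)"
proof -
  have "wf word_measure" by (simp add: word_measure_def)
  then show ?thesis
  proof (induction ws rule: wf_induct_rule)
    case (less ws)
    let ?S = "qmod.span (qword ` Collect decreasing)"
    show ?case
    proof (cases "decreasing ws")
      case True
      then show ?thesis by (auto intro: qmod.span_base)
    next
      case False
      then obtain us g h vs where ws: "ws = us @ g # h # vs" and "g < h"
        using not_decreasingD by blast
      from \<open>g < h\<close> show ?thesis
      proof (cases rule: gen_less_cases)
        case (1 j i)
        have "qword ws = qscale (qpow 1) (qword (us @ h # g # vs))"
          by (simp add: ws 1 qword_append qword_Cons q_exchange_left)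
        moreover have "(us @ h # g # vs, ws) \<in> word_measure"
          unfolding word_measure_def ws 1
          using pos_sum_replace_pair[of "\<lambda>g. of_bool (gen_kind g)" "GenM j" "GenU i" "GenU i"
              "GenM j" us vs]
          by simp
        ultimately show ?thesis using less by (auto intro: qmod.span_scale)
      next
        case (2 c k l)
        obtain l' where l: "l = Suc l'" using \<open>k < l\<close> by (cases l) auto
        have pair: "qword (us @ gen_of c i # gen_of c j # vs) \<in> ?S"
          if "i + j = k + l" "j < l" for i j
        proof (rule less.IH)
          show "(us @ gen_of c i # gen_of c j # vs, ws) \<in> word_measure"
            unfolding word_measure_def ws 2
            using that pos_sum_replace_pair[of gen_index "gen_of c k" "gen_of c l" "gen_of c i"
                "gen_of c j" us vs]
              pos_sum_replace_pair[of "\<lambda>g. of_bool (gen_kind g)" "gen_of c k" "gen_of c l"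
                  "gen_of c i" "gen_of c j" us vs]
            by simp
        qed
        let ?q = "\<lambda>i j. qword us * (q_gen (gen_of c i) * q_gen (gen_of c j)) * qword vs"
        have q: "qword (us @ gen_of c i # gen_of c j # vs) = ?q i j" for i j
          by (simp add: qword_append qword_Cons mult.assoc)
        have "qword us * (q_gen (gen_of c k) * q_gen (gen_of c (Suc l')) +
              q_gen (gen_of c l') * q_gen (gen_of c (Suc k))) * qword vs =
            qword us * qscale (quad_par c) (q_gen (gen_of c (Suc k)) * q_gen (gen_of c l') +
              q_gen (gen_of c (Suc l')) * q_gen (gen_of c k)) * qword vs"
          by (simp only: q_quadratic)
        then have rel: "?q k l + ?q l' (Suc k) = qscale (quad_par c) (?q (Suc k) l' + ?q l k)"
          by (simp add: l distrib_left distrib_right mult.assoc)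
        show ?thesis
        proof (cases "l' = k")
          case True
          \<comment> \<open>For neighbouring indices the relation is twice this identity.\<close>
          have "?q k l = qscale (quad_par c) (?q l k)"
            using rel unfolding l True qmod.scale_right_distrib by (rule qfun_double_cancel)
          then show ?thesis
            unfolding ws 2 q using pair[of l k] \<open>k < l\<close> by (simp add: q qmod.span_scale)
        next
          case False
          \<comment> \<open>Here \<open>l\<close> is at least \<open>k + 2\<close>, so the
            right-hand indices \<open>l'\<close>, \<open>k\<close> and \<open>Suc k\<close> are all
            below \<open>l\<close> and the induction hypothesis covers all three products.\<close>
          have "?q k l = qscale (quad_par c) (?q (Suc k) l' + ?q l k) - ?q l' (Suc k)"
            using rel by (simp add: eq_diff_eq)
          moreover have "?q (Suc k) l' \<in> ?S" "?q l k \<in> ?S" "?q l' (Suc k) \<in> ?S"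
            using pair[of "Suc k" l'] pair[of l k] pair[of l' "Suc k"] False \<open>k < l\<close> l
            by (simp_all add: q)
          ultimately show ?thesis
            unfolding ws 2 q by (simp add: qmod.span_scale qmod.span_add qmod.span_diff)
        qed
      qed
    qed
  qed
qed

definition pbw_word :: "gen multiset \<Rightarrow> gen list" where
  "pbw_word M = rev (sorted_list_of_multiset M)"

lemma mset_pbw_word [simp]: "mset (pbw_word M) = M"
  by (simp add: pbw_word_def)

lemma decreasing_pbw_word [simp]: "decreasing (pbw_word M)"
  by (simp add: pbw_word_def sorted_wrt_rev)

lemma decreasing_eq_pbw_word: "decreasing ws \<Longrightarrow> ws = pbw_word (mset ws)"
proof -
  assume "decreasing ws"
  then have "sorted (rev ws)" by (simp add: sorted_wrt_rev)
  then have "sorted_list_of_multiset (mset (rev ws)) = rev ws"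
    by (metis sorted_list_of_multiset_mset sorted_sort_id)
  then show ?thesis by (simp add: pbw_word_def)
qed

definition pbw :: "gen multiset \<Rightarrow> qfun" where
  "pbw M = qword (pbw_word M)"

lemma span_range_pbw: "qmod.span (range pbw) = UNIV"
proof -
  have "qword ` Collect decreasing \<subseteq> range pbw"
    using decreasing_eq_pbw_word by (auto simp: pbw_def image_iff) metis
  then have "qword ws \<in> qmod.span (range pbw)" for ws
    using qword_in_span qmod.span_mono by blast
  then have "x \<in> qmod.span (range pbw)" for x
    by (induction x rule: qfun_word_induct) (auto intro: qmod.span_scale qmod.span_add)
  then show ?thesis by blast
qed

section \<open>Vertex operators\<close>

type_synonym fock = "gen multiset \<Rightarrow>\<^sub>0 laurent"

definition fock_var :: "gen \<Rightarrow> fock" where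
  "fock_var g = Poly_Mapping.single {#g#} 1"

definition fock_const :: "laurent \<Rightarrow> fock" where
  "fock_const c = Poly_Mapping.single 0 c"

lemma fock_const_simps [simp]:
  "fock_const 0 = 0" "fock_const 1 = 1"
  by (simp_all add: fock_const_def)

lemma fock_const_add: "fock_const (a + b) = fock_const a + fock_const b"
  by (simp add: fock_const_def single_add)

lemma fock_const_mult: "fock_const (a * b) = fock_const a * fock_const b"
  by (simp add: fock_const_def mult_single)

lemma fock_induct [case_names const var add]:
  assumes "\<And>c. P (fock_const c)" "\<And>g f. P f \<Longrightarrow> P (fock_var g * f)"
    "\<And>f g. P f \<Longrightarrow> P g \<Longrightarrow> P (f + g)"
  shows "P f"
proof (induction f rule: poly_mapping_add_induct)
  case zero
  show ?case using assms(1)[of 0] by simp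
next
  case (single M c)
  show ?case
  proof (induction M)
    case empty
    show ?case using assms(1)[of c] by (simp add: fock_const_def)
  next
    case (add g M)
    have "fock_var g * Poly_Mapping.single M c = Poly_Mapping.single (add_mset g M) c"
      by (simp add: fock_var_def mult_single)
    then show ?case using assms(2)[OF add, of g] by simp
  qed
qed (rule assms(3))

text \<open>
  Vertex operators for Hall-Littlewood functions: with \<open>x(z) = \<Sum>\<^sub>n x\<^sub>n z\<^sup>n\<close>, the homomorphism
  \<open>shift_hom\<close> multiplies \<open>x(z)\<close> by \<open>(1 - z/w) / (1 - p z/w)\<close>, expanded in \<open>w\<^sup>-\<^sup>1\<close>, and \<open>raise c k f\<close>
  is the coefficient of \<open>w\<^sup>k\<close> in \<open>x(w)\<close> times the image of \<open>f\<close>.  The factor \<open>cross_factor\<close> on the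
  variables of the other kind produces the exchange relation.
\<close>

definition vertex_coeff :: "laurent \<Rightarrow> nat \<Rightarrow> laurent" where
  "vertex_coeff p a = (if a = 0 then 1 else (p - 1) * p ^ (a - 1))"

definition cross_factor :: "bool \<Rightarrow> laurent" where
  "cross_factor c = (if c then 1 else qpow 1)"

text \<open>The polynomial variable stands for w^-1. The image of x_n is the coefficient of z^n in
  x(z) (1 - z/w) / (1 - p z/w); it is a polynomial because x(z) has no negative powers, and
  \<open>vertex_coeff\<close> comes from the geometric series.\<close>

definition shift_var :: "bool \<Rightarrow> gen \<Rightarrow> fock poly" where
  "shift_var c g = (if gen_kind g = c
     then \<Sum>a\<le>gen_index g. monom (fock_const (vertex_coeff (quad_par c) a) *
       fock_var (gen_of c (gen_index g - a))) a
     else [:fock_const (cross_factor c) * fock_var g:])"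

definition shift_hom :: "bool \<Rightarrow> fock \<Rightarrow> fock poly" where
  "shift_hom c = lin_ext (\<lambda>M a. smult (fock_const a) (\<Prod>g\<in>#M. shift_var c g))"

lemma shift_hom_add: "shift_hom c (f + g) = shift_hom c f + shift_hom c g"
  unfolding shift_hom_def by (rule lin_ext_add) (simp_all add: fock_const_add smult_add_left)

lemma shift_hom_mult: "shift_hom c (f * g) = shift_hom c f * shift_hom c g"
  unfolding shift_hom_def
  by (rule lin_ext_mult) (simp_all add: fock_const_add smult_add_left fock_const_mult mult.commute)

lemma shift_hom_const: "shift_hom c (fock_const a) = [:fock_const a:]"
  unfolding shift_hom_def fock_const_def[of a]
  by (subst lin_ext_single) (simp_all add: fock_const_def)

lemma shift_hom_var: "shift_hom c (fock_var g) = shift_var c g"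
  unfolding shift_hom_def fock_var_def by (subst lin_ext_single) simp_all

definition shift_comp :: "bool \<Rightarrow> nat \<Rightarrow> fock \<Rightarrow> fock" where
  "shift_comp c i f = coeff (shift_hom c f) i"

lemma shift_comp_add: "shift_comp c i (f + g) = shift_comp c i f + shift_comp c i g"
  by (simp add: shift_comp_def shift_hom_add)

lemma shift_comp_0 [simp]: "shift_comp c i 0 = 0"
  using shift_comp_add[of c i 0 0] by simp

lemma shift_comp_sum: "shift_comp c i (\<Sum>x\<in>A. F x) = (\<Sum>x\<in>A. shift_comp c i (F x))"
  by (induction A rule: infinite_finite_induct) (simp_all add: shift_comp_add)

lemma shift_comp_mult:
  "shift_comp c i (f * g) = (\<Sum>a\<le>i. shift_comp c a f * shift_comp c (i - a) g)"
  by (simp add: shift_comp_def shift_hom_mult coeff_mult)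

lemma shift_comp_const: "shift_comp c i (fock_const a) = (if i = 0 then fock_const a else 0)"
  by (simp add: shift_comp_def shift_hom_const coeff_pCons split: nat.splits)

lemma shift_comp_const_mult: "shift_comp c i (fock_const a * f) = fock_const a * shift_comp c i f"
  by (simp add: shift_comp_def shift_hom_mult shift_hom_const)

lemma shift_comp_var:
  "shift_comp c i (fock_var (gen_of d n)) =
     (if d = c then if i \<le> n then fock_const (vertex_coeff (quad_par c) i) * fock_var (gen_of c
         (n - i))
        else 0
      else if i = 0 then fock_const (cross_factor c) * fock_var (gen_of d n) else 0)"
  by (simp add: shift_comp_def shift_hom_var shift_var_def coeff_sum coeff_pCons split: nat.splits)

lemma shift_comp_commute_var:
  "shift_comp c i (shift_comp d j (fock_var g)) = shift_comp d j (shift_comp c i (fock_var g))"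
proof -
  obtain e n where g: "g = gen_of e n" by (metis gen_kind_index(3))
  show ?thesis
    unfolding g
    by (cases "c = d"; cases "e = c"; cases "e = d")
      (auto simp: shift_comp_var shift_comp_const_mult mult.left_commute add.commute)
qed

text \<open>Both homomorphisms multiply the series x(z) by scalar series, and such multiplications
  commute; the product rule carries this from the variables to all polynomials.\<close>

lemma shift_comp_commute: "shift_comp c i (shift_comp d j f) = shift_comp d j (shift_comp c i f)"
proof (induction f arbitrary: i j rule: fock_induct)
  case (const a)
  then show ?case by (simp add: shift_comp_const)
next
  case (var g f)
  have "shift_comp c i (shift_comp d j (fock_var g * f)) =
      (\<Sum>b\<le>j. \<Sum>a\<le>i. shift_comp c a (shift_comp d b (fock_var g)) *
        shift_comp c (i - a) (shift_comp d (j - b) f))"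
    by (simp add: shift_comp_mult shift_comp_sum)
  also have "\<dots> = (\<Sum>a\<le>i. \<Sum>b\<le>j. shift_comp d b (shift_comp c a (fock_var g)) *
        shift_comp d (j - b) (shift_comp c (i - a) f))"
    by (subst sum.swap) (simp add: var shift_comp_commute_var[of d])
  also have "\<dots> = shift_comp d j (shift_comp c i (fock_var g * f))"
    by (simp add: shift_comp_mult shift_comp_sum)
  finally show ?case .
qed (simp add: shift_comp_add)

lemma shift_comp_eventually_0: "\<exists>N. \<forall>i\<ge>N. shift_comp c i f = 0"
  by (rule exI[of _ "Suc (degree (shift_hom c f))"]) (simp add: shift_comp_def coeff_eq_0)

lemma shift_comp2_eventually_0:
  "\<exists>N. \<forall>i j. N \<le> i \<or> N \<le> j \<longrightarrow> shift_comp c i (shift_comp d j f) = 0"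
proof -
  obtain N where N: "\<And>j. N \<le> j \<Longrightarrow> shift_comp d j f = 0"
    using shift_comp_eventually_0[of d f] by blast
  define n where "n j = Suc (degree (shift_hom c (shift_comp d j f)))" for j
  have n: "shift_comp c i (shift_comp d j f) = 0" if "n j \<le> i" for i j
    using that by (simp add: n_def shift_comp_def[of c] coeff_eq_0)
  have "n j \<le> (\<Sum>j<N. n j)" if "j < N" for j
    using that by (intro member_le_sum) auto
  then have "shift_comp c i (shift_comp d j f) = 0" if "N + (\<Sum>j<N. n j) \<le> i \<or> N +
      (\<Sum>j<N. n j) \<le> j" for i j
    using that N[of j] n[of j i] by (cases "j < N") (fastforce simp: not_less)+
  then show ?thesis by blast
qed

section \<open>Products of two vertex operators\<close>

definition raise :: "bool \<Rightarrow> nat \<Rightarrow> fock \<Rightarrow> fock" where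
  "raise c k f = (\<Sum>i\<le>degree (shift_hom c f). fock_var (gen_of c (k + i)) * shift_comp c i f)"

text \<open>The degree in the definition of \<open>raise\<close> depends on \<open>f\<close>. Any
  larger bound serves as well, so several polynomials can be treated with one common bound.\<close>

lemma raise_eq:
  assumes "\<And>i. N \<le> i \<Longrightarrow> shift_comp c i f = 0"
  shows "raise c k f = (\<Sum>i<N. fock_var (gen_of c (k + i)) * shift_comp c i f)"
proof -
  have "raise c k f = (\<Sum>i<N + Suc (degree (shift_hom c f)).
      fock_var (gen_of c (k + i)) * shift_comp c i f)"
    unfolding raise_def
    by (rule sum.mono_neutral_left) (auto simp: shift_comp_def coeff_eq_0)
  also have "\<dots> = (\<Sum>i<N. fock_var (gen_of c (k + i)) * shift_comp c i f)"
    by (rule sum.mono_neutral_right) (auto simp: assms)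
  finally show ?thesis .
qed

lemma raise_add: "raise c k (f + g) = raise c k f + raise c k g"
proof -
  obtain N M where N: "\<And>i. N \<le> i \<Longrightarrow> shift_comp c i f = 0" "\<And>i. M \<le> i \<Longrightarrow> shift_comp c i g = 0"
    using shift_comp_eventually_0 by meson
  have "raise c k h = (\<Sum>i<N + M. fock_var (gen_of c (k + i)) * shift_comp c i h)"
    if "h \<in> {f, g, f + g}" for h
    using that by (intro raise_eq) (auto simp: N shift_comp_add)
  then show ?thesis by (simp add: shift_comp_add distrib_left sum.distrib)
qed

lemma raise_const_mult: "raise c k (fock_const a * f) = fock_const a * raise c k f"
proof -
  obtain N where N: "\<And>i. N \<le> i \<Longrightarrow> shift_comp c i f = 0"
    using shift_comp_eventually_0 by meson
  have "raise c k h = (\<Sum>i<N. fock_var (gen_of c (k + i)) * shift_comp c i h)"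
    if "h \<in> {f, fock_const a * f}" for h
    using that by (intro raise_eq) (auto simp: N shift_comp_const_mult)
  then show ?thesis by (simp add: shift_comp_const_mult sum_distrib_left mult.left_commute)
qed

text \<open>For \<open>c = d\<close> this is the coefficient of w^K z^L in x(w) x(z) (1 - z/w) / (1
  - p z/w), the contraction of two vertex operators applied to 1.\<close>

definition raise_pair :: "bool \<Rightarrow> bool \<Rightarrow> nat \<Rightarrow> nat \<Rightarrow> fock" where
  "raise_pair c d K L = (\<Sum>a\<le>L. fock_var (gen_of c (K + a)) * shift_comp c a (fock_var
      (gen_of d L)))"

text \<open>Normal ordering: the outer shift acts multiplicatively on the variable created by the
  inner operator and on the shifted \<open>f\<close>. The first factor gives the contraction, the
  second a double shift of \<open>f\<close>.\<close>

lemma raise_raise: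
  assumes N: "\<And>j. N \<le> j \<Longrightarrow> shift_comp d j f = 0"
    "\<And>i j. N \<le> i \<Longrightarrow> shift_comp c i (shift_comp d j f) = 0"
  shows "raise c k (raise d l f) =
    (\<Sum>i<N. \<Sum>j<N. raise_pair c d (k + i) (l + j) * shift_comp c i (shift_comp d j f))"
proof -
  \<comment> \<open>Large enough for the total degree: a shift of the variable with index
    \<open>l + j\<close> has degree at most \<open>l + j < l + N\<close>, and the shift of the rest
    has degree below \<open>N\<close>.\<close>
  let ?M = "N + l + N"
  let ?F = "\<lambda>j a i. fock_var (gen_of c (k + i + a)) * shift_comp c a (fock_var (gen_of d (l + j))) *
     shift_comp c i (shift_comp d j f)"
  have tail: "shift_comp c a (fock_var (gen_of d n)) = 0" if "n < a" for a n
    using that by (simp add: shift_comp_var)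
  have comp: "shift_comp c i (raise d l f) = (\<Sum>j<N. \<Sum>a\<le>i. shift_comp c a (fock_var (gen_of d (l +
      j))) *
      shift_comp c (i - a) (shift_comp d j f))" for i
    by (simp add: raise_eq[OF N(1)] shift_comp_sum shift_comp_mult)
  have "shift_comp c i (raise d l f) = 0" if "?M \<le> i" for i
    unfolding comp
  proof (intro sum.neutral ballI)
    fix j a assume "j \<in> {..<N}" "a \<in> {..i}"
    then show "shift_comp c a (fock_var (gen_of d (l + j))) * shift_comp c (i - a)
        (shift_comp d j f) = 0"
      using that by (cases "a \<le> l + j") (simp_all add: tail N(2))
  qed
  then have "raise c k (raise d l f) =
      (\<Sum>i<?M. fock_var (gen_of c (k + i)) * shift_comp c i (raise d l f))"
    by (rule raise_eq)
  also have "\<dots> = (\<Sum>i<?M. \<Sum>j<N. \<Sum>a\<le>i. ?F j a (i - a))"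
    unfolding comp sum_distrib_left by (intro sum.cong) (auto simp: mult.assoc)
  also have "\<dots> = (\<Sum>j<N. \<Sum>i<?M. \<Sum>a\<le>i. ?F j a (i - a))"
    by (rule sum.swap)
  also have "\<dots> = (\<Sum>j<N. \<Sum>i<N. raise_pair c d (k + i) (l + j) * shift_comp c i (shift_comp d j f))"
  proof (rule sum.cong[OF refl])
    fix j assume j: "j \<in> {..<N}"
    have "(\<Sum>i<?M. \<Sum>a\<le>i. ?F j a (i - a)) = (\<Sum>(a, i)\<in>{(a, i). a + i < ?M}. ?F j a i)"
      by (rule sum.triangle_reindex[symmetric])
    \<comment> \<open>All nonzero terms of the triangle lie in this rectangle, where the two sums
      separate.\<close>
    also have "\<dots> = (\<Sum>(a, i)\<in>{..l + j} \<times> {..<N}. ?F j a i)"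
    proof (rule sum.mono_neutral_right)
      have "{(a, i). a + i < ?M} \<subseteq> {..<?M} \<times> {..<?M}" by auto
      then show "finite {(a, i). a + i < ?M}" by (rule finite_subset) simp
      show "{..l + j} \<times> {..<N} \<subseteq> {(a, i). a + i < ?M}" using j by auto
      show "\<forall>x\<in>{(a, i). a + i < ?M} - {..l + j} \<times> {..<N}. (case x of (a, i) \<Rightarrow> ?F j a i) = 0"
        using tail N(2) by (force simp: not_le not_less)
    qed
    also have "\<dots> = (\<Sum>i<N. \<Sum>a\<le>l + j. ?F j a i)"
      by (subst sum.cartesian_product[symmetric], rule sum.swap)
    finally show "(\<Sum>i<?M. \<Sum>a\<le>i. ?F j a (i - a)) =
        (\<Sum>i<N. raise_pair c d (k + i) (l + j) * shift_comp c i (shift_comp d j f))"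
      by (simp add: raise_pair_def sum_distrib_right)
  qed
  finally show ?thesis by (subst sum.swap)
qed

text \<open>Multiplying the contraction by 1 - p z/w clears its denominator and leaves x(w) x(z) (1
  - z/w).\<close>

lemma raise_pair_Suc:
  "raise_pair c c K (Suc L) - fock_const (quad_par c) * raise_pair c c (Suc K) L =
     fock_var (gen_of c K) * fock_var (gen_of c (Suc L)) -
     fock_var (gen_of c (Suc K)) * fock_var (gen_of c L)"
proof -
  let ?x = "\<lambda>k. fock_var (gen_of c k)" and ?p = "quad_par c"
  have step: "vertex_coeff ?p (Suc b) = ?p * vertex_coeff ?p b - of_bool (b = 0)" for b
    by (cases b) (simp_all add: vertex_coeff_def algebra_simps)
  have fc: "fock_const (a - b) = fock_const a - fock_const b" for a b
    by (simp add: fock_const_def single_diff)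
  have "raise_pair c c K (Suc L) = ?x K * ?x (Suc L) +
      (\<Sum>b\<le>L. ?x (Suc K + b) * (fock_const (vertex_coeff ?p (Suc b)) * ?x (L - b)))"
    unfolding raise_pair_def sum.atMost_Suc_shift
    by (simp add: shift_comp_var vertex_coeff_def[of _ 0])
  also have "(\<Sum>b\<le>L. ?x (Suc K + b) * (fock_const (vertex_coeff ?p (Suc b)) * ?x (L - b))) =
      (\<Sum>b\<le>L. fock_const ?p * (?x (Suc K + b) * (fock_const (vertex_coeff ?p b) * ?x (L - b)))) -
      (\<Sum>b\<le>L. if b = 0 then ?x (Suc K) * ?x L else 0)"
    unfolding sum_subtractf[symmetric]
    by (rule sum.cong) (auto simp: step fc fock_const_mult algebra_simps)
  finally show ?thesis
    by (simp add: raise_pair_def shift_comp_var sum_distrib_left)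
qed

text \<open>The right-hand side of \<open>raise_pair_Suc\<close> changes sign when its two indices
  trade places. Summed against the double shifts, which are symmetric, the identities for
  \<open>(k, l)\<close> and \<open>(l, k)\<close> cancel.\<close>

lemma raise_quadratic:
  "raise c k (raise c (Suc l) f) + raise c l (raise c (Suc k) f) =
     fock_const (quad_par c) * (raise c (Suc k) (raise c l f) + raise c (Suc l) (raise c k f))"
proof -
  obtain N1 where N1: "\<And>j. N1 \<le> j \<Longrightarrow> shift_comp c j f = 0"
    using shift_comp_eventually_0 by meson
  obtain N2 where N2: "\<And>i j. N2 \<le> i \<or> N2 \<le> j \<Longrightarrow> shift_comp c i (shift_comp c j f) = 0"
    using shift_comp2_eventually_0 by meson
  define N where "N = N1 + N2"
  let ?G = "\<lambda>i j. shift_comp c i (shift_comp c j f)" and ?p = "fock_const (quad_par c)"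
  let ?x = "\<lambda>k. fock_var (gen_of c k)"
  have rr: "raise c k (raise c l f) = (\<Sum>i<N. \<Sum>j<N. raise_pair c c (k + i) (l + j) * ?G i j)" for k l
    by (rule raise_raise) (auto simp: N_def N1 N2)
  have diff: "raise c k (raise c (Suc l) f) - ?p * raise c (Suc k) (raise c l f) =
      (\<Sum>i<N. \<Sum>j<N. (?x (k + i) * ?x (Suc (l + j)) - ?x (Suc (k + i)) * ?x (l + j)) * ?G i j)"
          for k l
    unfolding rr sum_distrib_left sum_subtractf[symmetric] raise_pair_Suc[symmetric]
    by (simp add: algebra_simps)
  have "(\<Sum>i<N. \<Sum>j<N. (?x (k + i) * ?x (Suc (l + j)) - ?x (Suc (k + i)) * ?x (l + j)) * ?G i j) =
      - (\<Sum>i<N. \<Sum>j<N. (?x (l + i) * ?x (Suc (k + j)) - ?x (Suc (l + i)) * ?x (k + j)) * ?G i j)"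
    unfolding sum_negf[symmetric]
    by (subst sum.swap) (simp add: shift_comp_commute[of c _ c] algebra_simps)
  from this[folded diff] show ?thesis
    by (simp add: algebra_simps)
qed

text \<open>Each shift acts on variables of the other kind by a scalar, so the contraction of
  operators of different kinds is a plain product. The only scalar different from 1 is
  \<open>cross_factor False\<close>, and it supplies the power of \<open>q\<close>.\<close>

lemma raise_exchange:
  "raise True i (raise False j f) = fock_const (qpow (- 1)) * raise False j (raise True i f)"
proof -
  obtain N1 where N1: "\<And>j. N1 \<le> j \<Longrightarrow> shift_comp False j f = 0"
    using shift_comp_eventually_0 by meson
  obtain N2 where N2: "\<And>j. N2 \<le> j \<Longrightarrow> shift_comp True j f = 0"
    using shift_comp_eventually_0 by meson
  obtain N3 where N3: "\<And>i j. N3 \<le> i \<or> N3 \<le> j \<Longrightarrow> shift_comp True i (shift_comp False j f) = 0"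
    using shift_comp2_eventually_0 by meson
  define N where "N = N1 + N2 + N3"
  have "fock_const (qpow (- 1)) * fock_const (qpow 1) = 1"
    by (simp flip: fock_const_mult qpow_add)
  then have q: "fock_const (qpow (- 1)) * (fock_const (qpow 1) * h) = h" for h
    by (simp flip: mult.assoc)
  have 1: "raise True i (raise False j f) = (\<Sum>i'<N. \<Sum>j'<N. raise_pair True False (i + i') (j + j') *
      shift_comp True i' (shift_comp False j' f))"
    by (rule raise_raise) (auto simp: N_def N1 N3)
  have 2: "raise False j (raise True i f) = (\<Sum>j'<N. \<Sum>i'<N. raise_pair False True (j + j') (i + i') *
      shift_comp False j' (shift_comp True i' f))"
    by (rule raise_raise) (auto simp: N_def N2 N3 shift_comp_commute[of False])
  have zero: "(\<Sum>a\<le>n. h a * (if a = 0 then z else 0)) = h 0 * z"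
    for n z and h :: "nat \<Rightarrow> fock"
    by (induction n) simp_all
  have pair: "raise_pair True False K L = fock_var (GenU K) * fock_var (GenM L)"
    "raise_pair False True L K = fock_const (qpow 1) * (fock_var (GenM L) * fock_var (GenU K))"
        for K L
    by (simp_all add: raise_pair_def shift_comp_var[of True _ False, simplified]
        shift_comp_var[of False _ True, simplified] zero cross_factor_def mult.left_commute)
  have "raise True i (raise False j f) = (\<Sum>j'<N. \<Sum>i'<N. raise_pair True False (i + i') (j + j') *
      shift_comp True i' (shift_comp False j' f))"
    unfolding 1 by (rule sum.swap)
  also have "\<dots> = (\<Sum>j'<N. \<Sum>i'<N. fock_const (qpow (- 1)) *
      (raise_pair False True (j + j') (i + i') * shift_comp False j' (shift_comp True i' f)))"
    unfolding pair by (intro sum.cong refl)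
      (simp only: mult.assoc q shift_comp_commute[of False] mult.left_commute[of "fock_var
          (GenU _)"])
  finally show ?thesis
    by (simp only: 2 sum_distrib_left)
qed

section \<open>Linear independence of the ordered monomials\<close>

lemma raise_0 [simp]: "raise c k 0 = 0"
  using raise_add[of c k 0 0] by simp

abbreviation raise_gen :: "gen \<Rightarrow> fock \<Rightarrow> fock" where
  "raise_gen g \<equiv> raise (gen_kind g) (gen_index g)"

lemma foldr_raise_add: "foldr raise_gen ws (f + g) = foldr raise_gen ws f + foldr raise_gen ws g"
  by (induction ws) (simp_all add: raise_add)

lemma foldr_raise_const_mult:
  "foldr raise_gen ws (fock_const a * f) = fock_const a * foldr raise_gen ws f"
  by (induction ws) (simp_all add: raise_const_mult)

lemma foldr_raise_0 [simp]: "foldr raise_gen ws 0 = 0"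
  by (induction ws) simp_all

section \<open>The action of the free algebra kills the relations\<close>

definition fock_act :: "free_algebra \<Rightarrow> fock \<Rightarrow> fock" where
  "fock_act x f = lin_ext (\<lambda>w c. fock_const c * foldr raise_gen (letters w) f) x"

lemma fock_act_add: "fock_act (x + y) f = fock_act x f + fock_act y f"
  unfolding fock_act_def by (rule lin_ext_add) (simp_all add: fock_const_add distrib_right)

lemma fock_act_0 [simp]: "fock_act 0 f = 0"
  by (simp add: fock_act_def)

lemma fock_act_uminus: "fock_act (- x) f = - fock_act x f"
  using fock_act_add[of x "- x" f] by (simp add: eq_neg_iff_add_eq_0 add.commute)

lemma fock_act_diff: "fock_act (x - y) f = fock_act x f - fock_act y f"
  using fock_act_add[of x "- y" f] by (simp add: fock_act_uminus)

lemma fock_act_single: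
  "fock_act (Poly_Mapping.single w c) f = fock_const c * foldr raise_gen (letters w) f"
  unfolding fock_act_def by (rule lin_ext_single) simp

lemma fock_act_right_0 [simp]: "fock_act x 0 = 0"
  by (simp add: fock_act_def lin_ext_def)

lemma fock_act_right_add: "fock_act x (f + g) = fock_act x f + fock_act x g"
  by (simp add: fock_act_def lin_ext_def foldr_raise_add distrib_left sum.distrib)

lemma fock_act_mult: "fock_act (x * y) f = fock_act x (fock_act y f)"
proof (induction x rule: poly_mapping_add_induct)
  case (single w c)
  show ?case
  proof (induction y rule: poly_mapping_add_induct)
    case (single v d)
    show ?case
      by (simp add: mult_single fock_act_single plus_word_def fock_const_mult
          foldr_raise_const_mult mult.assoc)
  qed (simp_all add: fock_act_add fock_act_right_add distrib_left)
qed (simp_all add: fock_act_add distrib_right)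

lemma fock_act_scalar: "fock_act (free_scalar c) f = fock_const c * f"
  by (simp add: free_scalar_def fock_act_single zero_word_def)

lemma fock_act_gen: "fock_act (free_gen (gen_of c k)) f = raise c k f"
  by (simp add: free_gen_def fock_act_single)

lemma fock_act_sign_eq_0: "fock_act ((- 1) ^ n * x) f = 0 \<longleftrightarrow> fock_act x f = 0"
  by (cases "even n") (auto simp: fock_act_uminus)

lemma fock_act_sum: "fock_act (\<Sum>a\<in>A. F a) f = (\<Sum>a\<in>A. fock_act (F a) f)"
  by (induction A rule: infinite_finite_induct) (simp_all add: fock_act_add)

lemma fock_double_cancel:
  fixes f g :: fock
  assumes "f + f = g + g"
  shows "f = g"
proof -
  have "fock_const (laurent_const (1/2)) * (h + h) = h" for h
  proof -
    have "fock_const (laurent_const (1/2)) * (h + h) =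
        fock_const (laurent_const (1/2) + laurent_const (1/2)) * h"
      by (simp only: distrib_left distrib_right fock_const_add)
    then show ?thesis by (simp add: laurent_half)
  qed
  then show ?thesis using assms by metis
qed

text \<open>Summing \<open>raise_quadratic\<close> over all pairs with sum \<open>n - 1\<close> runs
  through each antidiagonal twice. Halving gives the boundary relation, the missing end term on each
  side being the one subtracted.\<close>

lemma raise_quadratic_sum:
  "(\<Sum>a\<le>n. raise c a (raise c (n - a) f)) - raise c n (raise c 0 f) =
   fock_const (quad_par c) *
     ((\<Sum>a\<le>n. raise c a (raise c (n - a) f)) - raise c 0 (raise c n f))"
proof (cases n)
  case (Suc m)
  let ?p = "fock_const (quad_par c)" and ?R = "\<lambda>k l. raise c k (raise c l f)"
  have rev: "(\<Sum>a\<le>m. h (m - a)) = (\<Sum>a\<le>m. h a)" for h :: "nat \<Rightarrow> fock"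
    using sum.nat_diff_reindex[of h "Suc m"] by (simp add: lessThan_Suc_atMost)
  have 1: "(\<Sum>a\<le>m. ?R a (Suc (m - a))) = (\<Sum>a\<le>n. ?R a (n - a)) - ?R n 0"
    by (simp add: Suc Suc_diff_le)
  have 2: "(\<Sum>a\<le>m. ?R (Suc a) (m - a)) = (\<Sum>a\<le>n. ?R a (n - a)) - ?R 0 n"
    unfolding Suc sum.atMost_Suc_shift by simp
  have "(\<Sum>a\<le>m. ?R a (Suc (m - a))) + (\<Sum>a\<le>m. ?R (m - a) (Suc a)) =
      ?p * ((\<Sum>a\<le>m. ?R (Suc a) (m - a)) + (\<Sum>a\<le>m. ?R (Suc (m - a)) a))"
    unfolding sum.distrib[symmetric] sum_distrib_left raise_quadratic ..
  moreover have "(\<Sum>a\<le>m. ?R (m - a) (Suc a)) = (\<Sum>a\<le>m. ?R a (Suc (m - a)))"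
    using rev[of "\<lambda>a. ?R (m - a) (Suc a)"] by simp
  moreover have "(\<Sum>a\<le>m. ?R (Suc (m - a)) a) = (\<Sum>a\<le>m. ?R (Suc a) (m - a))"
    using rev[of "\<lambda>a. ?R (Suc (m - a)) a"] by simp
  ultimately have "(\<Sum>a\<le>m. ?R a (Suc (m - a))) + (\<Sum>a\<le>m. ?R a (Suc (m - a))) =
      ?p * (\<Sum>a\<le>m. ?R (Suc a) (m - a)) + ?p * (\<Sum>a\<le>m. ?R (Suc a) (m - a))"
    by (simp add: distrib_left)
  from fock_double_cancel[OF this] show ?thesis
    unfolding 1 2 .
qed simp

text \<open>Interchanging \<lambda> and \<mu> changes the sign of both factors in each
  product.\<close>

lemma quadratic_relator_nth_swap:
  "fps_nth (fps_nth (quadratic_relator c s) i) j = fps_nth (fps_nth (quadratic_relator c s) j) i"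
  unfolding quadratic_relator_expand
  by (simp add: ser_lam_mult_nth series_scalar_mult_nth algebra_simps)

lemma fock_act_quadratic_relator:
  "fock_act (fps_nth (fps_nth
     (quadratic_relator (quad_par c) (\<lambda>i. free_gen (gen_of c i))) i) j) f = 0"
proof -
  let ?r = "quadratic_relator (quad_par c) (\<lambda>i. free_gen (gen_of c i))"
  have SS: "fock_act (fps_nth (fps_nth ?r (Suc i)) (Suc j)) f = 0" for i j
    unfolding quadratic_relator_nth_Suc_Suc fock_act_sign_eq_0
    using raise_quadratic[of c i j f]
    by (simp add: fock_act_diff fock_act_add fock_act_mult fock_act_scalar fock_act_gen)
  have S0: "fock_act (fps_nth (fps_nth ?r (Suc i)) 0) f = 0" for i
    unfolding quadratic_relator_nth_Suc_0 fock_act_sign_eq_0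
    using raise_quadratic_sum[where n = i and c = c and f = f]
    by (simp add: fock_act_diff fock_act_sum fock_act_mult fock_act_scalar fock_act_gen)
  have "fps_nth (fps_nth ?r 0) 0 = 0"
    unfolding quadratic_relator_expand
    by (simp add: ser_lam_def ser_mu_def shift_seq_def)
  then show ?thesis
    using SS S0 quadratic_relator_nth_swap[of _ _ 0 j] by (cases i; cases j) simp_all
qed

lemma fock_act_exchange_relator:
  "fock_act (fps_nth (fps_nth (exchange_relator (qpow (- 1)) (\<lambda>i. free_gen (GenU i))
     (\<lambda>i. free_gen (GenM i))) i) j) f = 0"
  unfolding exchange_relator_nth fock_act_sign_eq_0
  using raise_exchange[of i j f] fock_act_gen[of True] fock_act_gen[of False]
  by (simp add: fock_act_diff fock_act_mult fock_act_scalar)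

lemma fock_act_relation_ideal: "x \<in> relation_ideal \<Longrightarrow> fock_act x f = 0"
proof (induction x rule: relation_ideal.induct)
  case (step a r x y)
  have "fock_act r f = 0" for f
    using step(2) fock_act_quadratic_relator[of True] fock_act_quadratic_relator[of False]
      fock_act_exchange_relator
    by (auto simp: relators_def relator_series_def)
  then show ?case using step by (simp add: fock_act_add fock_act_mult)
qed simp

lemma qpow_neq_0 [simp]: "qpow k \<noteq> 0"
  by (metis qpow_def keys_single keys_zero insert_not_empty zero_neq_one)

section \<open>Leading monomials and the basis\<close>

lemma lookup_fock_const_mult: "Poly_Mapping.lookup (fock_const c * f) M = c *
    Poly_Mapping.lookup f M"
  by (induction f rule: poly_mapping_add_induct)
    (simp_all add: fock_const_def mult_single lookup_single lookup_add distrib_left mult_when)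

lemma lookup_fock_var_mult:
  "Poly_Mapping.lookup (fock_var g * f) (add_mset g M) = Poly_Mapping.lookup f M"
  by (induction f rule: poly_mapping_add_induct)
    (auto simp: fock_var_def mult_single lookup_single lookup_add distrib_left when_def)

lemma lookup_fock_var_mult_neq_0:
  "Poly_Mapping.lookup (fock_var g * f) K \<noteq> 0 \<Longrightarrow>
     \<exists>N. K = add_mset g N \<and> Poly_Mapping.lookup f N \<noteq> 0"
  using keys_mult[of "fock_var g" f]
  by (auto simp: fock_var_def in_keys_iff[symmetric] keys_single split: if_splits)

text \<open>These are the eigenvalues of the degree 0 component of the shift, which is diagonal on
  monomials. They are powers of \<open>q\<close>, hence nonzero, so leading coefficients
  survive.\<close>

definition diag_factor :: "bool \<Rightarrow> gen multiset \<Rightarrow> laurent" where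
  "diag_factor c M = (\<Prod>g\<in>#M. if gen_kind g = c then 1 else cross_factor c)"

lemma diag_factor_neq_0: "diag_factor c M \<noteq> 0"
  by (induction M) (simp_all add: diag_factor_def cross_factor_def)

lemma lookup_shift_comp_0:
  "Poly_Mapping.lookup (shift_comp c 0 f) M = diag_factor c M * Poly_Mapping.lookup f M"
proof -
  have var: "shift_comp c 0 (fock_var g) =
      fock_const (if gen_kind g = c then 1 else cross_factor c) * fock_var g" for g
    using shift_comp_var[of c 0 "gen_kind g" "gen_index g"] unfolding gen_kind_index
    by (cases g; cases c) (simp_all add: vertex_coeff_def)
  have single: "shift_comp c 0 (Poly_Mapping.single N a) =
      Poly_Mapping.single N (diag_factor c N * a)" for N a
  proof (induction N)
    case empty
    show ?case using shift_comp_const[of c 0 a] by (simp add: fock_const_def diag_factor_def)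
  next
    case (add g N)
    have "Poly_Mapping.single (add_mset g N) a = fock_var g * Poly_Mapping.single N a"
      by (simp add: fock_var_def mult_single)
    then have "shift_comp c 0 (Poly_Mapping.single (add_mset g N) a) =
        fock_const (if gen_kind g = c then 1 else cross_factor c) * fock_var g *
        Poly_Mapping.single N (diag_factor c N * a)"
      by (simp only: shift_comp_mult) (simp add: var add)
    then show ?case
      by (simp add: fock_const_def fock_var_def mult_single diag_factor_def mult.assoc)
  qed
  show ?thesis
    by (induction f rule: poly_mapping_add_induct)
      (simp_all add: single lookup_single lookup_add shift_comp_add distrib_left mult_when when_def)
qed

text \<open>
  Apart from \<open>g\<close> itself, every variable that \<open>raise_gen g\<close> introduces is larger than \<open>g\<close>,
      hence than all
  of \<open>M\<close>; such monomials are larger in the multiset order.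
\<close>

lemma raise_leading_term:
  assumes low: "\<And>N. Poly_Mapping.lookup f N \<noteq> 0 \<Longrightarrow> M \<le> N"
    and lead: "Poly_Mapping.lookup f M \<noteq> 0" and le: "\<And>h. h \<in># M \<Longrightarrow> h \<le> g"
  shows "Poly_Mapping.lookup (raise_gen g f) N \<noteq> 0 \<Longrightarrow> add_mset g M \<le> N"
    and "Poly_Mapping.lookup (raise_gen g f) (add_mset g M) \<noteq> 0"
proof -
  let ?c = "gen_kind g" and ?k = "gen_index g"
  let ?T = "\<lambda>i. fock_var (gen_of ?c (?k + i)) * shift_comp ?c i f"
  have sum: "Poly_Mapping.lookup (raise_gen g f) N =
      (\<Sum>i\<le>degree (shift_hom ?c f). Poly_Mapping.lookup (?T i) N)" for N
    by (simp add: raise_def lookup_sum)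
  have pos: "add_mset g M < N" if neq: "Poly_Mapping.lookup (?T (Suc i)) N \<noteq> 0" for i N
  proof -
    obtain N' where N: "N = add_mset (gen_of ?c (?k + Suc i)) N'"
      using lookup_fock_var_mult_neq_0[OF neq] by blast
    have "g < gen_of ?c (?k + Suc i)"
      by (cases g) simp_all
    then show ?thesis
      unfolding N using le by (intro ex_gt_imp_less_multiset) (auto intro: le_less_trans)
  qed
  have zero: "add_mset g M \<le> N" if "Poly_Mapping.lookup (?T 0) N \<noteq> 0" for N
  proof -
    have "Poly_Mapping.lookup (fock_var g * shift_comp ?c 0 f) N \<noteq> 0" using that by simp
    then obtain N' where N': "N = add_mset g N'" "Poly_Mapping.lookup (shift_comp ?c 0 f) N' \<noteq> 0"
      using lookup_fock_var_mult_neq_0 by blast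
    then have "M \<le> N'" using low by (simp add: lookup_shift_comp_0)
    then show ?thesis by (simp add: N')
  qed
  have all: "add_mset g M \<le> N" if "Poly_Mapping.lookup (?T i) N \<noteq> 0" for i N
    using that zero pos by (cases i) (auto dest: less_imp_le)
  show "add_mset g M \<le> N" if "Poly_Mapping.lookup (raise_gen g f) N \<noteq> 0"
    using that unfolding sum by (meson all sum.neutral)
  have "Poly_Mapping.lookup (raise_gen g f) (add_mset g M) =
      (\<Sum>i\<le>degree (shift_hom ?c f). if i = 0 then Poly_Mapping.lookup (?T 0) (add_mset g M) else 0)"
    unfolding sum
  proof (intro sum.cong refl)
    fix i
    show "Poly_Mapping.lookup (?T i) (add_mset g M) =
        (if i = 0 then Poly_Mapping.lookup (?T 0) (add_mset g M) else 0)"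
      using pos[of "i - 1" "add_mset g M"] by (cases i) auto
  qed
  also have "\<dots> = diag_factor ?c M * Poly_Mapping.lookup f M"
    by (simp add: lookup_fock_var_mult lookup_shift_comp_0)
  finally show "Poly_Mapping.lookup (raise_gen g f) (add_mset g M) \<noteq> 0"
    using lead diag_factor_neq_0 by simp
qed

lemma foldr_raise_leading_term:
  assumes "decreasing ws"
  shows "(\<forall>N. Poly_Mapping.lookup (foldr raise_gen ws 1) N \<noteq> 0 \<longrightarrow> mset ws \<le> N) \<and>
    Poly_Mapping.lookup (foldr raise_gen ws 1) (mset ws) \<noteq> 0"
  using assms
proof (induction ws)
  case Nil
  show ?case by (simp add: lookup_one when_def)
next
  case (Cons g ws)
  then show ?case
    using raise_leading_term[of "foldr raise_gen ws 1" "mset ws" g] by auto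
qed

definition pbw_sum :: "fock \<Rightarrow> qfun" where
  "pbw_sum = lin_ext (\<lambda>M c. qscale c (pbw M))"

lemma pbw_sum_add: "pbw_sum (a + b) = pbw_sum a + pbw_sum b"
  unfolding pbw_sum_def by (rule lin_ext_add) (simp_all add: qmod.scale_left_distrib)

lemma pbw_sum_single: "pbw_sum (Poly_Mapping.single M c) = qscale c (pbw M)"
  unfolding pbw_sum_def by (rule lin_ext_single) simp

lemma pbw_sum_0 [simp]: "pbw_sum 0 = 0"
  by (simp add: pbw_sum_def)

lemma pbw_sum_const_mult: "pbw_sum (fock_const c * a) = qscale c (pbw_sum a)"
  by (induction a rule: poly_mapping_add_induct)
    (simp_all add: pbw_sum_add pbw_sum_single fock_const_def mult_single distrib_left
        qmod.scale_right_distrib)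

lemma pbw_sum_surj: "\<exists>a. x = pbw_sum a"
proof -
  have "x \<in> qmod.span (range pbw)" by (simp add: span_range_pbw)
  then show ?thesis
  proof (induction x rule: qmod.span_induct_alt)
    case base
    show ?case using pbw_sum_0 by metis
  next
    case (step c x y)
    then obtain M a where "x = pbw M" "y = pbw_sum a" by blast
    then have "qscale c x + y = pbw_sum (Poly_Mapping.single M c + a)"
      by (simp add: pbw_sum_add pbw_sum_single)
    then show ?case by blast
  qed
qed

text \<open>Applied to 1, an ordered word has its own multiset as least monomial. The least monomial
  occurring in \<open>a\<close> would therefore survive with nonzero coefficient.\<close>

lemma pbw_sum_eq_0:
  assumes "pbw_sum a = 0"
  shows "a = 0"
proof (rule ccontr)
  assume "a \<noteq> 0"
  let ?w = "\<lambda>M. foldr raise_gen (pbw_word M) 1"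
  \<comment> \<open>A preimage in the free algebra, on which \<open>fock_act\<close> is
    defined.\<close>
  define x where "x = lin_ext (\<lambda>M. Poly_Mapping.single (Word (pbw_word M))) a"
  have "abs_qfun x = pbw_sum a"
    unfolding x_def
    by (induction a rule: poly_mapping_add_induct)
      (simp_all add: abs_qfun_0 lin_ext_single lin_ext_add single_add abs_qfun_add pbw_sum_add
        pbw_sum_single abs_qfun_single pbw_def)
  then have 0: "fock_act x 1 = 0"
    using assms fock_act_relation_ideal by (simp add: abs_qfun_eq_0_iff)
  have "fock_act x 1 = lin_ext (\<lambda>M c. fock_const c * ?w M) a"
    unfolding x_def
    by (induction a rule: poly_mapping_add_induct)
      (simp_all add: lin_ext_single lin_ext_add single_add fock_act_add fock_act_single
        fock_const_add distrib_right)
  with 0 have sum: "(\<Sum>M\<in>Poly_Mapping.keys a. fock_const (Poly_Mapping.lookup a M) * ?w M) = 0"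
    by (simp add: lin_ext_def)
  define M where "M = Min (Poly_Mapping.keys a)"
  have M: "M \<in> Poly_Mapping.keys a" "\<And>N. N \<in> Poly_Mapping.keys a \<Longrightarrow> M \<le> N"
    using \<open>a \<noteq> 0\<close> by (auto simp: M_def)
  have "0 = (\<Sum>N\<in>Poly_Mapping.keys a. Poly_Mapping.lookup a N * Poly_Mapping.lookup (?w N) M)"
    using arg_cong[OF sum, of "\<lambda>f. Poly_Mapping.lookup f M"]
    by (simp add: lookup_sum lookup_fock_const_mult)
  \<comment> \<open>If the monomial \<open>M\<close> occurs in the image of the word for
    \<open>N\<close>, then \<open>N \<le> M\<close>, and minimality of \<open>M\<close> forces
    \<open>N = M\<close>.\<close>
  also have "\<dots> = (\<Sum>N\<in>{M}. Poly_Mapping.lookup a N * Poly_Mapping.lookup (?w N) M)"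
  proof (rule sum.mono_neutral_right)
    show "\<forall>N\<in>Poly_Mapping.keys a - {M}. Poly_Mapping.lookup a N * Poly_Mapping.lookup (?w N) M = 0"
      using M(2) foldr_raise_leading_term[OF decreasing_pbw_word] by (fastforce intro: antisym)
  qed (use M in auto)
  finally show False
    using M(1) foldr_raise_leading_term[OF decreasing_pbw_word, of M]
    by (simp add: in_keys_iff)
qed

lemma pbw_sum_inject: "pbw_sum a = pbw_sum b \<longleftrightarrow> a = b"
proof
  assume "pbw_sum a = pbw_sum b"
  then have "pbw_sum (a - b) = 0"
    using pbw_sum_add[of "a - b" b] by simp
  then show "a = b" using pbw_sum_eq_0 by fastforce
qed simp

lemma free_module_qscale: "free_module qscale"
  unfolding free_module_def
proof (intro exI conjI)
  show "qmod.span (range pbw) = UNIV" by (rule span_range_pbw)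
  have inj: "inj pbw"
  proof (rule injI)
    fix M N assume "pbw M = pbw N"
    then have "pbw_sum (Poly_Mapping.single M 1) = pbw_sum (Poly_Mapping.single N 1)"
      by (simp add: pbw_sum_single)
    then have "Poly_Mapping.single M (1 :: laurent) = Poly_Mapping.single N 1"
      by (simp only: pbw_sum_inject)
    then have "Poly_Mapping.keys (Poly_Mapping.single M (1 :: laurent)) =
        Poly_Mapping.keys (Poly_Mapping.single N (1 :: laurent))" by simp
    then show "M = N" by simp
  qed
  show "\<not> qmod.dependent (range pbw)"
  proof
    assume "qmod.dependent (range pbw)"
    then obtain t u where t: "finite t" "t \<subseteq> range pbw" and 0: "(\<Sum>v\<in>t. qscale (u v) v) = 0"
      and "\<exists>v\<in>t. u v \<noteq> 0"
      unfolding qmod.dependent_explicit by blast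
    then obtain M where M: "pbw M \<in> t" "u (pbw M) \<noteq> 0" by blast
    obtain T where T: "t = pbw ` T" using t(2) by (auto simp: subset_image_iff)
    then have "finite T" using t(1) inj by (simp add: finite_image_iff inj_on_subset)
    define a where "a = (\<Sum>N\<in>T. Poly_Mapping.single N (u (pbw N)))"
    have "pbw_sum a = (\<Sum>N\<in>T. qscale (u (pbw N)) (pbw N))"
      unfolding a_def using \<open>finite T\<close>
      by (induction T rule: finite_induct) (simp_all add: pbw_sum_add pbw_sum_single)
    also have "\<dots> = 0"
      using 0 unfolding T by (subst (asm) sum.reindex) (auto intro: inj_on_subset[OF inj])
    finally have "a = 0" by (rule pbw_sum_eq_0)
    moreover have "M \<in> T" using M(1) T inj by (auto dest: injD)
    then have "Poly_Mapping.lookup a M = u (pbw M)"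
      unfolding a_def using \<open>finite T\<close> by (simp add: lookup_sum lookup_single when_def)
    ultimately show False using M(2) by simp
  qed
qed

lemma qfun_torsion_free:
  assumes "qscale c x = 0" "c \<noteq> 0"
  shows "x = 0"
proof -
  obtain a where a: "x = pbw_sum a" using pbw_sum_surj by blast
  then have "fock_const c * a = 0"
    using assms(1) by (intro pbw_sum_eq_0) (simp add: pbw_sum_const_mult)
  then have "c * Poly_Mapping.lookup a M = 0" for M
    by (metis lookup_fock_const_mult lookup_zero)
  then have "a = 0" using assms(2) by (intro poly_mapping_eqI) simp
  then show ?thesis by (simp add: a)
qed

section \<open>Specialization and commutators\<close>

text \<open>Every power of \<open>q\<close> takes the value 1 at \<open>q = 1\<close>, so evaluation
  there is the sum of the coefficients.\<close>

definition at_one :: "laurent \<Rightarrow> complex" where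
  "at_one = lin_ext (\<lambda>k a. a)"

lemma at_one_add: "at_one (a + b) = at_one a + at_one b"
  unfolding at_one_def by (rule lin_ext_add) simp_all

lemma at_one_mult: "at_one (a * b) = at_one a * at_one b"
  unfolding at_one_def by (rule lin_ext_mult) simp_all

lemma at_one_single: "at_one (Poly_Mapping.single k a) = a"
  unfolding at_one_def by (rule lin_ext_single) simp

lemma at_one_simps [simp]:
  "at_one 0 = 0" "at_one 1 = 1" "at_one (qpow k) = 1" "at_one (laurent_const a) = a"
  using at_one_single[of 0 1] by (simp_all add: at_one_def qpow_def at_one_single[unfolded
      at_one_def]
      laurent_const_def)

lemma at_one_uminus: "at_one (- a) = - at_one a"
  using at_one_add[of a "- a"] by (simp add: eq_neg_iff_add_eq_0 add.commute)

lemma at_one_diff: "at_one (a - b) = at_one a - at_one b"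
  using at_one_add[of a "- b"] by (simp add: at_one_uminus)

lemma at_one_quad_par [simp]: "at_one (quad_par c) = 1"
  by (cases c) simp_all

lemma qpow_minus_1_dvd: "qpow 1 - 1 dvd qpow k - 1"
proof (induction k rule: int_induct[of _ 0])
  case base
  show ?case by simp
next
  case (step1 k)
  have "qpow (k + 1) - 1 = (qpow 1 - 1) * qpow k + (qpow k - 1)"
    by (simp add: qpow_add algebra_simps)
  then show ?case using step1 by (simp only: dvd_add dvd_triv_left)
next
  case (step2 k)
  have "qpow 1 * qpow (k - 1) = qpow k" by (simp flip: qpow_add)
  then have "qpow (k - 1) - 1 = (qpow k - 1) - (qpow 1 - 1) * qpow (k - 1)"
    by (simp add: algebra_simps)
  then show ?case using step2 by (simp only: dvd_diff dvd_triv_left)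
qed

text \<open>Modulo \<open>q - 1\<close> each power of \<open>q\<close> is 1, so a Laurent polynomial
  is congruent to the constant given by its value at \<open>q = 1\<close>.\<close>

lemma at_one_eq_0_dvd:
  assumes "at_one a = 0"
  shows "qpow 1 - 1 dvd a"
proof -
  have "qpow 1 - 1 dvd a - laurent_const (at_one a)"
  proof (induction a rule: poly_mapping_add_induct)
    case (single k c)
    have "Poly_Mapping.single k c - laurent_const c = (qpow k - 1) * laurent_const c"
      by (simp add: qpow_def laurent_const_def mult_single left_diff_distrib)
    then show ?case by (simp add: at_one_single qpow_minus_1_dvd)
  next
    case (add a b)
    have "a + b - laurent_const (at_one (a + b)) =
        (a - laurent_const (at_one a)) + (b - laurent_const (at_one b))"
      by (simp add: at_one_add laurent_const_def single_add)
    then show ?case using add by (simp only: dvd_add)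
  qed (simp add: laurent_const_def)
  then show ?thesis using assms by (simp add: laurent_const_def)
qed

lemma qpow_minus_1_neq_0: "qpow 1 - 1 \<noteq> 0"
proof
  assume "qpow 1 - 1 = 0"
  then have "Poly_Mapping.lookup (qpow 1 - 1) 1 = 0" by simp
  then show False by (simp add: qpow_def lookup_minus lookup_single lookup_one)
qed

section \<open>Complex-valued characters at q = 1\<close>

definition eval_free :: "(gen \<Rightarrow> complex) \<Rightarrow> free_algebra \<Rightarrow> complex" where
  "eval_free t = lin_ext (\<lambda>w c. at_one c * (\<Prod>g\<leftarrow>letters w. t g))"

lemma eval_free_add: "eval_free t (x + y) = eval_free t x + eval_free t y"
  unfolding eval_free_def by (rule lin_ext_add) (simp_all add: at_one_add distrib_right)

lemma eval_free_mult: "eval_free t (x * y) = eval_free t x * eval_free t y"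
  unfolding eval_free_def
  by (rule lin_ext_mult) (simp_all add: at_one_add at_one_mult distrib_right plus_word_def)

lemma eval_free_single: "eval_free t (Poly_Mapping.single w c) = at_one c * (\<Prod>g\<leftarrow>letters w. t g)"
  unfolding eval_free_def by (rule lin_ext_single) simp

lemma eval_free_0 [simp]: "eval_free t 0 = 0"
  by (simp add: eval_free_def)

lemma eval_free_1 [simp]: "eval_free t 1 = 1"
proof -
  have "letters 0 = []" by (simp add: zero_word_def)
  then show ?thesis using eval_free_single[of t 0 1] by simp
qed

lemma eval_free_uminus: "eval_free t (- x) = - eval_free t x"
  using eval_free_add[of t x "- x"] by (simp add: eq_neg_iff_add_eq_0 add.commute)

lemma eval_free_diff: "eval_free t (x - y) = eval_free t x - eval_free t y"
  using eval_free_add[of t x "- y"] by (simp add: eval_free_uminus)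

lemma eval_free_scalar: "eval_free t (free_scalar c) = at_one c"
  by (simp add: free_scalar_def eval_free_single zero_word_def)

lemma eval_free_sign_eq_0: "eval_free t ((- 1) ^ n * x) = 0 \<longleftrightarrow> eval_free t x = 0"
  by (cases "even n") (auto simp: eval_free_uminus)

text \<open>At \<open>q = 1\<close> every coefficient of the relator is a combination of
  commutators, which a character with commutative values kills.\<close>

lemma eval_free_quadratic_relator:
  assumes "at_one c = 1"
  shows "eval_free t (fps_nth (fps_nth (quadratic_relator c s) i) j) = 0"
proof -
  have SS: "eval_free t (fps_nth (fps_nth (quadratic_relator c s) (Suc i)) (Suc j)) = 0" for i j
    unfolding quadratic_relator_nth_Suc_Suc eval_free_sign_eq_0
    by (simp add: eval_free_diff eval_free_add eval_free_mult eval_free_scalar assms)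
  have S0: "eval_free t (fps_nth (fps_nth (quadratic_relator c s) (Suc i)) 0) = 0" for i
    unfolding quadratic_relator_nth_Suc_0 eval_free_sign_eq_0
    by (simp add: eval_free_diff eval_free_mult eval_free_scalar assms)
  have "fps_nth (fps_nth (quadratic_relator c s) 0) 0 = 0"
    unfolding quadratic_relator_expand
    by (simp add: ser_lam_def ser_mu_def shift_seq_def)
  then show ?thesis
    using SS S0 quadratic_relator_nth_swap[of _ _ 0 j] by (cases i; cases j) simp_all
qed

lemma eval_free_relation_ideal: "x \<in> relation_ideal \<Longrightarrow> eval_free t x = 0"
proof (induction x rule: relation_ideal.induct)
  case (step a r x y)
  have "eval_free t (fps_nth (fps_nth (exchange_relator (qpow (- 1)) s s') i) j) = 0" for s s' i j
    unfolding exchange_relator_nth eval_free_sign_eq_0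
    by (simp add: eval_free_diff eval_free_mult eval_free_scalar)
  then have "eval_free t r = 0"
    using step(2) eval_free_quadratic_relator
    by (auto simp: relators_def relator_series_def)
  then show ?case using step by (simp add: eval_free_add eval_free_mult)
qed simp

lift_definition qeval :: "(gen \<Rightarrow> complex) \<Rightarrow> qfun \<Rightarrow> complex" is eval_free
  unfolding relation_eq_def by (metis eval_free_relation_ideal eval_free_diff right_minus_eq)

lemma qeval_add: "qeval t (x + y) = qeval t x + qeval t y"
  by transfer (rule eval_free_add)

lemma qeval_mult: "qeval t (x * y) = qeval t x * qeval t y"
  by transfer (rule eval_free_mult)

lemma qeval_1 [simp]: "qeval t 1 = 1"
  by transfer (rule eval_free_1)

lemma qeval_0 [simp]: "qeval t 0 = 0"
  by transfer (rule eval_free_0)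

lemma qeval_uminus: "qeval t (- x) = - qeval t x"
  by transfer (rule eval_free_uminus)

lemma qeval_diff: "qeval t (x - y) = qeval t x - qeval t y"
  by transfer (rule eval_free_diff)

lemma qeval_scale: "qeval t (qscale c x) = at_one c * qeval t x"
  by transfer (simp add: eval_free_mult eval_free_scalar)

lemma qeval_gen [simp]: "qeval t (q_gen g) = t g"
  by transfer (simp add: free_gen_def eval_free_single)

lemma qeval_pbw: "qeval t (pbw M) = (\<Prod>g\<in>#M. t g)"
proof -
  have "qeval t (qword ws) = (\<Prod>g\<in>#mset ws. t g)" for ws
    by (induction ws) (simp_all add: qword_Cons qeval_mult)
  then show ?thesis by (simp add: pbw_def)
qed

lemma prod_mset_eq_prod_power:
  fixes t :: "'v \<Rightarrow> 'a::comm_monoid_mult"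
  assumes "finite V" "set_mset M \<subseteq> V"
  shows "(\<Prod>v\<in>#M. t v) = (\<Prod>v\<in>V. t v ^ count M v)"
  using assms(2)
proof (induction M)
  case (add w M)
  have "(\<Prod>v\<in>V. t v ^ count (add_mset w M) v) =
      (\<Prod>v\<in>V. (if v = w then t w else 1) * t v ^ count M v)"
    by (intro prod.cong) auto
  also have "\<dots> = t w * (\<Prod>v\<in>V. t v ^ count M v)"
    using add.prems assms(1) by (simp add: prod.distrib)
  finally show ?case using add by simp
qed simp

text \<open>Induction on the variables. With the others fixed, the sum is a polynomial in one
  variable with infinitely many zeros, so its coefficients vanish; these are sums of the same kind
  in fewer variables.\<close>

lemma polynomial_vanishing_everywhere:
  fixes c :: "'i \<Rightarrow> complex" and e :: "'i \<Rightarrow> 'v \<Rightarrow> nat"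
  assumes "finite V" "finite F"
    and "\<And>t. (\<Sum>i\<in>F. c i * (\<Prod>v\<in>V. t v ^ e i v)) = 0"
    and "\<And>i j. i \<in> F \<Longrightarrow> j \<in> F \<Longrightarrow> (\<And>v. v \<in> V \<Longrightarrow> e i v = e j v) \<Longrightarrow> i = j"
    and "i \<in> F"
  shows "c i = 0"
  using assms
proof (induction V arbitrary: F i rule: finite_induct)
  case empty
  then have "F = {i}" by blast
  then show ?case using empty.prems(2) by simp
next
  case (insert w V)
  let ?k = "e i w"
  let ?F = "{j \<in> F. e j w = ?k}"
  have "(\<Sum>j\<in>?F. c j * (\<Prod>v\<in>V. t v ^ e j v)) = 0" for t
  proof -
    \<comment> \<open>The sum as a polynomial in the value at \<open>w\<close> alone.\<close>
    define p where "p = (\<Sum>j\<in>F. monom (c j * (\<Prod>v\<in>V. t v ^ e j v)) (e j w))"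
    have "poly p y = 0" for y
    proof -
      have "(\<Prod>v\<in>V. (t(w := y)) v ^ e j v) = (\<Prod>v\<in>V. t v ^ e j v)" for j
        using insert.hyps(2) by (intro prod.cong) auto
      then have "poly p y = (\<Sum>j\<in>F. c j * (\<Prod>v\<in>insert w V. (t(w := y)) v ^ e j v))"
        unfolding p_def using insert.hyps
        by (simp add: poly_sum poly_monom mult_ac)
      then show ?thesis using insert.prems(2) by simp
    qed
    then have "p = 0" using poly_all_0_iff_0 by blast
    then have "0 = coeff p ?k" by simp
    also have "\<dots> = (\<Sum>j\<in>F. if e j w = ?k then c j * (\<Prod>v\<in>V. t v ^ e j v) else 0)"
      by (simp add: p_def coeff_sum)
    also have "\<dots> = (\<Sum>j\<in>?F. c j * (\<Prod>v\<in>V. t v ^ e j v))"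
      using insert.prems(1) by (simp add: sum.inter_filter)
    finally show ?thesis by simp
  qed
  then show ?case
  proof (intro insert.IH[of ?F])
    fix j l assume "j \<in> ?F" "l \<in> ?F" "\<And>v. v \<in> V \<Longrightarrow> e j v = e l v"
    then show "j = l" by (intro insert.prems(3)) auto
  qed (use insert.prems in auto)
qed

text \<open>In the basis of ordered monomials the vanishing of all characters says that every
  coefficient is 0 at \<open>q = 1\<close>, hence divisible by \<open>q - 1\<close>. This determines
  the kernel of the specialization and makes commutators divisible.\<close>

lemma qeval_eq_0_imp_divisible:
  assumes "\<And>t. qeval t x = 0"
  shows "\<exists>z. x = qscale (qpow 1 - 1) z"
proof -
  obtain a where a: "x = pbw_sum a" using pbw_sum_surj by blast
  let ?K = "Poly_Mapping.keys a"
  define V where "V = (\<Union>M\<in>?K. set_mset M)"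
  have eval: "(\<Sum>M\<in>?K. at_one (Poly_Mapping.lookup a M) * (\<Prod>g\<in>V. t g ^ count M g)) = 0" for t
  proof -
    have "(\<Prod>g\<in>#M. t g) = (\<Prod>g\<in>V. t g ^ count M g)" if "M \<in> ?K" for M
      using that by (intro prod_mset_eq_prod_power) (auto simp: V_def)
    moreover have "qeval t (pbw_sum b) = lin_ext (\<lambda>M c. at_one c * (\<Prod>g\<in>#M. t g)) b" for b
      by (induction b rule: poly_mapping_add_induct)
        (simp_all add: lin_ext_add lin_ext_single pbw_sum_add pbw_sum_single qeval_add qeval_scale
          qeval_pbw at_one_add distrib_right)
    ultimately show ?thesis using assms[of t] by (simp add: a lin_ext_def)
  qed
  have "at_one (Poly_Mapping.lookup a M) = 0" if "M \<in> ?K" for M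
  proof (rule polynomial_vanishing_everywhere[OF _ _ eval _ that])
    fix M N assume "M \<in> ?K" "N \<in> ?K" "\<And>g. g \<in> V \<Longrightarrow> count M g = count N g"
    moreover have "count M g = count N g" if "g \<notin> V" for g
      using that \<open>M \<in> ?K\<close> \<open>N \<in> ?K\<close> by (simp add: V_def not_in_iff)
    ultimately show "M = N" by (metis multiset_eqI)
  qed (simp_all add: V_def)
  then have "\<exists>d. Poly_Mapping.lookup a M = (qpow 1 - 1) * d" for M
    using at_one_eq_0_dvd[of "Poly_Mapping.lookup a M"]
    by (cases "M \<in> ?K") (auto simp: dvd_def in_keys_iff)
  then obtain d where d: "\<And>M. Poly_Mapping.lookup a M = (qpow 1 - 1) * d M" by metis
  have "a = fock_const (qpow 1 - 1) * (\<Sum>M\<in>?K. Poly_Mapping.single M (d M))"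
    by (subst poly_mapping_eq_sum_single[of a]) (simp add: d fock_const_def sum_distrib_left
        mult_single)
  then show ?thesis by (metis a pbw_sum_const_mult)
qed

text \<open>
  An antisymmetric biderivation \<open>D\<close> at the point \<open>t\<close> that has the right values on generators is
  the first-order term of the commutator.
\<close>

locale commutator_bracket =
  fixes t :: "gen \<Rightarrow> complex" and D :: "qfun \<Rightarrow> qfun \<Rightarrow> complex"
  assumes D_antisym: "D x y = - D y x"
    and D_add: "D (x + y) z = D x z + D y z"
    and D_scale: "D (qscale a x) z = at_one a * D x z"
    and D_mult: "D (x * y) z = qeval t x * D y z + D x z * qeval t y"
    and D_quadratic: "D (q_gen (gen_of c k)) (q_gen (gen_of c (Suc l))) =
      D (q_gen (gen_of c (Suc k))) (q_gen (gen_of c l)) + (if c then 1 else - 1) *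
        (t (gen_of c k) * t (gen_of c (Suc l)) + t (gen_of c (Suc k)) * t (gen_of c l))"
    and D_exchange: "D (q_gen (GenU i)) (q_gen (GenM j)) = - t (GenU i) * t (GenM j)"
begin

definition lifts :: "qfun \<Rightarrow> qfun \<Rightarrow> bool" where
  "lifts x y \<longleftrightarrow> (\<exists>c. x * y - y * x = qscale (qpow 1 - 1) c \<and> qeval t c = D x y)"

lemma lifts_sym:
  assumes "lifts x y"
  shows "lifts y x"
proof -
  obtain c where c: "x * y - y * x = qscale (qpow 1 - 1) c" "qeval t c = D x y"
    using assms by (auto simp: lifts_def)
  have "y * x - x * y = - qscale (qpow 1 - 1) c"
    by (simp flip: c(1))
  then show ?thesis
    unfolding lifts_def using c(2) D_antisym[of y x]
    by (intro exI[of _ "- c"]) (simp add: qeval_uminus)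
qed

lemma lifts_add:
  assumes "lifts x z" "lifts y z"
  shows "lifts (x + y) z"
proof -
  obtain c d where "x * z - z * x = qscale (qpow 1 - 1) c" "qeval t c = D x z"
    "y * z - z * y = qscale (qpow 1 - 1) d" "qeval t d = D y z"
    using assms by (auto simp: lifts_def)
  moreover have "(x + y) * z - z * (x + y) = (x * z - z * x) + (y * z - z * y)"
    by (simp add: algebra_simps)
  ultimately show ?thesis
    unfolding lifts_def
    by (intro exI[of _ "c + d"]) (simp add: D_add qeval_add qmod.scale_right_distrib)
qed

lemma lifts_scale:
  assumes "lifts x z"
  shows "lifts (qscale a x) z"
proof -
  obtain c where "x * z - z * x = qscale (qpow 1 - 1) c" "qeval t c = D x z"
    using assms by (auto simp: lifts_def)
  moreover have "qscale a x * z - z * qscale a x = qscale a (x * z - z * x)"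
    by (simp add: qmod.scale_right_diff_distrib)
  ultimately show ?thesis
    unfolding lifts_def
    by (intro exI[of _ "qscale a c"]) (simp add: D_scale qeval_scale mult.commute)
qed

lemma lifts_mult:
  assumes "lifts x z" "lifts y z"
  shows "lifts (x * y) z"
proof -
  obtain c d where "x * z - z * x = qscale (qpow 1 - 1) c" "qeval t c = D x z"
    "y * z - z * y = qscale (qpow 1 - 1) d" "qeval t d = D y z"
    using assms by (auto simp: lifts_def)
  moreover have "x * y * z - z * (x * y) = x * (y * z - z * y) + (x * z - z * x) * y"
    by (simp add: algebra_simps)
  ultimately show ?thesis
    unfolding lifts_def
    by (intro exI[of _ "x * d + c * y"])
      (simp add: D_mult qeval_add qeval_mult qmod.scale_right_distrib)
qed

lemma lifts_1: "lifts 1 z"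
proof -
  have "D 1 z = 0" using D_mult[of 1 1 z] by simp
  then show ?thesis unfolding lifts_def by (intro exI[of _ 0]) simp
qed

lemma lifts_if_gens:
  assumes "\<And>g. lifts (q_gen g) z"
  shows "lifts x z"
proof (induction x rule: qfun_word_induct)
  case (word c ws)
  have "lifts (qword ws) z"
    by (induction ws) (simp_all add: qword_Cons lifts_1 lifts_mult assms)
  then show ?case by (rule lifts_scale)
qed (rule lifts_add)

text \<open>The quadratic relation expresses the commutator at \<open>(k, l)\<close> by the one at
  \<open>(k + 1, l - 1)\<close>, up to a multiple of the parameter minus 1, and
  \<open>D_quadratic\<close> is the matching recursion. It ends at equal or neighbouring
  indices.\<close>

lemma lifts_same_kind_le: "k \<le> l \<Longrightarrow> lifts (q_gen (gen_of c k)) (q_gen (gen_of c l))"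
proof (induction "l - k" arbitrary: k l rule: less_induct)
  case less
  let ?s = "\<lambda>k. q_gen (gen_of c k)" and ?p = "quad_par c"
  have D_refl: "D x x = 0" for x
    using D_antisym[of x x] by simp
  \<comment> \<open>\<open>e\<close> is 1 for the parameter \<open>q\<close> and
    \<open>- q^-1\<close> for \<open>q^-1\<close>; its value at \<open>q = 1\<close> is the sign in
    \<open>D_quadratic\<close>.\<close>
  obtain e where e: "?p - 1 = (qpow 1 - 1) * e"
    using qpow_minus_1_dvd[of "if c then 1 else - 1"] by (cases c) (auto simp: dvd_def)
  have e1: "at_one e = (if c then 1 else - 1)"
  proof (cases c)
    case True
    then have "(qpow 1 - 1) * (e - 1) = 0" using e by (simp add: algebra_simps)
    then have "e - 1 = 0" using qpow_minus_1_neq_0 mult_eq_0_iff by blast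
    then show ?thesis using True by simp
  next
    case False
    have "(qpow 1 - 1) * (qpow 1 * e + 1) = qpow 1 * ((qpow 1 - 1) * e) + (qpow 1 - 1)"
      by (simp add: algebra_simps)
    also have "qpow 1 * ((qpow 1 - 1) * e) = 1 - qpow 1"
      using e False by (simp add: right_diff_distrib flip: e qpow_add)
    also have "1 - qpow 1 + (qpow 1 - 1) = 0" by simp
    finally have "qpow 1 * e + 1 = 0" using qpow_minus_1_neq_0 mult_eq_0_iff by blast
    then have "at_one (qpow 1 * e + 1) = 0" by simp
    then show ?thesis using False by (simp add: at_one_add at_one_mult eq_neg_iff_add_eq_0)
  qed
  consider "l = k" | "l = Suc k" | l' where "l = Suc l'" "Suc k \<le> l'"
  proof (cases l)
    case (Suc l')
    then show ?thesis using that less.prems by (cases "k \<le> l'"; cases "k = l'") auto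
  qed (use that less.prems in auto)
  then show ?case
  proof cases
    case 1
    then show ?thesis unfolding lifts_def by (intro exI[of _ 0]) (simp add: D_refl)
  next
    case 2
    have "?s k * ?s (Suc k) = qscale ?p (?s (Suc k) * ?s k)"
      using q_quadratic[of c k k] unfolding qmod.scale_right_distrib by (rule qfun_double_cancel)
    then have "?s k * ?s l - ?s l * ?s k = qscale (?p - 1) (?s l * ?s k)"
      by (simp add: 2 qmod.scale_left_diff_distrib)
    moreover have "D (?s k) (?s l) = (if c then 1 else - 1) * t (gen_of c k) * t (gen_of c l)"
      using D_quadratic[of c k k] D_antisym[of "?s (Suc k)" "?s k"] by (simp add: 2)
    ultimately show ?thesis
      unfolding lifts_def e
      by (intro exI[of _ "qscale e (?s l * ?s k)"]) (simp add: qeval_scale qeval_mult e1)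
  next
    case (3 l')
    obtain d where d: "?s (Suc k) * ?s l' - ?s l' * ?s (Suc k) = qscale (qpow 1 - 1) d"
      "qeval t d = D (?s (Suc k)) (?s l')"
    proof -
      have "lifts (?s (Suc k)) (?s l')"
        using 3 by (intro less.hyps) simp_all
      then show thesis using that by (auto simp: lifts_def)
    qed
    have "?s k * ?s l - ?s l * ?s k =
        qscale ?p (?s (Suc k) * ?s l' + ?s l * ?s k) - ?s l' * ?s (Suc k) - ?s l * ?s k"
      using q_quadratic[of c k l'] 3 by (simp add: eq_diff_eq)
    \<comment> \<open>Adding and subtracting the product with indices \<open>l'\<close> and
      \<open>Suc k\<close>, scaled by \<open>?p\<close>, produces the inner commutator, known by
      induction; the remainder carries the factor \<open>?p - 1\<close>.\<close>
    also have "\<dots> = qscale ?p (?s (Suc k) * ?s l' - ?s l' * ?s (Suc k)) +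
        qscale (?p - 1) (?s l * ?s k + ?s l' * ?s (Suc k))"
      by (simp add: qmod.scale_right_distrib qmod.scale_right_diff_distrib
          qmod.scale_left_diff_distrib)
    also have "\<dots> = qscale (qpow 1 - 1) (qscale ?p d + qscale e (?s l * ?s k + ?s l' * ?s (Suc k)))"
      by (simp add: d e qmod.scale_right_distrib mult.commute)
    finally have "?s k * ?s l - ?s l * ?s k =
        qscale (qpow 1 - 1) (qscale ?p d + qscale e (?s l * ?s k + ?s l' * ?s (Suc k)))" .
    moreover have "qeval t (qscale ?p d + qscale e (?s l * ?s k + ?s l' * ?s (Suc k))) = D (?s k)
        (?s l)"
      using D_quadratic[of c k l'] 3 d(2)
      by (simp add: qeval_add qeval_scale qeval_mult e1 mult.commute del: gen_of.simps)
    ultimately show ?thesis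
      unfolding lifts_def by blast
  qed
qed

lemma lifts_gens: "lifts (q_gen g) (q_gen h)"
proof -
  \<comment> \<open>The exchange relation gives um - mu = (1 - q) um, hence the witness with a minus
    sign.\<close>
  have UM: "lifts (q_gen (GenU i)) (q_gen (GenM j))" for i j
    unfolding lifts_def q_exchange
    by (intro exI[of _ "- (q_gen (GenU i) * q_gen (GenM j))"])
      (simp add: qmod.scale_left_diff_distrib D_exchange qeval_uminus qeval_mult)
  have same: "lifts (q_gen (gen_of c k)) (q_gen (gen_of c l))" for c k l
    using lifts_same_kind_le lifts_sym by (metis linear)
  show ?thesis
    using UM lifts_sym[OF UM] same[of True] same[of False] by (cases g; cases h) simp_all
qed

lemma lifts_all: "lifts x y"
proof -
  have "lifts x (q_gen g)" for x g
    by (rule lifts_if_gens) (rule lifts_gens)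
  then have "lifts (q_gen g) y" for g by (rule lifts_sym)
  then show ?thesis by (rule lifts_if_gens)
qed

text \<open>The quotient of the commutator by \<open>q - 1\<close> is unique because the module has
  no torsion, so the element constructed in \<open>lifts\<close> is the given
  \<open>c\<close>.\<close>

lemma qeval_commutator:
  assumes "x * y - y * x = qscale (qpow 1 - 1) c"
  shows "qeval t c = D x y"
proof -
  obtain d where d: "x * y - y * x = qscale (qpow 1 - 1) d" "qeval t d = D x y"
    using lifts_all[of x y] by (auto simp: lifts_def)
  have "qscale (qpow 1 - 1) (c - d) = 0"
    using assms d(1) by (simp add: qmod.scale_right_diff_distrib)
  then have "c = d"
    using qfun_torsion_free[OF _ qpow_minus_1_neq_0] by fastforce
  then show ?thesis using d(2) by simp
qed

end

section \<open>Coordinates on the homogeneous space\<close>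

lemma mat22_nth [simp]:
  "mat22 a b c d $ 1 $ 1 = a" "mat22 a b c d $ 1 $ 2 = b"
  "mat22 a b c d $ 2 $ 1 = c" "mat22 a b c d $ 2 $ 2 = d"
  by (simp_all add: mat22_def)

lemma mat22_eqI:
  fixes g h :: loop_mat
  assumes "g $ 1 $ 1 = h $ 1 $ 1" "g $ 1 $ 2 = h $ 1 $ 2" "g $ 2 $ 1 = h $ 2 $ 1" "g $ 2 $ 2 =
      h $ 2 $ 2"
  shows "g = h"
  using assms by (simp add: vec_eq_iff forall_2)

lemma matrix_mult_nth_2: "(g ** h) $ i $ j = g $ i $ 1 * h $ 1 $ j + g $ i $ 2 * h $ 2 $ j"
  for g h :: loop_mat
  by (simp add: matrix_matrix_mult_def sum_2)

lemma mat22_mult: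
  "mat22 a b c d ** mat22 a' b' c' d' =
     mat22 (a * a' + b * c') (a * b' + b * d') (c * a' + d * c') (c * b' + d * d')"
  by (rule mat22_eqI) (simp_all add: matrix_mult_nth_2)

lemma mat22_add: "mat22 a b c d + mat22 a' b' c' d' = mat22 (a + a') (b + b') (c + c') (d + d')"
  by (rule mat22_eqI) simp_all

lemma mat22_inject [simp]:
  "mat22 a b c d = mat22 a' b' c' d' \<longleftrightarrow> a = a' \<and> b = b' \<and> c = c' \<and> d = d'"
  by (metis mat22_nth)

lemma mat_1_mat22: "mat 1 = mat22 1 0 0 1"
  by (rule mat22_eqI) (simp_all add: mat_def)

lemma det_mat22 [simp]: "det (mat22 a b c d) = a * d - b * c"
  by (simp add: det_2)

lemma lam_pow_mult_nth: "fls_nth (lam_pow k * f) n = fls_nth f (n + k)"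
  unfolding fls_X_intpow_times_conv_shift fls_shift_nth by simp

lemma power_series_iff: "f \<in> power_series \<longleftrightarrow> fps_to_fls (fls_regpart f) = f"
proof
  assume "f \<in> power_series"
  then show "fps_to_fls (fls_regpart f) = f"
    by (intro fls_eqI) (auto simp: power_series_def)
next
  assume "fps_to_fls (fls_regpart f) = f"
  then have "fls_nth f k = fls_nth (fps_to_fls (fls_regpart f)) k" for k by simp
  then show "f \<in> power_series" by (auto simp: power_series_def)
qed

lemma fps_to_fls_power_series [simp]: "fps_to_fls F \<in> power_series"
  by (simp add: power_series_def)

definition fps_mat :: "complex fps \<Rightarrow> complex fps \<Rightarrow> complex fps \<Rightarrow> complex fps \<Rightarrow> loop_mat" where
  "fps_mat A B C D = mat22 (fps_to_fls A) (fps_to_fls B) (fps_to_fls C) (fps_to_fls D)"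

lemma fps_mat_nth [simp]:
  "fps_mat A B C D $ 1 $ 1 = fps_to_fls A" "fps_mat A B C D $ 1 $ 2 = fps_to_fls B"
  "fps_mat A B C D $ 2 $ 1 = fps_to_fls C" "fps_mat A B C D $ 2 $ 2 = fps_to_fls D"
  by (simp_all add: fps_mat_def)

lemma fps_mat_mult:
  "fps_mat A B C D ** fps_mat A' B' C' D' =
     fps_mat (A * A' + B * C') (A * B' + B * D') (C * A' + D * C') (C * B' + D * D')"
  by (simp add: fps_mat_def mat22_mult fls_times_fps_to_fls)

lemma fps_mat_inject [simp]:
  "fps_mat A B C D = fps_mat A' B' C' D' \<longleftrightarrow> A = A' \<and> B = B' \<and> C = C' \<and> D = D'"
  by (simp add: fps_mat_def)

lemma fps_mat_B_minus_iff:
  "fps_mat A B C D \<in> B_minus \<longleftrightarrow> A * D - B * C = 1 \<and> fps_nth B 0 = 0"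
  unfolding B_minus_def SL2_loop_def fps_mat_def
  by (simp add: forall_2 flip: fls_times_fps_to_fls fps_to_fls_minus)

definition entry :: "loop_mat \<Rightarrow> 2 \<Rightarrow> 2 \<Rightarrow> complex fps" where
  "entry b i j = fls_regpart (b $ i $ j)"

lemma entry_fps_mat [simp]:
  "entry (fps_mat A B C D) 1 1 = A" "entry (fps_mat A B C D) 1 2 = B"
  "entry (fps_mat A B C D) 2 1 = C" "entry (fps_mat A B C D) 2 2 = D"
  by (simp_all add: entry_def)

lemma B_minus_eq_fps_mat:
  assumes "b \<in> B_minus"
  shows "b = fps_mat (entry b 1 1) (entry b 1 2) (entry b 2 1) (entry b 2 2)"
proof -
  have "b $ i $ j \<in> power_series" for i j using assms by (simp add: B_minus_def)
  then have "fps_to_fls (entry b i j) = b $ i $ j" for i j by (simp add: power_series_iff entry_def)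
  then show ?thesis by (intro mat22_eqI) simp_all
qed

lemma B_minus_entry:
  assumes "b \<in> B_minus"
  shows "entry b 1 1 * entry b 2 2 - entry b 1 2 * entry b 2 1 = 1"
    and "fps_nth (entry b 1 2) 0 = 0"
    and "fps_nth (entry b 1 1) 0 * fps_nth (entry b 2 2) 0 = 1"
proof -
  show det: "entry b 1 1 * entry b 2 2 - entry b 1 2 * entry b 2 1 = 1"
    and B: "fps_nth (entry b 1 2) 0 = 0"
    using assms B_minus_eq_fps_mat[OF assms] fps_mat_B_minus_iff by metis+
  show "fps_nth (entry b 1 1) 0 * fps_nth (entry b 2 2) 0 = 1"
    using arg_cong[OF det, of "\<lambda>f. fps_nth f 0"] B by simp
qed

lemma B_minus_cases:
  assumes "b \<in> B_minus"
  obtains A B C D where "b = fps_mat A B C D" "A * D - B * C = 1" "fps_nth B 0 = 0"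
    "fps_nth A 0 \<noteq> 0" "fps_nth D 0 \<noteq> 0"
  using B_minus_eq_fps_mat[OF assms] B_minus_entry[OF assms] that by fastforce

lemma B_minus_mult: "b \<in> B_minus \<Longrightarrow> b' \<in> B_minus \<Longrightarrow> b ** b' \<in> B_minus"
proof (elim B_minus_cases)
  fix A B C D A' B' C' D' :: "complex fps"
  assume *: "b = fps_mat A B C D" "b' = fps_mat A' B' C' D'" "fps_nth B 0 = 0" "fps_nth B' 0 = 0"
    and det: "A * D - B * C = 1" "A' * D' - B' * C' = 1"
  have "(A * A' + B * C') * (C * B' + D * D') - (A * B' + B * D') * (C * A' + D * C') =
      (A * D - B * C) * (A' * D' - B' * C')"
    by (simp add: algebra_simps)
  then show ?thesis by (simp add: * det fps_mat_mult fps_mat_B_minus_iff)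
qed

lemma H_minus_iff: "h \<in> H_minus \<longleftrightarrow> (\<exists>a. fps_nth a 0 \<noteq> 0 \<and> h = fps_mat a 0 0 (inverse a))"
proof -
  have inv: "inverse (fps_to_fls a) = fps_to_fls (inverse a)" if "fps_nth a 0 \<noteq> 0" for a ::
      "complex fps"
    using that by (simp add: fls_inverse_fps_to_fls subdegree_eq_0_iff)
  show ?thesis
  proof
    assume "h \<in> H_minus"
    then obtain a where a: "a \<in> power_series" "fls_nth a 0 \<noteq> 0" "h = mat22 a 0 0 (inverse a)"
      by (auto simp: H_minus_def)
    then have "a = fps_to_fls (fls_regpart a)" by (simp add: power_series_iff)
    with a inv[of "fls_regpart a"] have "h = fps_mat (fls_regpart a) 0 0 (inverse (fls_regpart a))"
      by (simp add: fps_mat_def)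
    then show "\<exists>a. fps_nth a 0 \<noteq> 0 \<and> h = fps_mat a 0 0 (inverse a)"
      using a(2) by (intro exI[of _ "fls_regpart a"]) simp
  next
    assume "\<exists>a. fps_nth a 0 \<noteq> 0 \<and> h = fps_mat a 0 0 (inverse a)"
    then obtain a where a: "fps_nth a 0 \<noteq> 0" "h = fps_mat a 0 0 (inverse a)" by blast
    then have "h = mat22 (fps_to_fls a) 0 0 (inverse (fps_to_fls a))" by (simp add: fps_mat_def inv)
    moreover have "fls_nth (fps_to_fls a) 0 \<noteq> 0" using a(1) by simp
    ultimately show "h \<in> H_minus" unfolding H_minus_def using fps_to_fls_power_series by blast
  qed
qed

lemma H_minus_subset_B_minus: "H_minus \<subseteq> B_minus"
  by (auto simp: H_minus_iff fps_mat_B_minus_iff inverse_mult_eq_1')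

text \<open>With h = diag(a, a^-1) the product has second row (a^-1 u, a^-1) and upper right entry a
  v. This forces \<open>a = inverse D\<close> and determines u and v; the remaining entry agrees by
  the determinant condition.\<close>

lemma uv_cl_fps_mat:
  assumes det: "A * D - B * C = 1" and B: "fps_nth B 0 = 0"
  shows "uv_cl (fps_mat A B C D) = (fps_to_fls (C * inverse D), fps_to_fls (B * D))"
proof -
  have AD: "fps_nth A 0 * fps_nth D 0 = 1"
    using arg_cong[OF det, of "\<lambda>f. fps_nth f 0"] B by simp
  then have D: "fps_nth D 0 \<noteq> 0" by auto
  have DD: "D * inverse D = 1" "inverse D * D = 1"
    using D by (simp_all add: inverse_mult_eq_1 inverse_mult_eq_1')
  have prod: "fps_mat a 0 0 (inverse a) ** (mat22 1 (fps_to_fls v) 0 1 ** mat22 1 0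
      (fps_to_fls u) 1) =
      fps_mat (a * (1 + u * v)) (a * v) (inverse a * u) (inverse a)" for a u v
  proof -
    have "mat22 1 (fps_to_fls v) 0 1 = fps_mat 1 v 0 1" "mat22 1 0 (fps_to_fls u) 1 =
        fps_mat 1 0 u 1"
      by (simp_all add: fps_mat_def)
    then show ?thesis by (simp add: fps_mat_mult mult.commute)
  qed
  show ?thesis
    unfolding uv_cl_def
  proof (rule the_equality, goal_cases)
    case 1
    have "inverse (inverse D) = D" using D by (simp add: fps_inverse_idempotent)
    moreover have "inverse D * (1 + C * inverse D * (B * D)) = A"
    proof -
      have "inverse D * (1 + C * inverse D * (B * D)) = inverse D * (1 + C * B * (D * inverse D))"
        by (simp add: mult_ac)
      also have "\<dots> = inverse D * (A * D)" using det by (simp add: DD mult.commute diff_eq_eq)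
      finally show ?thesis by (simp add: DD mult_ac)
    qed
    moreover have "inverse D * (B * D) = B" "D * (C * inverse D) = C"
      using DD by (simp_all add: mult_ac)
    ultimately have "fps_mat A B C D = fps_mat (inverse D) 0 0 (inverse (inverse D)) **
        (mat22 1 (fps_to_fls (B * D)) 0 1 ** mat22 1 0 (fps_to_fls (C * inverse D)) 1)"
      unfolding prod by (simp only:)
    moreover have "fps_mat (inverse D) 0 0 (inverse (inverse D)) \<in> H_minus"
      using D by (auto simp: H_minus_iff fps_inverse_def)
    ultimately show ?case using B by auto
  next
    case (2 uv)
    then obtain u v h where uv: "uv = (u, v)" "u \<in> power_series" "v \<in> power_series" "h \<in> H_minus"
      "fps_mat A B C D = h ** (mat22 1 v 0 1 ** mat22 1 0 u 1)" by auto
    then obtain a where a: "fps_nth a 0 \<noteq> 0" "h = fps_mat a 0 0 (inverse a)"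
      by (auto simp: H_minus_iff)
    obtain u' v' where u': "u = fps_to_fls u'" "v = fps_to_fls v'"
      using uv(2,3) by (metis power_series_iff)
    have "B = a * v'" "C = inverse a * u'" "D = inverse a"
      using uv(5) unfolding a(2) u' prod by simp_all
    moreover have "a * inverse a = 1" using a(1) by (simp add: inverse_mult_eq_1')
    ultimately have "u' = C * inverse D" "v' = B * D"
      using a(1) by (simp_all add: fps_inverse_idempotent mult_ac)
    then show ?case by (simp add: uv(1) u')
  qed
qed

text \<open>
  For \<open>b\<close> with rows \<open>(A, B)\<close> and \<open>(C, D)\<close>, the coordinates are \<open>u = C/D\<close>, \<open>v = B D\<close> and
  \<open>m = - \<lambda> B/A\<close>; so \<open>y_ser\<close> below is \<open>- \<lambda>\<^sup>-\<^sup>1 m\<close>.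
\<close>

definition u_ser :: "loop_mat \<Rightarrow> complex fps" where
  "u_ser b = entry b 2 1 * inverse (entry b 2 2)"

definition y_ser :: "loop_mat \<Rightarrow> complex fps" where
  "y_ser b = entry b 1 2 * inverse (entry b 1 1)"

lemma u_coord_eq:
  assumes "b \<in> B_minus"
  shows "u_coord i b = (- 1) ^ i * fps_nth (u_ser b) i"
proof -
  obtain A B C D where "b = fps_mat A B C D" "A * D - B * C = 1" "fps_nth B 0 = 0"
    using B_minus_cases[OF assms] by metis
  then show ?thesis using assms by (simp add: u_coord_def u_cl_def uv_cl_fps_mat u_ser_def)
qed

text \<open>From 1 + uv = A D the quotient v / (1 + uv) equals B/A. The factor -\<lambda> accounts
  for the sign and for the shift of the index by one.\<close>

lemma m_coord_eq:
  assumes "b \<in> B_minus"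
  shows "m_coord i b = - ((- 1) ^ i * fps_nth (y_ser b) (Suc i))"
  using assms
proof (elim B_minus_cases)
  fix A B C D :: "complex fps"
  assume b: "b = fps_mat A B C D" and det: "A * D - B * C = 1" and nz: "fps_nth B 0 = 0"
    "fps_nth A 0 \<noteq> 0" "fps_nth D 0 \<noteq> 0"
  have inv: "D * inverse D = 1" using nz by (simp add: inverse_mult_eq_1')
  have "1 + C * inverse D * (B * D) = 1 + C * B * (D * inverse D)" by (simp add: mult_ac)
  also have "\<dots> = A * D" using det by (simp add: inv mult.commute diff_eq_eq)
  finally have uv: "1 + fps_to_fls (C * inverse D) * fps_to_fls (B * D) = fps_to_fls (A * D)"
    by (simp flip: fls_times_fps_to_fls fps_to_fls_plus fps_one_to_fls)
  have "inverse (fps_to_fls (A * D)) = fps_to_fls (inverse (A * D))"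
    using nz by (simp add: fls_inverse_fps_to_fls subdegree_eq_0_iff)
  moreover have "B * D * inverse (A * D) = y_ser b"
  proof -
    have "B * D * inverse (A * D) = B * inverse A * (D * inverse D)"
      by (simp add: fps_inverse_mult mult_ac)
    then show ?thesis by (simp add: b y_ser_def inv)
  qed
  ultimately have inv_AD: "fps_to_fls (B * D) * inverse (fps_to_fls (A * D)) = fps_to_fls (y_ser b)"
    by (simp only: flip: fls_times_fps_to_fls)
  have "m_cl b = - lam_pow 1 * fps_to_fls (B * D) *
      inverse (1 + fps_to_fls (C * inverse D) * fps_to_fls (B * D))"
    unfolding m_cl_def v_cl_def u_cl_def b uv_cl_fps_mat[OF det nz(1)] by simp
  then have "m_cl b = - (lam_pow 1 * fps_to_fls (y_ser b))"
    unfolding uv mult.assoc inv_AD by simp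
  then have "fls_nth (m_cl b) (int i) = - fls_nth (fps_to_fls (y_ser b)) (int i + 1)"
    by (simp only: fls_uminus_nth lam_pow_mult_nth)
  then show ?thesis
    by (simp add: m_coord_def assms nat_add_distrib)
qed

lemma y_ser_0: "b \<in> B_minus \<Longrightarrow> fps_nth (y_ser b) 0 = 0"
  by (simp add: y_ser_def B_minus_entry(2))

section \<open>Regular functions and invariance of the coordinates\<close>

definition regular :: "(loop_mat \<Rightarrow> complex) \<Rightarrow> bool" where
  "regular \<phi> \<longleftrightarrow> restrict \<phi> B_minus \<in> regular_functions"

lemma regular_cong: "(\<And>b. b \<in> B_minus \<Longrightarrow> \<phi> b = \<psi> b) \<Longrightarrow> regular \<phi> \<longleftrightarrow> regular \<psi>"
  unfolding regular_def by (metis restrict_ext)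

lemma regular_const: "regular (\<lambda>b. c)"
  unfolding regular_def by (rule regular_functions.const)

lemma regular_add: "regular \<phi> \<Longrightarrow> regular \<psi> \<Longrightarrow> regular (\<lambda>b. \<phi> b + \<psi> b)"
  unfolding regular_def by (drule (1) regular_functions.add) (simp cong: restrict_cong)

lemma regular_mult: "regular \<phi> \<Longrightarrow> regular \<psi> \<Longrightarrow> regular (\<lambda>b. \<phi> b * \<psi> b)"
  unfolding regular_def by (drule (1) regular_functions.mult) (simp cong: restrict_cong)

lemma regular_entry: "regular (\<lambda>b. fps_nth (entry b i j) n)"
  unfolding regular_def entry_def fls_regpart_nth by (rule regular_functions.coeff)

lemma regular_sum: "(\<And>i. i \<in> S \<Longrightarrow> regular (\<phi> i)) \<Longrightarrow> regular (\<lambda>b. \<Sum>i\<in>S. \<phi> i b)"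
  by (induction S rule: infinite_finite_induct) (simp_all add: regular_const regular_add)

lemma regular_cmult: "regular \<phi> \<Longrightarrow> regular (\<lambda>b. c * \<phi> b)"
  using regular_mult[OF regular_const] .

lemma regular_uminus: "regular \<phi> \<Longrightarrow> regular (\<lambda>b. - \<phi> b)"
  using regular_cmult[of \<phi> "- 1"] by simp

lemma regular_series_mult:
  assumes "\<And>n. regular (\<lambda>b. fps_nth (F b) n)" "\<And>n. regular (\<lambda>b. fps_nth (G b) n)"
  shows "regular (\<lambda>b. fps_nth (F b * G b) n)"
  unfolding fps_mult_nth by (intro regular_sum regular_mult assms)

text \<open>The coefficients of an inverse series follow recursively, with division by the constant
  term only. The inverse of that term is itself a regular function \<open>r\<close>: the constant
  terms of the two diagonal entries are inverse to each other.\<close>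

lemma regular_series_inverse:
  assumes F: "\<And>n. regular (\<lambda>b. fps_nth (F b) n)" and r: "regular r"
    and r0: "\<And>b. b \<in> B_minus \<Longrightarrow> r b * fps_nth (F b) 0 = 1"
  shows "regular (\<lambda>b. fps_nth (inverse (F b)) n)"
proof (induction n rule: less_induct)
  case (less n)
  have rinv: "inverse (fps_nth (F b) 0) = r b" if "b \<in> B_minus" for b
    using r0[OF that] by (metis inverse_unique mult.commute)
  show ?case
  proof (cases n)
    case 0
    then have "regular (\<lambda>b. fps_nth (inverse (F b)) n) \<longleftrightarrow> regular r"
      using rinv by (intro regular_cong) simp
    then show ?thesis using r by simp
  next
    case (Suc m)
    have "regular (\<lambda>b. fps_nth (inverse (F b)) n) \<longleftrightarrow>
        regular (\<lambda>b. - (r b * (\<Sum>i=0..m. fps_nth (inverse (F b)) i * fps_nth (F b) (n - i))))"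
    proof (rule regular_cong)
      fix b assume b: "b \<in> B_minus"
      have "inverse (F b) * F b = 1"
        using r0[OF b] by (intro inverse_mult_eq_1) auto
      then have "fps_nth (inverse (F b) * F b) n = 0" by (simp add: Suc)
      then have "(\<Sum>i=0..m. fps_nth (inverse (F b)) i * fps_nth (F b) (n - i)) +
          fps_nth (inverse (F b)) n * fps_nth (F b) 0 = 0"
        by (simp add: fps_mult_nth Suc)
      then have "r b * (\<Sum>i=0..m. fps_nth (inverse (F b)) i * fps_nth (F b) (n - i)) +
          fps_nth (inverse (F b)) n * (r b * fps_nth (F b) 0) = 0"
        by (metis distrib_left mult.left_commute mult_zero_right)
      then show "fps_nth (inverse (F b)) n =
          - (r b * (\<Sum>i=0..m. fps_nth (inverse (F b)) i * fps_nth (F b) (n - i)))"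
        by (simp add: r0[OF b] eq_neg_iff_add_eq_0 add.commute)
    qed
    moreover have "regular (\<lambda>b. - (r b * (\<Sum>i=0..m. fps_nth (inverse (F b)) i * fps_nth (F b) (n -
        i))))"
      using less.IH F r by (intro regular_uminus regular_mult regular_sum) (auto simp: Suc)
    ultimately show ?thesis by simp
  qed
qed

lemma regular_u_ser: "regular (\<lambda>b. fps_nth (u_ser b) n)"
  unfolding u_ser_def
  by (intro regular_series_mult regular_entry
      regular_series_inverse[where r = "\<lambda>b. fps_nth (entry b 1 1) 0"] B_minus_entry(3))

lemma regular_y_ser: "regular (\<lambda>b. fps_nth (y_ser b) n)"
  unfolding y_ser_def
  by (intro regular_series_mult regular_entry
      regular_series_inverse[where r = "\<lambda>b. fps_nth (entry b 2 2) 0"])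
    (simp add: B_minus_entry(3) mult.commute)

text \<open>Multiplication by diag(a, a^-1) on the left rescales the rows, and both series are
  quotients within a row.\<close>

lemma ser_H_minus_invariant:
  assumes "h \<in> H_minus" "b \<in> B_minus"
  shows "u_ser (h ** b) = u_ser b" "y_ser (h ** b) = y_ser b"
proof -
  obtain a where a: "fps_nth a 0 \<noteq> 0" "h = fps_mat a 0 0 (inverse a)"
    using assms(1) by (auto simp: H_minus_iff)
  obtain A B C D where b: "b = fps_mat A B C D" "fps_nth A 0 \<noteq> 0" "fps_nth D 0 \<noteq> 0"
    using B_minus_cases[OF assms(2)] by metis
  have aa: "a * inverse a = 1" using a(1) by (simp add: inverse_mult_eq_1')
  have "inverse a * C * (a * inverse D) = C * inverse D * (a * inverse a)"
    "a * B * (inverse a * inverse A) = B * inverse A * (a * inverse a)"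
    by (simp_all add: mult_ac)
  then show "u_ser (h ** b) = u_ser b" "y_ser (h ** b) = y_ser b"
    using a(1) by (simp_all add: a(2) b(1) fps_mat_mult u_ser_def y_ser_def fps_inverse_mult
        fps_inverse_idempotent aa)
qed

lemma regular_u_coord: "u_coord i \<in> regular_functions"
proof -
  have "u_coord i = restrict (\<lambda>b. (- 1) ^ i * fps_nth (u_ser b) i) B_minus"
    using u_coord_eq[of _ i] by (auto simp: u_coord_def)
  then show ?thesis using regular_cmult[OF regular_u_ser] by (simp add: regular_def)
qed

lemma regular_m_coord: "m_coord i \<in> regular_functions"
proof -
  have "m_coord i = restrict (\<lambda>b. - ((- 1) ^ i * fps_nth (y_ser b) (Suc i))) B_minus"
    using m_coord_eq[of _ i] by (auto simp: m_coord_def)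
  then show ?thesis using regular_uminus[OF regular_cmult[OF regular_y_ser]] by
      (simp add: regular_def)
qed

lemma coords_quotient_functions:
  "u_coord i \<in> quotient_functions" "m_coord i \<in> quotient_functions"
  unfolding quotient_functions_def
  using H_minus_subset_B_minus B_minus_mult
  by (auto simp: regular_u_coord regular_m_coord u_coord_eq m_coord_eq ser_H_minus_invariant
      subsetD)

section \<open>The coordinates generate and take arbitrary values\<close>

fun coord :: "gen \<Rightarrow> loop_mat \<Rightarrow> complex" where
  "coord (GenU i) = u_coord i" | "coord (GenM i) = m_coord i"

text \<open>Elements of the deformed algebra, evaluated at \<open>q = 1\<close>, play the role of
  polynomials in the coordinates; this is directly the form in which surjectivity of the
  specialization is needed.\<close>

definition polynomial_fun :: "(loop_mat \<Rightarrow> complex) \<Rightarrow> bool" where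
  "polynomial_fun \<phi> \<longleftrightarrow> (\<exists>x. \<forall>b\<in>B_minus. \<phi> b = qeval (\<lambda>g. coord g b) x)"

lemma polynomial_fun_cong:
  "(\<And>b. b \<in> B_minus \<Longrightarrow> \<phi> b = \<psi> b) \<Longrightarrow> polynomial_fun \<phi> \<longleftrightarrow> polynomial_fun \<psi>"
  by (simp add: polynomial_fun_def)

lemma polynomial_fun_const: "polynomial_fun (\<lambda>b. c)"
  unfolding polynomial_fun_def by (rule exI[of _ "qscale (laurent_const c) 1"])
      (simp add: qeval_scale)

lemma polynomial_fun_coord: "polynomial_fun (coord g)"
  unfolding polynomial_fun_def by (rule exI[of _ "q_gen g"]) simp

lemma polynomial_fun_add: "polynomial_fun \<phi> \<Longrightarrow> polynomial_fun \<psi> \<Longrightarrow> polynomial_fun (\<lambda>b. \<phi> b + \<psi> b)"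
  unfolding polynomial_fun_def by (metis qeval_add)

lemma polynomial_fun_mult: "polynomial_fun \<phi> \<Longrightarrow> polynomial_fun \<psi> \<Longrightarrow> polynomial_fun (\<lambda>b. \<phi> b * \<psi> b)"
  unfolding polynomial_fun_def by (metis qeval_mult)

lemma polynomial_fun_sum:
  "(\<And>i. i \<in> S \<Longrightarrow> polynomial_fun (\<phi> i)) \<Longrightarrow> polynomial_fun (\<lambda>b. \<Sum>i\<in>S. \<phi> i b)"
  by (induction S rule: infinite_finite_induct) (simp_all add: polynomial_fun_const
      polynomial_fun_add)

lemma polynomial_fun_series_mult:
  assumes "\<And>n. polynomial_fun (\<lambda>b. fps_nth (F b) n)" "\<And>n. polynomial_fun (\<lambda>b. fps_nth (G b) n)"
  shows "polynomial_fun (\<lambda>b. fps_nth (F b * G b) n)"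
  unfolding fps_mult_nth by (intro polynomial_fun_sum polynomial_fun_mult assms)

lemma polynomial_fun_u_ser: "polynomial_fun (\<lambda>b. fps_nth (u_ser b) n)"
proof -
  have "polynomial_fun (\<lambda>b. fps_nth (u_ser b) n) \<longleftrightarrow> polynomial_fun (\<lambda>b. (- 1) ^ n * coord
      (GenU n) b)"
    by (rule polynomial_fun_cong) (simp add: u_coord_eq flip: mult.assoc power_add)
  then show ?thesis by (simp only: polynomial_fun_mult polynomial_fun_const polynomial_fun_coord)
qed

lemma polynomial_fun_y_ser: "polynomial_fun (\<lambda>b. fps_nth (y_ser b) n)"
proof (cases n)
  case 0
  have "polynomial_fun (\<lambda>b. fps_nth (y_ser b) n) \<longleftrightarrow> polynomial_fun (\<lambda>b. 0)"
    by (rule polynomial_fun_cong) (simp add: y_ser_0 0)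
  then show ?thesis by (simp only: polynomial_fun_const)
next
  case (Suc m)
  have "polynomial_fun (\<lambda>b. fps_nth (y_ser b) n) \<longleftrightarrow>
      polynomial_fun (\<lambda>b. (- ((- 1) ^ m)) * coord (GenM m) b)"
    by (rule polynomial_fun_cong) (simp add: m_coord_eq Suc flip: mult.assoc power_add)
  then show ?thesis by (simp only: polynomial_fun_mult polynomial_fun_const polynomial_fun_coord)
qed

definition v_ser :: "loop_mat \<Rightarrow> complex fps" where
  "v_ser b = entry b 1 2 * entry b 2 2"

text \<open>This is v = y (1 + uv). As y has no constant term, it determines the coefficients of v
  recursively from u and y.\<close>

lemma v_ser_eq:
  assumes "b \<in> B_minus"
  shows "v_ser b = y_ser b + u_ser b * y_ser b * v_ser b"
  using assms
proof (elim B_minus_cases)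
  fix A B C D :: "complex fps"
  assume b: "b = fps_mat A B C D" and det: "A * D - B * C = 1" and nz: "fps_nth A 0 \<noteq> 0"
      "fps_nth D 0 \<noteq> 0"
  have inv: "D * inverse D = 1" "A * inverse A = 1" using nz by (simp_all add: inverse_mult_eq_1')
  have "B * D = B * D * (A * inverse A)" by (simp add: inv)
  also have "\<dots> = B * inverse A * (A * D)" by (simp add: mult_ac)
  also have "A * D = 1 + B * C * (D * inverse D)" using det by (simp add: inv diff_eq_eq)
  also have "B * inverse A * (1 + B * C * (D * inverse D)) =
      B * inverse A + C * inverse D * (B * inverse A) * (B * D)"
    by (simp add: algebra_simps)
  finally show ?thesis
    by (simp only: b v_ser_def y_ser_def u_ser_def entry_fps_mat)
qed

lemma polynomial_fun_v_ser: "polynomial_fun (\<lambda>b. fps_nth (v_ser b) n)"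
proof (induction n rule: less_induct)
  case (less n)
  have uy: "polynomial_fun (\<lambda>b. fps_nth (u_ser b * y_ser b) i)" for i
    by (intro polynomial_fun_series_mult polynomial_fun_u_ser polynomial_fun_y_ser)
  have "polynomial_fun (\<lambda>b. fps_nth (v_ser b) n) \<longleftrightarrow> polynomial_fun (\<lambda>b. fps_nth (y_ser b) n +
      (\<Sum>i\<in>{1..n}. fps_nth (u_ser b * y_ser b) i * fps_nth (v_ser b) (n - i)))"
  proof (rule polynomial_fun_cong)
    fix b assume b: "b \<in> B_minus"
    have "fps_nth (v_ser b) n = fps_nth (y_ser b) n + fps_nth (u_ser b * y_ser b * v_ser b) n"
      using v_ser_eq[OF b] by (metis fps_add_nth)
    also have "fps_nth (u_ser b * y_ser b * v_ser b) n =
        (\<Sum>i=0..n. fps_nth (u_ser b * y_ser b) i * fps_nth (v_ser b) (n - i))"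
      by (rule fps_mult_nth)
    also have "\<dots> = (\<Sum>i\<in>{1..n}. fps_nth (u_ser b * y_ser b) i * fps_nth (v_ser b) (n - i))"
      by (rule sum.mono_neutral_right) (auto simp: y_ser_0[OF b] not_less_eq_eq)
    finally show "fps_nth (v_ser b) n = fps_nth (y_ser b) n +
        (\<Sum>i\<in>{1..n}. fps_nth (u_ser b * y_ser b) i * fps_nth (v_ser b) (n - i))" .
  qed
  moreover have "polynomial_fun (\<lambda>b. fps_nth (y_ser b) n +
      (\<Sum>i\<in>{1..n}. fps_nth (u_ser b * y_ser b) i * fps_nth (v_ser b) (n - i)))"
    using less.IH by (intro polynomial_fun_add polynomial_fun_sum polynomial_fun_mult uy
        polynomial_fun_y_ser) auto
  ultimately show ?case by simp
qed

text \<open>The representative of the left \<open>H_minus\<close>-orbit with lower right entry 1. An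
  invariant function is determined by its values on such matrices, whose entries are polynomial in
  the coordinates.\<close>

definition normal_form :: "loop_mat \<Rightarrow> loop_mat" where
  "normal_form b = fps_mat (1 + u_ser b * v_ser b) (v_ser b) (u_ser b) 1"

lemma normal_form_B_minus: "b \<in> B_minus \<Longrightarrow> normal_form b \<in> B_minus"
  by (simp add: normal_form_def fps_mat_B_minus_iff v_ser_def B_minus_entry(2))

lemma normal_form_equivalent:
  assumes "b \<in> B_minus"
  shows "\<exists>h\<in>H_minus. b = h ** normal_form b"
  using assms
proof (elim B_minus_cases)
  fix A B C D :: "complex fps"
  assume b: "b = fps_mat A B C D" and det: "A * D - B * C = 1" and nz: "fps_nth D 0 \<noteq> 0"
  have inv: "D * inverse D = 1" "inverse D * D = 1"
    using nz by (simp_all add: inverse_mult_eq_1 inverse_mult_eq_1')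
  have "inverse D * (1 + C * inverse D * (B * D)) = inverse D * (1 + C * B * (D * inverse D))"
    by (simp add: mult_ac)
  also have "\<dots> = inverse D * (A * D)" using det by (simp add: inv mult.commute diff_eq_eq)
  finally have "inverse D * (1 + C * inverse D * (B * D)) = A" by (simp add: inv mult_ac)
  moreover have "inverse D * (B * D) = B" "D * (C * inverse D) = C"
    using inv by (simp_all add: mult_ac)
  ultimately have "b = fps_mat (inverse D) 0 0 (inverse (inverse D)) ** normal_form b"
    using nz by (simp add: b normal_form_def u_ser_def v_ser_def fps_mat_mult
        fps_inverse_idempotent)
  moreover have "fps_mat (inverse D) 0 0 (inverse (inverse D)) \<in> H_minus"
    using nz by (auto simp: H_minus_iff fps_inverse_def)
  ultimately show ?thesis by blast
qed

lemma polynomial_fun_normal_form: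
  "\<phi> \<in> regular_functions \<Longrightarrow> polynomial_fun (\<lambda>b. \<phi> (normal_form b))"
proof (induction \<phi> rule: regular_functions.induct)
  case (const c)
  have "polynomial_fun (\<lambda>b. (\<lambda>b\<in>B_minus. c) (normal_form b)) \<longleftrightarrow> polynomial_fun (\<lambda>b. c)"
    by (rule polynomial_fun_cong) (simp add: normal_form_B_minus)
  then show ?case by (simp only: polynomial_fun_const)
next
  case (coeff i j k)
  have ser: "polynomial_fun (\<lambda>b. fps_nth (entry (normal_form b) i j) n)" for n
  proof -
    have "polynomial_fun (\<lambda>b. fps_nth (1 + u_ser b * v_ser b) n)"
      unfolding fps_add_nth
      by (intro polynomial_fun_add polynomial_fun_const polynomial_fun_series_mult
          polynomial_fun_u_ser polynomial_fun_v_ser)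
    then show ?thesis
      using exhaust_2[of i] exhaust_2[of j] polynomial_fun_v_ser polynomial_fun_u_ser
        polynomial_fun_const
      by (auto simp: normal_form_def)
  qed
  have "polynomial_fun (\<lambda>b. (\<lambda>b\<in>B_minus. fls_nth (b $ i $ j) k) (normal_form b)) \<longleftrightarrow>
      polynomial_fun (\<lambda>b. if k < 0 then 0 else fps_nth (entry (normal_form b) i j) (nat k))"
  proof (rule polynomial_fun_cong)
    fix b assume "b \<in> B_minus"
    then have "normal_form b \<in> B_minus" by (rule normal_form_B_minus)
    moreover from this have "normal_form b $ i $ j \<in> power_series" by (simp add: B_minus_def)
    ultimately show "(\<lambda>b\<in>B_minus. fls_nth (b $ i $ j) k) (normal_form b) =
        (if k < 0 then 0 else fps_nth (entry (normal_form b) i j) (nat k))"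
      by (auto simp: entry_def power_series_def)
  qed
  then show ?case using ser polynomial_fun_const by (cases "k < 0") auto
next
  case (add \<phi> \<psi>)
  have "polynomial_fun (\<lambda>b. (\<lambda>b\<in>B_minus. \<phi> b + \<psi> b) (normal_form b)) \<longleftrightarrow>
      polynomial_fun (\<lambda>b. \<phi> (normal_form b) + \<psi> (normal_form b))"
    by (rule polynomial_fun_cong) (simp add: normal_form_B_minus)
  then show ?case using add by (simp only: polynomial_fun_add)
next
  case (mult \<phi> \<psi>)
  have "polynomial_fun (\<lambda>b. (\<lambda>b\<in>B_minus. \<phi> b * \<psi> b) (normal_form b)) \<longleftrightarrow>
      polynomial_fun (\<lambda>b. \<phi> (normal_form b) * \<psi> (normal_form b))"
    by (rule polynomial_fun_cong) (simp add: normal_form_B_minus)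
  then show ?case using mult by (simp only: polynomial_fun_mult)
qed

lemma quotient_function_polynomial:
  assumes "\<phi> \<in> quotient_functions"
  shows "polynomial_fun \<phi>"
proof -
  have "polynomial_fun \<phi> \<longleftrightarrow> polynomial_fun (\<lambda>b. \<phi> (normal_form b))"
  proof (rule polynomial_fun_cong)
    fix b assume b: "b \<in> B_minus"
    obtain h where h: "h \<in> H_minus" "b = h ** normal_form b"
        using normal_form_equivalent[OF b] by blast
    have "\<phi> (h ** normal_form b) = \<phi> (normal_form b)"
      using h(1) assms normal_form_B_minus[OF b] by (simp add: quotient_functions_def)
    then show "\<phi> b = \<phi> (normal_form b)"
      using h(2) by metis
  qed
  then show ?thesis
    using assms polynomial_fun_normal_form by (simp add: quotient_functions_def)
qed

lemma coord_surjective: "\<exists>b\<in>B_minus. \<forall>g. coord g b = t g"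
proof -
  define u where "u = Abs_fps (\<lambda>i. (- 1) ^ i * t (GenU i))"
  define y where "y = Abs_fps (\<lambda>i. if i = 0 then 0 else - ((- 1) ^ (i - 1) * t (GenM (i - 1))))"
  \<comment> \<open>The solution of v = y (1 + uv), invertible since \<open>y\<close> has no
    constant term.\<close>
  define v where "v = y * inverse (1 - u * y)"
  define b where "b = fps_mat (1 + u * v) v u 1"
  have y0: "fps_nth y 0 = 0" by (simp add: y_def)
  have inv: "(1 - u * y) * inverse (1 - u * y) = 1" by (simp add: inverse_mult_eq_1' y0)
  have "(1 - u * y) * (1 + u * v) = 1 - u * y + u * y * ((1 - u * y) * inverse (1 - u * y))"
    by (simp add: v_def algebra_simps)
  then have one: "(1 - u * y) * (1 + u * v) = 1" by (simp add: inv)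
  have b: "b \<in> B_minus"
    by (simp add: b_def fps_mat_B_minus_iff v_def y0 algebra_simps)
  have "u_ser b = u" by (simp add: b_def u_ser_def)
  moreover have "y_ser b = y"
  proof -
    have "v * inverse (1 + u * v) = y"
    proof -
      have nz: "fps_nth (1 + u * v) 0 \<noteq> 0" by (simp add: v_def y0)
      have "v = y * (1 + u * v)"
        using one inv by (metis (no_types, lifting) v_def mult.assoc mult.commute
            mult.right_neutral)
      then have "v * inverse (1 + u * v) = y * ((1 + u * v) * inverse (1 + u * v))"
        by (metis mult.assoc)
      then show ?thesis by (simp only: inverse_mult_eq_1'[OF nz] mult.right_neutral)
    qed
    then show ?thesis by (simp add: b_def y_ser_def)
  qed
  ultimately have "coord g b = t g" for g
    by (cases g) (simp_all add: u_coord_eq[OF b] m_coord_eq[OF b] u_def y_def flip: mult.assoc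
        power_add)
  then show ?thesis using b by blast
qed

section \<open>Velocities and the triangular decomposition\<close>

text \<open>The range of summation depends only on the bounds \<open>m\<close> and \<open>n\<close>,
  so along a curve with uniform bounds each coefficient of a product is one fixed finite
  sum.\<close>

lemma fls_times_nth_bounded:
  fixes f g :: loop
  assumes f: "\<And>k. k < m \<Longrightarrow> fls_nth f k = 0" and g: "\<And>k. k < n \<Longrightarrow> fls_nth g k = 0"
  shows "fls_nth (f * g) k = (\<Sum>i=m..k - n. fls_nth f i * fls_nth g (k - i))"
proof (cases "f = 0 \<or> g = 0")
  case False
  then have "m \<le> fls_subdegree f" "n \<le> fls_subdegree g"
    using f g nth_fls_subdegree_nonzero by (metis not_le)+
  then show ?thesis
    unfolding fls_times_nth(2) by (intro sum.mono_neutral_left) auto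
qed auto

lemma polys_mult_nth:
  assumes "f \<in> polys" "g \<in> polys" "0 \<le> k"
  shows "fls_nth (f * g) k = (if k = 0 then fls_nth f 0 * fls_nth g 0 else 0)"
proof -
  let ?m = "fls_subdegree f" and ?n = "fls_subdegree g"
  have "fls_nth (f * g) k = (\<Sum>i=?m..k - ?n. if i = 0 \<and> k = 0 then fls_nth f 0 * fls_nth g 0 else 0)"
    unfolding fls_times_nth(2)
  proof (rule sum.cong[OF refl])
    fix i
    show "fls_nth f i * fls_nth g (k - i) = (if i = 0 \<and> k = 0 then fls_nth f 0 *
        fls_nth g 0 else 0)"
    proof (cases "0 < i \<or> 0 < k - i")
      case False
      then have "i = 0" "k = 0" using assms(3) by linarith+
      then show ?thesis by simp
    qed (use assms in \<open>auto simp: polys_def\<close>)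
  qed
  also have "\<dots> = (if k = 0 then fls_nth f 0 * fls_nth g 0 else 0)"
  proof (cases "k = 0 \<and> 0 \<in> {?m..k - ?n}")
    case True
    then show ?thesis by auto
  next
    case False
    then have "k = 0 \<Longrightarrow> fls_nth f 0 * fls_nth g 0 = 0"
      by (cases "0 < ?m") (auto simp: fls_eq0_below_subdegree)
    then show ?thesis by (auto intro!: sum.neutral)
  qed
  finally show ?thesis .
qed

lemma polys_mult: "f \<in> polys \<Longrightarrow> g \<in> polys \<Longrightarrow> f * g \<in> polys"
  unfolding polys_def[of] using polys_mult_nth[of f g] by (simp add: polys_def)

section \<open>Uniqueness of the decomposition into lower and upper factors\<close>

definition adj :: "loop_mat \<Rightarrow> loop_mat" where
  "adj g = mat22 (g $ 2 $ 2) (- (g $ 1 $ 2)) (- (g $ 2 $ 1)) (g $ 1 $ 1)"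

lemma adj_inverse:
  assumes "det g = 1"
  shows "adj g ** g = mat 1" "g ** adj g = mat 1"
  using assms by (auto simp: adj_def det_2 mat_1_mat22 matrix_mult_nth_2 algebra_simps intro!:
      mat22_eqI)

lemma adj_mat22 [simp]: "adj (mat22 a b c d) = mat22 d (- b) (- c) a"
  by (simp add: adj_def)

lemma adj_fps_mat: "adj (fps_mat A B C D) = fps_mat D (- B) (- C) A"
  by (simp add: fps_mat_def)

lemma det_B_minus: "b \<in> B_minus \<Longrightarrow> det b = 1" and det_N_plus: "n \<in> N_plus \<Longrightarrow> det n = 1"
  by (simp_all add: B_minus_def N_plus_def SL2_loop_def)

lemma adj_B_minus: "b \<in> B_minus \<Longrightarrow> adj b \<in> B_minus"
  by (elim B_minus_cases) (simp add: adj_fps_mat fps_mat_B_minus_iff mult.commute)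

lemma polys_add: "f \<in> polys \<Longrightarrow> g \<in> polys \<Longrightarrow> f + g \<in> polys"
  and polys_uminus: "f \<in> polys \<Longrightarrow> - f \<in> polys"
  by (simp_all add: polys_def)

lemma N_plus_mult: "n \<in> N_plus \<Longrightarrow> n' \<in> N_plus \<Longrightarrow> n ** n' \<in> N_plus"
  unfolding N_plus_def SL2_loop_def
  by (auto simp: det_mul matrix_mult_nth_2 polys_mult_nth polys_add polys_mult)

lemma adj_N_plus: "n \<in> N_plus \<Longrightarrow> adj n \<in> N_plus"
  unfolding N_plus_def SL2_loop_def
  by (auto simp: adj_def forall_2 det_2 polys_uminus mult.commute)

text \<open>An entry that is both a power series in \<lambda>^-1 and a polynomial in \<lambda> is
  constant, and a constant matrix that is both lower triangular and upper unipotent is the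
  identity.\<close>

lemma B_minus_Int_N_plus: "b \<in> B_minus \<Longrightarrow> b \<in> N_plus \<Longrightarrow> b = mat 1"
proof -
  assume b: "b \<in> B_minus" "b \<in> N_plus"
  have "fls_nth (b $ i $ j) k = (if k = 0 then fls_nth (b $ i $ j) 0 else 0)" for i j k
    using b by (cases "k < 0"; cases "k > 0") (auto simp: B_minus_def N_plus_def power_series_def
        polys_def)
  then have const: "b $ i $ j = fls_const (fls_nth (b $ i $ j) 0)" for i j
    by (intro fls_eqI) (metis fls_const_nth)
  have "fls_nth (b $ 1 $ 1) 0 = 1" "fls_nth (b $ 1 $ 2) 0 = 0" "fls_nth (b $ 2 $ 1) 0 = 0"
    "fls_nth (b $ 2 $ 2) 0 = 1"
    using b by (simp_all add: B_minus_def N_plus_def)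
  then have "b $ 1 $ 1 = 1" "b $ 1 $ 2 = 0" "b $ 2 $ 1 = 0" "b $ 2 $ 2 = 1"
    using const by (metis fls_const_0 fls_const_1)+
  then show ?thesis unfolding mat_1_mat22 by (intro mat22_eqI) simp_all
qed

lemma mat_1_N_plus: "mat 1 \<in> N_plus"
  by (auto simp: N_plus_def SL2_loop_def mat_1_mat22 forall_2 polys_def)

lemma cell_decomposition_unique:
  assumes "b \<in> B_minus" "b' \<in> B_minus" "n \<in> N_plus" "n' \<in> N_plus" "b ** n = b' ** n'"
  shows "b = b'" "n = n'"
proof -
  have "adj b' ** b = adj b' ** (b ** n) ** adj n"
    by (simp add: matrix_mul_assoc[symmetric] adj_inverse det_N_plus assms(3))
  also have "\<dots> = n' ** adj n"
    unfolding assms(5) by (simp add: matrix_mul_assoc adj_inverse det_B_minus assms)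
  finally have eq: "adj b' ** b = n' ** adj n" .
  have "adj b' ** b = mat 1"
    using B_minus_mult[OF adj_B_minus[OF assms(2)] assms(1)]
      N_plus_mult[OF assms(4) adj_N_plus[OF assms(3)]] unfolding eq by (rule B_minus_Int_N_plus)
  then have "b' ** (adj b' ** b) = b'" by simp
  then show "b = b'" by (simp add: matrix_mul_assoc adj_inverse det_B_minus assms)
  have "n' ** adj n ** n = n" using eq \<open>adj b' ** b = mat 1\<close> by (metis matrix_mul_lid)
  then show "n = n'" by (simp add: matrix_mul_assoc[symmetric] adj_inverse det_N_plus assms)
qed

lemma lift_fun_mult:
  assumes "b \<in> B_minus" "n \<in> N_plus"
  shows "lift_fun \<phi> (b ** n) = \<phi> b"
proof -
  have "(THE b'. b' \<in> B_minus \<and> (\<exists>n'\<in>N_plus. b ** n = b' ** n')) = b"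
    using assms by (intro the_equality) (auto dest: cell_decomposition_unique)
  then show ?thesis by (simp add: lift_fun_def)
qed

section \<open>Coefficientwise derivatives of curves\<close>

definition loop_velocity :: "(complex \<Rightarrow> loop) \<Rightarrow> loop \<Rightarrow> bool" where
  "loop_velocity f F \<longleftrightarrow> (\<forall>k. ((\<lambda>t. fls_nth (f t) k) has_field_derivative fls_nth F k) (at 0))"

lemma has_velocity_iff: "has_velocity \<gamma> V \<longleftrightarrow> (\<forall>i j. loop_velocity (\<lambda>t. \<gamma> t $ i $ j) (V $ i $ j))"
  by (simp add: has_velocity_def loop_velocity_def)

lemma loop_velocity_const: "loop_velocity (\<lambda>t. f) 0"
  by (simp add: loop_velocity_def)

lemma loop_velocity_unique: "loop_velocity f F \<Longrightarrow> loop_velocity f G \<Longrightarrow> F = G"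
  unfolding loop_velocity_def by (intro fls_eqI) (metis DERIV_unique)

lemma loop_velocity_add:
  "loop_velocity f F \<Longrightarrow> loop_velocity g G \<Longrightarrow> loop_velocity (\<lambda>t. f t + g t) (F + G)"
  by (simp add: loop_velocity_def DERIV_add)

lemma loop_velocity_linear: "loop_velocity (\<lambda>t. f + fls_const t * g) g"
  unfolding loop_velocity_def by (auto intro!: derivative_eq_intros)

lemma loop_velocity_nth_const:
  assumes "loop_velocity f F" "\<And>t. fls_nth (f t) k = c"
  shows "fls_nth F k = 0"
proof -
  have "((\<lambda>t. fls_nth (f t) k) has_field_derivative fls_nth F k) (at 0)"
    using assms(1) by (simp add: loop_velocity_def)
  then have "((\<lambda>t. c) has_field_derivative fls_nth F k) (at 0)"
    by (simp only: assms(2))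
  then show ?thesis using DERIV_const by (rule DERIV_unique)
qed

text \<open>The uniform bounds make every coefficient of the product a finite sum with a range
  independent of the parameter, so the ordinary product rule applies term by term; the velocities
  inherit the bounds.\<close>

lemma loop_velocity_mult:
  assumes f: "loop_velocity f F" "\<And>t k. k < m \<Longrightarrow> fls_nth (f t) k = 0"
    and g: "loop_velocity g G" "\<And>t k. k < n \<Longrightarrow> fls_nth (g t) k = 0"
  shows "loop_velocity (\<lambda>t. f t * g t) (F * g 0 + f 0 * G)"
proof -
  have F: "fls_nth F k = 0" if "k < m" for k
    using loop_velocity_nth_const[OF f(1)] f(2)[OF that] by blast
  have G: "fls_nth G k = 0" if "k < n" for k
    using loop_velocity_nth_const[OF g(1)] g(2)[OF that] by blast
  show ?thesis
    unfolding loop_velocity_def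
  proof
    fix k
    have "((\<lambda>t. \<Sum>i=m..k - n. fls_nth (f t) i * fls_nth (g t) (k - i)) has_field_derivative
        (\<Sum>i=m..k - n. fls_nth F i * fls_nth (g 0) (k - i) + fls_nth G (k - i) * fls_nth (f 0) i))
            (at 0)"
      using f(1) g(1) unfolding loop_velocity_def by (intro DERIV_sum DERIV_mult) auto
    moreover have "fls_nth (f t * g t) k = (\<Sum>i=m..k - n. fls_nth (f t) i * fls_nth (g t) (k -
        i))" for t
      by (rule fls_times_nth_bounded[OF f(2) g(2)])
    moreover have "fls_nth (F * g 0 + f 0 * G) k =
        (\<Sum>i=m..k - n. fls_nth F i * fls_nth (g 0) (k - i) + fls_nth G (k - i) * fls_nth (f 0) i)"
      by (simp add: fls_times_nth_bounded[OF F g(2)] fls_times_nth_bounded[OF f(2) G] sum.distrib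
          mult.commute[of "fls_nth G _"])
    ultimately show "((\<lambda>t. fls_nth (f t * g t) k) has_field_derivative fls_nth (F * g 0 + f 0 *
        G) k) (at 0)"
      by simp
  qed
qed

definition bounded_below :: "(complex \<Rightarrow> loop_mat) \<Rightarrow> int \<Rightarrow> bool" where
  "bounded_below \<gamma> m \<longleftrightarrow> (\<forall>t i j. \<forall>k<m. fls_nth (\<gamma> t $ i $ j) k = 0)"

lemma has_velocity_mult:
  assumes "has_velocity \<gamma> V" "bounded_below \<gamma> m" "has_velocity \<eta> W" "bounded_below \<eta> n"
  shows "has_velocity (\<lambda>t. \<gamma> t ** \<eta> t) (V ** \<eta> 0 + \<gamma> 0 ** W)"
proof -
  have "loop_velocity (\<lambda>t. \<gamma> t $ i $ l * \<eta> t $ l $ j) (V $ i $ l * \<eta> 0 $ l $ j + \<gamma> 0 $ i $ l *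
      W $ l $ j)"
    for i j l
    using assms unfolding has_velocity_iff bounded_below_def by
        (intro loop_velocity_mult[where m = m and n = n]) auto
  from loop_velocity_add[OF this[of _ 1] this[of _ 2]] show ?thesis
    unfolding has_velocity_iff by (simp add: matrix_mult_nth_2 add_ac)
qed

lemma bounded_below_mult:
  assumes "bounded_below \<gamma> m" "bounded_below \<eta> n"
  shows "bounded_below (\<lambda>t. \<gamma> t ** \<eta> t) (m + n)"
  unfolding bounded_below_def
proof (intro allI impI)
  fix t i j k assume k: "k < m + n"
  have "fls_nth (\<gamma> t $ i $ l * \<eta> t $ l $ j) k = 0" for l
  proof -
    have "fls_nth (\<gamma> t $ i $ l * \<eta> t $ l $ j) k =
        (\<Sum>a=m..k - n. fls_nth (\<gamma> t $ i $ l) a * fls_nth (\<eta> t $ l $ j) (k - a))"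
      using assms unfolding bounded_below_def by (intro fls_times_nth_bounded) auto
    then show ?thesis using k by simp
  qed
  then show "fls_nth ((\<gamma> t ** \<eta> t) $ i $ j) k = 0" by (simp add: matrix_mult_nth_2)
qed

lemma has_velocity_const: "has_velocity (\<lambda>t. g) 0"
  by (simp add: has_velocity_iff loop_velocity_const)

lemma has_velocity_unique: "has_velocity \<gamma> V \<Longrightarrow> has_velocity \<gamma> W \<Longrightarrow> V = W"
  unfolding has_velocity_iff vec_eq_iff by (metis loop_velocity_unique)

lemma B_minus_bounded_below: "(\<And>t. \<beta> t \<in> B_minus) \<Longrightarrow> bounded_below \<beta> 0"
  by (simp add: bounded_below_def B_minus_def power_series_def)

definition strict_part :: "loop \<Rightarrow> complex fps" where
  "strict_part x = fls_regpart x - fps_const (fls_nth x 0)"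

lemma strict_part_0 [simp]: "fps_nth (strict_part x) 0 = 0"
  by (simp add: strict_part_def)

text \<open>Projection to the tangent directions of \<open>B_minus\<close> along those of
  \<open>N_plus\<close>. Only the upper right entry is cut strictly, since its constant term belongs
  to the upper factor.\<close>

definition lower_part :: "loop_mat \<Rightarrow> loop_mat" where
  "lower_part X = fps_mat (fls_regpart (X $ 1 $ 1)) (strict_part (X $ 1 $ 2))
     (fls_regpart (X $ 2 $ 1)) (fls_regpart (X $ 2 $ 2))"

lemma lower_part_add: "lower_part (X + Y) = lower_part X + lower_part Y"
  by (simp add: lower_part_def strict_part_def fps_mat_def mat22_add fps_const_add[symmetric]
      del: fps_const_add)

text \<open>Without a trace condition this is closed under multiplication and contains the group
  \<open>B_minus\<close> as well as its tangent vectors.\<close>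

definition lower_algebra :: "loop_mat set" where
  "lower_algebra = {X. (\<forall>i j. X $ i $ j \<in> power_series) \<and> fls_nth (X $ 1 $ 2) 0 = 0}"

definition upper_algebra :: "loop_mat set" where
  "upper_algebra = {X. (\<forall>i j. X $ i $ j \<in> polys) \<and> fls_nth (X $ 1 $ 1) 0 = 0 \<and>
     fls_nth (X $ 2 $ 2) 0 = 0 \<and> fls_nth (X $ 2 $ 1) 0 = 0}"

lemma lower_part_lower: "X \<in> lower_algebra \<Longrightarrow> lower_part X = X"
  by (rule mat22_eqI) (auto simp: lower_part_def lower_algebra_def strict_part_def power_series_iff)

lemma lower_part_in: "lower_part X \<in> lower_algebra"
  by (simp add: lower_part_def lower_algebra_def forall_2)

lemma regpart_poly: "f \<in> polys \<Longrightarrow> fls_regpart f = fps_const (fls_nth f 0)"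
  by (rule fps_ext) (auto simp: polys_def)

lemma lower_part_upper: "X \<in> upper_algebra \<Longrightarrow> lower_part X = 0"
  by (rule mat22_eqI) (auto simp: lower_part_def upper_algebra_def strict_part_def regpart_poly)

lemma lower_algebra_iff:
  "X \<in> lower_algebra \<longleftrightarrow> (\<exists>A B C D. X = fps_mat A B C D \<and> fps_nth B 0 = 0)"
proof
  assume X: "X \<in> lower_algebra"
  then show "\<exists>A B C D. X = fps_mat A B C D \<and> fps_nth B 0 = 0"
    using lower_part_lower[OF X] unfolding lower_part_def
    by (metis strict_part_0)
qed (auto simp: lower_algebra_def forall_2)

lemma lower_algebra_mult: "X \<in> lower_algebra \<Longrightarrow> Y \<in> lower_algebra \<Longrightarrow> X ** Y \<in> lower_algebra"
  by (auto simp: lower_algebra_iff fps_mat_mult)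

lemma B_minus_lower_algebra: "B_minus \<subseteq> lower_algebra"
  by (auto simp: B_minus_def lower_algebra_def)

lemma velocity_lower:
  assumes "\<And>t. \<beta> t \<in> B_minus" "has_velocity \<beta> V"
  shows "V \<in> lower_algebra"
proof -
  have "fls_nth (V $ i $ j) k = 0" if "\<And>t. fls_nth (\<beta> t $ i $ j) k = 0" for i j k
    using loop_velocity_nth_const[of _ "V $ i $ j" k 0] assms(2) that by
        (auto simp: has_velocity_iff)
  then show ?thesis
    using assms(1) by (simp add: B_minus_def lower_algebra_def power_series_def)
qed

lemma velocity_upper:
  assumes "\<And>t. \<nu> t \<in> N_plus" "has_velocity \<nu> W"
  shows "W \<in> upper_algebra"
proof -
  have "fls_nth (W $ i $ j) k = 0" if "\<And>t. fls_nth (\<nu> t $ i $ j) k = c" for i j k c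
    using loop_velocity_nth_const[of _ "W $ i $ j" k c] assms(2) that by
        (auto simp: has_velocity_iff)
  moreover have "\<And>t i j k. 0 < k \<Longrightarrow> fls_nth (\<nu> t $ i $ j) k = 0"
    "\<And>t. fls_nth (\<nu> t $ 1 $ 1) 0 = 1" "\<And>t. fls_nth (\<nu> t $ 2 $ 2) 0 = 1" "\<And>t. fls_nth
        (\<nu> t $ 2 $ 1) 0 = 0"
    using assms(1) by (auto simp: N_plus_def polys_def)
  ultimately show ?thesis
    by (simp add: upper_algebra_def polys_def)
qed

text \<open>At a point of \<open>B_minus\<close> the upper factor starts at the identity.
  Differentiating the product and multiplying by \<open>adj b\<close> splits \<open>X\<close> into a
  lower and an upper summand, and \<open>lower_part\<close> picks out the first.\<close>

lemma cell_curve_velocity: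
  assumes \<beta>\<nu>: "cell_curve \<beta> \<nu>" and b: "b \<in> B_minus" "\<beta> 0 ** \<nu> 0 = b"
    and V: "has_velocity (\<lambda>t. \<beta> t ** \<nu> t) (b ** X)"
  shows "\<beta> 0 = b" "has_velocity \<beta> (b ** lower_part X)"
proof -
  obtain V\<beta> W d where
    *: "\<And>t. \<beta> t \<in> B_minus" "\<And>t. \<nu> t \<in> N_plus" "has_velocity \<beta> V\<beta>" "has_velocity \<nu> W"
    "bounded_below \<nu> (- d)"
    using \<beta>\<nu> unfolding cell_curve_def bounded_below_def by blast
  show \<beta>0: "\<beta> 0 = b"
    using cell_decomposition_unique(1)[OF *(1) b(1) *(2) mat_1_N_plus] b(2) by simp
  have \<nu>0: "\<nu> 0 = mat 1"
    using cell_decomposition_unique(2)[OF *(1) b(1) *(2) mat_1_N_plus] b(2) by simp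
  have "b ** X = V\<beta> ** \<nu> 0 + \<beta> 0 ** W"
    using has_velocity_unique[OF V] has_velocity_mult[OF *(3) B_minus_bounded_below[OF *(1)]
        *(4,5)] .
  then have "adj b ** (b ** X) = adj b ** (V\<beta> + b ** W)" by (simp add: \<beta>0 \<nu>0)
  then have "X = adj b ** V\<beta> + W"
    by (simp add: matrix_mul_assoc matrix_add_ldistrib adj_inverse det_B_minus b)
  moreover have "lower_part W = 0"
    using lower_part_upper velocity_upper[OF *(2,4)] by blast
  moreover have "lower_part (adj b ** V\<beta>) = adj b ** V\<beta>"
    using adj_B_minus[OF b(1)] B_minus_lower_algebra velocity_lower[OF *(1,3)]
    by (intro lower_part_lower lower_algebra_mult) auto
  ultimately have "b ** lower_part X = b ** (adj b ** V\<beta>)"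
    by (simp add: lower_part_add)
  also have "\<dots> = V\<beta>" by (simp add: matrix_mul_assoc adj_inverse det_B_minus b)
  finally show "has_velocity \<beta> (b ** lower_part X)" using *(3) by simp
qed

section \<open>Derivatives of the coordinate functions\<close>

definition traceless :: "loop_mat \<Rightarrow> bool" where
  "traceless X \<longleftrightarrow> X $ 1 $ 1 + X $ 2 $ 2 = 0"

text \<open>The curve 1 + tX, which for nilpotent \<open>X\<close> is the exponential. The zero
  summands keep each entry in the form required by \<open>loop_velocity_linear\<close>.\<close>

definition affine_curve :: "loop_mat \<Rightarrow> complex \<Rightarrow> loop_mat" where
  "affine_curve X t = mat22 (1 + fls_const t * X $ 1 $ 1) (0 + fls_const t * X $ 1 $ 2)
     (0 + fls_const t * X $ 2 $ 1) (1 + fls_const t * X $ 2 $ 2)"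

lemma affine_curve_0: "affine_curve X 0 = mat 1"
  by (simp add: affine_curve_def mat_1_mat22)

lemma has_velocity_affine_curve: "has_velocity (affine_curve X) X"
  unfolding has_velocity_iff forall_2 affine_curve_def mat22_nth by
      (intro conjI loop_velocity_linear)

lemma det_affine_curve:
  assumes "traceless X" "det X = 0"
  shows "det (affine_curve X t) = 1"
proof -
  have "(1 + s * x) * (1 + s * w) - (0 + s * y) * (0 + s * z) = 1 + s * (x + w) + s * s * (x *
      w - y * z)"
    for s x y z w :: loop
    by (simp add: algebra_simps)
  then have "det (affine_curve X t) =
      1 + fls_const t * (X $ 1 $ 1 + X $ 2 $ 2) + fls_const t * fls_const t * det X"
    unfolding affine_curve_def det_2 mat22_nth .
  then show ?thesis using assms by (simp add: traceless_def)
qed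

lemma affine_curve_B_minus:
  assumes "X \<in> lower_algebra" "traceless X" "det X = 0"
  shows "affine_curve X t \<in> B_minus"
  using assms det_affine_curve[OF assms(2,3)]
  by (auto simp: B_minus_def SL2_loop_def lower_algebra_def affine_curve_def forall_2
      power_series_def)

lemma affine_curve_N_plus:
  assumes "X \<in> upper_algebra" "traceless X" "det X = 0"
  shows "affine_curve X t \<in> N_plus"
  using assms det_affine_curve[OF assms(2,3)]
  by (auto simp: N_plus_def SL2_loop_def upper_algebra_def affine_curve_def forall_2 polys_def)

definition tangent_B :: "loop_mat \<Rightarrow> bool" where
  "tangent_B X \<longleftrightarrow> (\<exists>\<beta>. (\<forall>t. \<beta> t \<in> B_minus) \<and> \<beta> 0 = mat 1 \<and> has_velocity \<beta> X)"

definition tangent_N :: "loop_mat \<Rightarrow> bool" where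
  "tangent_N X \<longleftrightarrow> (\<exists>\<nu> m. (\<forall>t. \<nu> t \<in> N_plus) \<and> \<nu> 0 = mat 1 \<and> has_velocity \<nu> X \<and> bounded_below \<nu> m)"

lemma tangent_B_add:
  assumes "tangent_B X" "tangent_B Y"
  shows "tangent_B (X + Y)"
proof -
  obtain \<beta> \<beta>' where *: "\<And>t. \<beta> t \<in> B_minus" "\<beta> 0 = mat 1" "has_velocity \<beta> X"
    "\<And>t. \<beta>' t \<in> B_minus" "\<beta>' 0 = mat 1" "has_velocity \<beta>' Y"
    using assms unfolding tangent_B_def by blast
  have "has_velocity (\<lambda>t. \<beta> t ** \<beta>' t) (X ** \<beta>' 0 + \<beta> 0 ** Y)"
    by (rule has_velocity_mult[OF *(3) B_minus_bounded_below[OF *(1)] *(6)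
        B_minus_bounded_below[OF *(4)]])
  then show ?thesis
    unfolding tangent_B_def using * B_minus_mult by (intro exI[of _ "\<lambda>t. \<beta> t ** \<beta>' t"]) simp
qed

lemma tangent_N_add:
  assumes "tangent_N X" "tangent_N Y"
  shows "tangent_N (X + Y)"
proof -
  obtain \<nu> \<nu>' m m' where *: "\<And>t. \<nu> t \<in> N_plus" "\<nu> 0 = mat 1" "has_velocity \<nu> X" "bounded_below \<nu> m"
    "\<And>t. \<nu>' t \<in> N_plus" "\<nu>' 0 = mat 1" "has_velocity \<nu>' Y" "bounded_below \<nu>' m'"
    using assms unfolding tangent_N_def by blast
  have "has_velocity (\<lambda>t. \<nu> t ** \<nu>' t) (X ** \<nu>' 0 + \<nu> 0 ** Y)"
    by (rule has_velocity_mult[OF *(3,4,7,8)])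
  moreover have "bounded_below (\<lambda>t. \<nu> t ** \<nu>' t) (m + m')"
    by (rule bounded_below_mult[OF *(4,8)])
  ultimately show ?thesis
    unfolding tangent_N_def using * N_plus_mult
    by (intro exI[of _ "\<lambda>t. \<nu> t ** \<nu>' t"] exI[of _ "m + m'"]) simp
qed

lemma tangent_B_nilpotent: "X \<in> lower_algebra \<Longrightarrow> traceless X \<Longrightarrow> det X = 0 \<Longrightarrow> tangent_B X"
  unfolding tangent_B_def
  using affine_curve_B_minus affine_curve_0 has_velocity_affine_curve by blast

lemma tangent_N_nilpotent:
  assumes "X \<in> upper_algebra" "traceless X" "det X = 0"
  shows "tangent_N X"
proof -
  define m where "m = min 0 (Min (range (\<lambda>(i, j). fls_subdegree (X $ i $ j))))"
  have "m \<le> fls_subdegree (X $ i $ j)" for i j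
    unfolding m_def by (intro min.coboundedI2 Min_le) (auto intro: rev_image_eqI[of "(i, j)"])
  then have "fls_nth (X $ i $ j) k = 0" if "k < m" for i j k
    using that by (meson fls_eq0_below_subdegree less_le_trans)
  moreover have "m \<le> 0" by (simp add: m_def)
  ultimately have "bounded_below (affine_curve X) m"
    unfolding bounded_below_def by (auto simp: forall_2 affine_curve_def)
  then show ?thesis
    unfolding tangent_N_def
    using affine_curve_N_plus[OF assms] affine_curve_0 has_velocity_affine_curve by blast
qed

lemma tangent_B_constant_diagonal: "tangent_B (mat22 (fls_const c) 0 0 (- fls_const c))"
proof -
  define \<beta> where "\<beta> t = mat22 (fls_const (exp (c * t))) 0 0 (fls_const (exp (- (c * t))))" for t
  have "loop_velocity (\<lambda>t. fls_const (exp (a * t))) (fls_const a)" for a :: complex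
    unfolding loop_velocity_def by (auto intro!: derivative_eq_intros)
  from this[of c] this[of "- c"] have "has_velocity \<beta> (mat22 (fls_const c) 0 0 (- fls_const c))"
    unfolding has_velocity_iff forall_2 \<beta>_def by (simp add: loop_velocity_const)
  moreover have "\<beta> t \<in> B_minus" for t
    by (simp add: \<beta>_def B_minus_def SL2_loop_def forall_2 power_series_def fls_const_mult_const
        exp_minus_inverse)
  moreover have "\<beta> 0 = mat 1" by (simp add: \<beta>_def mat_1_mat22)
  ultimately show ?thesis unfolding tangent_B_def by blast
qed

text \<open>
  A traceless matrix is a sum of nilpotent matrices with entries of the same kind; only the constant
  diagonal part of the lower algebra needs a genuine exponential.
\<close>

lemma traceless_decomposition:
  fixes X :: loop_mat and c :: loop
  assumes "traceless X"
  defines "x \<equiv> X $ 1 $ 1 - c"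
  shows "X = mat22 c 0 0 (- c) + (mat22 x (- x) x (- x) +
    (mat22 0 (X $ 1 $ 2 + x) 0 0 + mat22 0 0 (X $ 2 $ 1 - x) 0))"
proof (rule mat22_eqI)
  have "X $ 2 $ 2 = - (X $ 1 $ 1)"
    using assms(1) by (simp add: traceless_def eq_neg_iff_add_eq_0 add.commute)
  then show "X $ 2 $ 2 = (mat22 c 0 0 (- c) + (mat22 x (- x) x (- x) +
    (mat22 0 (X $ 1 $ 2 + x) 0 0 + mat22 0 0 (X $ 2 $ 1 - x) 0))) $ 2 $ 2"
    by (simp add: x_def)
qed (simp_all add: x_def)

lemma tangent_B_lower:
  assumes "X \<in> lower_algebra" "traceless X"
  shows "tangent_B X"
proof -
  \<comment> \<open>Removing the constant term makes \<open>- x\<close> and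
    \<open>X $ 1 $ 2 + x\<close> admissible upper right entries of the lower algebra.\<close>
  define x where "x = X $ 1 $ 1 - fls_const (fls_nth (X $ 1 $ 1) 0)"
  have x: "fls_nth x 0 = 0" "x \<in> power_series"
    using assms(1) by (auto simp: x_def lower_algebra_def power_series_def)
  have "tangent_B (mat22 x (- x) x (- x))" "tangent_B (mat22 0 (X $ 1 $ 2 + x) 0 0)"
    "tangent_B (mat22 0 0 (X $ 2 $ 1 - x) 0)"
    using assms(1) x
    by (auto intro!: tangent_B_nilpotent simp: lower_algebra_def traceless_def forall_2
        power_series_def)
  then show ?thesis
    using traceless_decomposition[OF assms(2), of "fls_const (fls_nth (X $ 1 $ 1) 0)"]
      tangent_B_constant_diagonal tangent_B_add unfolding x_def by metis
qed

lemma tangent_N_upper: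
  assumes "X \<in> upper_algebra" "traceless X"
  shows "tangent_N X"
proof -
  define x where "x = X $ 1 $ 1"
  have x: "fls_nth x 0 = 0" "x \<in> polys"
    using assms(1) by (auto simp: x_def upper_algebra_def)
  have N: "tangent_N (mat22 x (- x) x (- x))" "tangent_N (mat22 0 (X $ 1 $ 2 + x) 0 0)"
    "tangent_N (mat22 0 0 (X $ 2 $ 1 - x) 0)"
    using assms(1) x
    by (auto intro!: tangent_N_nilpotent simp: upper_algebra_def traceless_def forall_2 polys_def)
  have "X = mat22 x (- x) x (- x) + (mat22 0 (X $ 1 $ 2 + x) 0 0 + mat22 0 0 (X $ 2 $ 1 - x) 0)"
    using traceless_decomposition[OF assms(2), of 0] by (simp add: x_def mat22_add)
  then show ?thesis
    using N tangent_N_add by metis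
qed

lemma upper_part_in: "X - lower_part X \<in> upper_algebra"
  by (auto simp: upper_algebra_def lower_part_def forall_2 polys_def strict_part_def)

lemma traceless_lower_part: "traceless X \<Longrightarrow> traceless (lower_part X)"
  unfolding traceless_def lower_part_def fps_mat_nth
  by (metis fls_regpart_plus fls_regpart_zero fps_to_fls_plus fps_zero_to_fls)

lemma traceless_diff: "traceless X \<Longrightarrow> traceless Y \<Longrightarrow> traceless (X - Y)"
  by (simp add: traceless_def algebra_simps) (metis add.inverse_unique add.inverse_inverse)

text \<open>The lower part of \<open>X\<close> is realized inside \<open>B_minus\<close> and the
  rest inside \<open>N_plus\<close>. Existence of such a curve ensures that at most one value meets
  the description of \<open>cell_deriv\<close>.\<close>

lemma cell_curve_exists:
  assumes b: "b \<in> B_minus" and X: "traceless X"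
  obtains \<beta> \<nu> where "cell_curve \<beta> \<nu>" "\<beta> 0 ** \<nu> 0 = b" "has_velocity (\<lambda>t. \<beta> t ** \<nu> t) (b ** X)"
proof -
  obtain \<beta> where \<beta>: "\<And>t. \<beta> t \<in> B_minus" "\<beta> 0 = mat 1" "has_velocity \<beta> (lower_part X)"
    using tangent_B_lower[OF lower_part_in traceless_lower_part[OF X]] unfolding tangent_B_def by
        blast
  obtain \<nu> m where \<nu>: "\<And>t. \<nu> t \<in> N_plus" "\<nu> 0 = mat 1" "has_velocity \<nu> (X - lower_part X)"
    "bounded_below \<nu> m"
    using tangent_N_upper[OF upper_part_in traceless_diff[OF X traceless_lower_part[OF X]]]
    unfolding tangent_N_def by blast
  have "has_velocity (\<lambda>t. b ** \<beta> t) (0 ** \<beta> 0 + b ** lower_part X)"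
    by (rule has_velocity_mult[OF has_velocity_const B_minus_bounded_below[OF b] \<beta>(3)
          B_minus_bounded_below[OF \<beta>(1)]])
  then have b\<beta>: "has_velocity (\<lambda>t. b ** \<beta> t) (b ** lower_part X)" by simp
  have B: "b ** \<beta> t \<in> B_minus" for t by (rule B_minus_mult[OF b \<beta>(1)])
  have "has_velocity (\<lambda>t. (b ** \<beta> t) ** \<nu> t) ((b ** lower_part X) ** \<nu> 0 + (b ** \<beta> 0) ** (X -
      lower_part X))"
    by (rule has_velocity_mult[OF b\<beta> B_minus_bounded_below[OF B] \<nu>(3,4)])
  moreover have "(b ** lower_part X) ** \<nu> 0 + (b ** \<beta> 0) ** (X - lower_part X) = b ** X"
    by (simp add: \<beta>(2) \<nu>(2) flip: matrix_add_ldistrib)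
  moreover have "cell_curve (\<lambda>t. b ** \<beta> t) \<nu>"
    unfolding cell_curve_def using B \<nu> b\<beta>
    by (auto simp: bounded_below_def intro!: exI[of _ "- m"])
  ultimately show thesis using that[of "\<lambda>t. b ** \<beta> t" \<nu>] by (simp add: \<beta>(2) \<nu>(2))
qed

text \<open>The derivative depends on the curve only through its starting point and velocity; for
  coefficients this is the definition of velocity, and sums and products preserve it.\<close>

lemma regular_function_derivative:
  assumes "\<phi> \<in> regular_functions"
  shows "\<exists>L. \<forall>\<beta> V. (\<forall>t. \<beta> t \<in> B_minus) \<and> has_velocity \<beta> V \<longrightarrow>
     ((\<lambda>t. \<phi> (\<beta> t)) has_field_derivative L (\<beta> 0) V) (at 0)"
  using assms
proof (induction \<phi> rule: regular_functions.induct)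
  case (const c)
  show ?case by (rule exI[of _ "\<lambda>b V. 0"]) auto
next
  case (coeff i j k)
  show ?case
    by (rule exI[of _ "\<lambda>b V. fls_nth (V $ i $ j) k"]) (auto simp: has_velocity_def)
next
  case (add \<phi> \<psi>)
  then obtain L M where "\<forall>\<beta> V. (\<forall>t. \<beta> t \<in> B_minus) \<and> has_velocity \<beta> V \<longrightarrow>
     ((\<lambda>t. \<phi> (\<beta> t)) has_field_derivative L (\<beta> 0) V) (at 0)"
    "\<forall>\<beta> V. (\<forall>t. \<beta> t \<in> B_minus) \<and> has_velocity \<beta> V \<longrightarrow>
     ((\<lambda>t. \<psi> (\<beta> t)) has_field_derivative M (\<beta> 0) V) (at 0)" by blast
  then show ?case by (intro exI[of _ "\<lambda>b V. L b V + M b V"]) (auto intro!: DERIV_add)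
next
  case (mult \<phi> \<psi>)
  then obtain L M where "\<forall>\<beta> V. (\<forall>t. \<beta> t \<in> B_minus) \<and> has_velocity \<beta> V \<longrightarrow>
     ((\<lambda>t. \<phi> (\<beta> t)) has_field_derivative L (\<beta> 0) V) (at 0)"
    "\<forall>\<beta> V. (\<forall>t. \<beta> t \<in> B_minus) \<and> has_velocity \<beta> V \<longrightarrow>
     ((\<lambda>t. \<psi> (\<beta> t)) has_field_derivative M (\<beta> 0) V) (at 0)" by blast
  then show ?case
    by (intro exI[of _ "\<lambda>b V. L b V * \<psi> b + M b V * \<phi> b"]) (auto intro!: DERIV_mult)
qed

text \<open>The velocity of the \<open>B_minus\<close> factor is forced by \<open>X\<close>, so all
  curves in the definition of \<open>cell_deriv\<close> give the same value. Derivatives on the cell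
  are thereby computed inside \<open>B_minus\<close>.\<close>

lemma cell_deriv_curve:
  assumes \<phi>: "\<phi> \<in> regular_functions" and b: "b \<in> B_minus" and X: "traceless X"
    and \<beta>: "\<And>t. \<beta> t \<in> B_minus" "\<beta> 0 = b" "has_velocity \<beta> (b ** lower_part X)"
  shows "((\<lambda>t. \<phi> (\<beta> t)) has_field_derivative cell_deriv \<phi> b (b ** X)) (at 0)"
proof -
  obtain L where L: "\<And>\<beta> V. (\<And>t. \<beta> t \<in> B_minus) \<Longrightarrow> has_velocity \<beta> V \<Longrightarrow>
     ((\<lambda>t. \<phi> (\<beta> t)) has_field_derivative L (\<beta> 0) V) (at 0)"
    using regular_function_derivative[OF \<phi>] by metis
  let ?P = "\<lambda>D. \<forall>\<beta> \<nu>. cell_curve \<beta> \<nu> \<and> \<beta> 0 ** \<nu> 0 = b \<and> has_velocity (\<lambda>t. \<beta> t ** \<nu> t) (b ** X) \<longrightarrow>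
     ((\<lambda>t. lift_fun \<phi> (\<beta> t ** \<nu> t)) has_field_derivative D) (at 0)"
  have "?P (L b (b ** lower_part X))"
  proof (intro allI impI, elim conjE)
    fix \<beta> \<nu>
    assume *: "cell_curve \<beta> \<nu>" "\<beta> 0 ** \<nu> 0 = b" "has_velocity (\<lambda>t. \<beta> t ** \<nu> t) (b ** X)"
    then have "\<beta> t \<in> B_minus" "\<nu> t \<in> N_plus" for t by (auto simp: cell_curve_def)
    moreover have "\<beta> 0 = b" "has_velocity \<beta> (b ** lower_part X)"
      using cell_curve_velocity[OF *(1) b *(2,3)] by blast+
    ultimately show "((\<lambda>t. lift_fun \<phi> (\<beta> t ** \<nu> t)) has_field_derivative L b (b ** lower_part X))
        (at 0)"
      using L[of \<beta> "b ** lower_part X"] by (simp add: lift_fun_mult)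
  qed
  moreover have "D = D'" if "?P D" "?P D'" for D D'
  proof -
    obtain \<beta> \<nu> where "cell_curve \<beta> \<nu>" "\<beta> 0 ** \<nu> 0 = b" "has_velocity (\<lambda>t. \<beta> t ** \<nu> t) (b ** X)"
      using cell_curve_exists[OF b X] by blast
    then show ?thesis using that DERIV_unique by blast
  qed
  ultimately have "cell_deriv \<phi> b (b ** X) = L b (b ** lower_part X)"
    unfolding cell_deriv_def by (intro the_equality) blast+
  then show ?thesis using L[OF \<beta>(1,3)] \<beta>(2) by simp
qed

lemma lower_curve_exists:
  assumes "b \<in> B_minus" "traceless X"
  obtains \<beta> where "\<And>t. \<beta> t \<in> B_minus" "\<beta> 0 = b" "has_velocity \<beta> (b ** lower_part X)"
proof -
  obtain \<beta> \<nu> where *: "cell_curve \<beta> \<nu>" "\<beta> 0 ** \<nu> 0 = b" "has_velocity (\<lambda>t. \<beta> t ** \<nu> t) (b ** X)"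
    using cell_curve_exists[OF assms] by blast
  show thesis
  proof (rule that)
    show "\<beta> t \<in> B_minus" for t using *(1) by (simp add: cell_curve_def)
  qed (rule cell_curve_velocity[OF *(1) assms(1) *(2,3)])+
qed

lemma cell_deriv_eqI:
  assumes "\<phi> \<in> regular_functions" "b \<in> B_minus" "traceless X"
    and "\<And>\<beta>. (\<And>t. \<beta> t \<in> B_minus) \<Longrightarrow> \<beta> 0 = b \<Longrightarrow> has_velocity \<beta> (b ** lower_part X) \<Longrightarrow>
      ((\<lambda>t. \<phi> (\<beta> t)) has_field_derivative D) (at 0)"
  shows "cell_deriv \<phi> b (b ** X) = D"
proof -
  obtain \<beta> where \<beta>: "\<And>t. \<beta> t \<in> B_minus" "\<beta> 0 = b" "has_velocity \<beta> (b ** lower_part X)"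
    using lower_curve_exists[OF assms(2,3)] by blast
  show ?thesis
    using DERIV_unique[OF cell_deriv_curve[OF assms(1-3) \<beta>] assms(4)[OF \<beta>]] .
qed

lemma cell_deriv_add:
  assumes "\<phi> \<in> regular_functions" "\<psi> \<in> regular_functions" "b \<in> B_minus" "traceless X"
  shows "cell_deriv (\<lambda>b\<in>B_minus. \<phi> b + \<psi> b) b (b ** X) =
    cell_deriv \<phi> b (b ** X) + cell_deriv \<psi> b (b ** X)"
  by (rule cell_deriv_eqI[OF regular_functions.add[OF assms(1,2)] assms(3,4)])
    (simp add: DERIV_add cell_deriv_curve assms)

lemma cell_deriv_mult:
  assumes "\<phi> \<in> regular_functions" "\<psi> \<in> regular_functions" "b \<in> B_minus" "traceless X"
  shows "cell_deriv (\<lambda>b\<in>B_minus. \<phi> b * \<psi> b) b (b ** X) =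
    \<phi> b * cell_deriv \<psi> b (b ** X) + cell_deriv \<phi> b (b ** X) * \<psi> b"
proof (rule cell_deriv_eqI[OF regular_functions.mult[OF assms(1,2)] assms(3,4)])
  fix \<beta> assume \<beta>: "\<And>t. \<beta> t \<in> B_minus" "\<beta> 0 = b" "has_velocity \<beta> (b ** lower_part X)"
  show "((\<lambda>t. (\<lambda>b\<in>B_minus. \<phi> b * \<psi> b) (\<beta> t)) has_field_derivative
      \<phi> b * cell_deriv \<psi> b (b ** X) + cell_deriv \<phi> b (b ** X) * \<psi> b) (at 0)"
    using DERIV_mult[OF cell_deriv_curve[OF assms(1,3,4) \<beta>] cell_deriv_curve[OF assms(2,3,4) \<beta>]]
    by (simp add: \<beta> add.commute mult.commute)
qed

lemma cell_deriv_const: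
  assumes "b \<in> B_minus" "traceless X"
  shows "cell_deriv (\<lambda>b\<in>B_minus. c) b (b ** X) = 0"
  by (rule cell_deriv_eqI[OF regular_functions.const assms]) simp

lemma cell_deriv_upper:
  assumes "\<phi> \<in> regular_functions" "b \<in> B_minus" "traceless X" "lower_part X = 0"
  shows "cell_deriv \<phi> b (b ** X) = 0"
proof -
  have "((\<lambda>t. \<phi> b) has_field_derivative cell_deriv \<phi> b (b ** X)) (at 0)"
    using cell_deriv_curve[OF assms(1-3), of "\<lambda>t. b"] assms by (simp add: has_velocity_const)
  then show ?thesis using DERIV_unique DERIV_const by blast
qed

definition series_velocity :: "(complex \<Rightarrow> complex fps) \<Rightarrow> complex fps \<Rightarrow> bool" where
  "series_velocity F G \<longleftrightarrow> (\<forall>n. ((\<lambda>t. fps_nth (F t) n) has_field_derivative fps_nth G n) (at 0))"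

lemma series_velocity_entry: "has_velocity \<beta> V \<Longrightarrow> series_velocity (\<lambda>t. entry (\<beta> t) i j)
    (entry V i j)"
  by (simp add: series_velocity_def entry_def has_velocity_def)

lemma series_velocity_mult:
  assumes "series_velocity F F'" "series_velocity G G'"
  shows "series_velocity (\<lambda>t. F t * G t) (F' * G 0 + F 0 * G')"
  unfolding series_velocity_def
proof
  fix n
  have "((\<lambda>t. \<Sum>i=0..n. fps_nth (F t) i * fps_nth (G t) (n - i)) has_field_derivative
      (\<Sum>i=0..n. fps_nth F' i * fps_nth (G 0) (n - i) + fps_nth G' (n - i) * fps_nth (F 0) i))
          (at 0)"
    using assms unfolding series_velocity_def by (intro DERIV_sum DERIV_mult) auto
  then show "((\<lambda>t. fps_nth (F t * G t) n) has_field_derivative fps_nth (F' * G 0 + F 0 * G') n)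
      (at 0)"
    by (simp add: fps_mult_nth sum.distrib mult.commute[of "fps_nth G' _"])
qed

lemma series_velocity_unique: "series_velocity F G \<Longrightarrow> series_velocity F H \<Longrightarrow> G = H"
  unfolding series_velocity_def by (intro fps_ext) (metis DERIV_unique)

text \<open>The product rule for \<open>Q t * F t = G t\<close> is solved for the velocity of
  \<open>Q\<close>, so only products are differentiated.\<close>

lemma series_velocity_quotient:
  assumes F: "series_velocity F F'" and G: "series_velocity G G'" and Q: "series_velocity Q Q'"
    and eq: "\<And>t. Q t * F t = G t" and F0: "fps_nth (F 0) 0 \<noteq> 0"
  shows "Q' = (G' * F 0 - G 0 * F') * (inverse (F 0))\<^sup>2"
proof -
  have "series_velocity G (Q' * F 0 + Q 0 * F')"
    using series_velocity_mult[OF Q F] by (simp only: eq)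
  then have "Q' * F 0 + Q 0 * F' = G'" using G by (rule series_velocity_unique)
  then have "Q' * F 0 * F 0 = G' * F 0 - (Q 0 * F 0) * F'"
    by (simp add: algebra_simps flip: \<open>Q' * F 0 + Q 0 * F' = G'\<close>)
  then have eq': "Q' * F 0 * F 0 = G' * F 0 - G 0 * F'" by (simp only: eq)
  have "Q' = Q' * (F 0 * inverse (F 0)) * (F 0 * inverse (F 0))"
    using F0 by (simp add: inverse_mult_eq_1')
  also have "\<dots> = (Q' * F 0 * F 0) * (inverse (F 0))\<^sup>2"
    by (simp only: power2_eq_square mult_ac)
  finally show ?thesis by (simp only: eq')
qed

lemma regular_series_velocity:
  assumes "\<And>n. regular (\<lambda>b. fps_nth (F b) n)" "\<And>t. \<beta> t \<in> B_minus" "has_velocity \<beta> V"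
  shows "\<exists>G. series_velocity (\<lambda>t. F (\<beta> t)) G"
proof -
  have "\<exists>D. ((\<lambda>t. fps_nth (F (\<beta> t)) n) has_field_derivative D) (at 0)" for n
  proof -
    obtain L where "\<And>\<beta> V. (\<And>t. \<beta> t \<in> B_minus) \<Longrightarrow> has_velocity \<beta> V \<Longrightarrow>
        ((\<lambda>t. restrict (\<lambda>b. fps_nth (F b) n) B_minus (\<beta> t)) has_field_derivative L (\<beta> 0) V) (at 0)"
      using regular_function_derivative[OF assms(1)[unfolded regular_def, of n]] by blast
    from this[OF assms(2,3)] show ?thesis using assms(2) by auto
  qed
  then obtain D where "\<And>n. ((\<lambda>t. fps_nth (F (\<beta> t)) n) has_field_derivative D n) (at 0)" by metis
  then have "series_velocity (\<lambda>t. F (\<beta> t)) (Abs_fps D)" by (simp add: series_velocity_def)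
  then show ?thesis by blast
qed

text \<open>Quotient rule for C/D and B/A. Here \<open>x\<close>, \<open>y\<close>, \<open>z\<close>
  are the entries of the lower part of \<open>X\<close>, whose lower right entry is
  \<open>- x\<close> by tracelessness.\<close>

lemma cell_deriv_coord:
  assumes b: "b = fps_mat A B C D" "b \<in> B_minus" and X: "traceless X"
  defines "x \<equiv> fls_regpart (X $ 1 $ 1)" and "y \<equiv> strict_part (X $ 1 $ 2)" and "z \<equiv> fls_regpart
      (X $ 2 $ 1)"
  shows "cell_deriv (u_coord p) b (b ** X) =
      (- 1) ^ p * fps_nth ((2 * C * D * x - C\<^sup>2 * y + D\<^sup>2 * z) * (inverse D)\<^sup>2) p"
    and "cell_deriv (m_coord p) b (b ** X) =
      - ((- 1) ^ p * fps_nth ((- (2 * A * B) * x + A\<^sup>2 * y - B\<^sup>2 * z) * (inverse A)\<^sup>2) (Suc p))"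
proof -
  obtain \<beta> where \<beta>: "\<And>t. \<beta> t \<in> B_minus" "\<beta> 0 = b" "has_velocity \<beta> (b ** lower_part X)"
    using lower_curve_exists[OF b(2) X] by blast
  have "fls_regpart (X $ 1 $ 1) + fls_regpart (X $ 2 $ 2) = 0"
    using X by (simp add: traceless_def flip: fls_regpart_plus)
  then have "lower_part X = fps_mat x y z (- x)"
    by (simp add: lower_part_def x_def y_def z_def eq_neg_iff_add_eq_0 add.commute)
  then have V: "b ** lower_part X = fps_mat (A * x + B * z) (A * y - B * x) (C * x + D * z) (C *
      y - D * x)"
    by (simp add: b(1) fps_mat_mult)
  have vel: "series_velocity (\<lambda>t. entry (\<beta> t) 1 1) (A * x + B * z)"
    "series_velocity (\<lambda>t. entry (\<beta> t) 1 2) (A * y - B * x)"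
    "series_velocity (\<lambda>t. entry (\<beta> t) 2 1) (C * x + D * z)"
    "series_velocity (\<lambda>t. entry (\<beta> t) 2 2) (C * y - D * x)"
    using series_velocity_entry[OF \<beta>(3)] unfolding V by (metis entry_fps_mat)+
  have nz: "fps_nth (entry (\<beta> t) 1 1) 0 \<noteq> 0" "fps_nth (entry (\<beta> t) 2 2) 0 \<noteq> 0" for t
    using B_minus_entry(3)[OF \<beta>(1)[of t]] by auto
  have quot: "u_ser (\<beta> t) * entry (\<beta> t) 2 2 = entry (\<beta> t) 2 1"
    "y_ser (\<beta> t) * entry (\<beta> t) 1 1 = entry (\<beta> t) 1 2" for t
    by (simp_all add: u_ser_def y_ser_def mult.assoc inverse_mult_eq_1 nz)
  obtain U where U: "series_velocity (\<lambda>t. u_ser (\<beta> t)) U"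
    using regular_series_velocity[OF regular_u_ser \<beta>(1,3)] by blast
  obtain Y where Y: "series_velocity (\<lambda>t. y_ser (\<beta> t)) Y"
    using regular_series_velocity[OF regular_y_ser \<beta>(1,3)] by blast
  have U_eq: "U = (2 * C * D * x - C\<^sup>2 * y + D\<^sup>2 * z) * (inverse D)\<^sup>2"
    using series_velocity_quotient[OF vel(4,3) U quot(1) nz(2)]
    by (simp add: \<beta>(2) b(1) algebra_simps power2_eq_square)
  have Y_eq: "Y = (- (2 * A * B) * x + A\<^sup>2 * y - B\<^sup>2 * z) * (inverse A)\<^sup>2"
    using series_velocity_quotient[OF vel(1,2) Y quot(2) nz(1)]
    by (simp add: \<beta>(2) b(1) algebra_simps power2_eq_square)
  have "((\<lambda>t. u_coord p (\<beta> t)) has_field_derivative (- 1) ^ p * fps_nth U p) (at 0)"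
    using U by (simp add: u_coord_eq[OF \<beta>(1)] series_velocity_def DERIV_cmult)
  then show "cell_deriv (u_coord p) b (b ** X) =
      (- 1) ^ p * fps_nth ((2 * C * D * x - C\<^sup>2 * y + D\<^sup>2 * z) * (inverse D)\<^sup>2) p"
    unfolding U_eq using cell_deriv_curve[OF regular_u_coord b(2) X \<beta>] DERIV_unique by blast
  have "((\<lambda>t. m_coord p (\<beta> t)) has_field_derivative - ((- 1) ^ p * fps_nth Y (Suc p))) (at 0)"
    unfolding m_coord_eq[OF \<beta>(1)] using Y by (intro DERIV_minus DERIV_cmult)
        (simp add: series_velocity_def)
  then show "cell_deriv (m_coord p) b (b ** X) =
      - ((- 1) ^ p * fps_nth ((- (2 * A * B) * x + A\<^sup>2 * y - B\<^sup>2 * z) * (inverse A)\<^sup>2) (Suc p))"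
    unfolding Y_eq using cell_deriv_curve[OF regular_m_coord b(2) X \<beta>] DERIV_unique by blast
qed

section \<open>Double series\<close>

text \<open>\<open>outer F\<close> and \<open>inner_ser F\<close> are F at \<lambda> and F at \<mu>;
  the outer power series variable is \<lambda>^-1 and the inner one \<mu>^-1.\<close>

definition outer :: "complex fps \<Rightarrow> complex fps fps" where
  "outer F = Abs_fps (\<lambda>i. fps_const (fps_nth F i))"

definition inner_ser :: "complex fps \<Rightarrow> complex fps fps" where
  "inner_ser F = fps_const F"

lemma series2_eqI: "(\<And>p r. fps_nth (fps_nth X p) r = fps_nth (fps_nth Y p) r) \<Longrightarrow> X = Y"
  by (intro fps_ext) blast

lemma outer_nth [simp]: "fps_nth (outer F) i = fps_const (fps_nth F i)"
  by (simp add: outer_def)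

lemma outer_simps:
  "outer (F + G) = outer F + outer G" "outer (F - G) = outer F - outer G" "outer (- F) = - outer F"
  "outer 0 = 0" "outer 1 = 1" "outer (F * G) = outer F * outer G"
proof -
  show "outer (F * G) = outer F * outer G"
  proof (rule series2_eqI)
    fix p r
    show "fps_nth (fps_nth (outer (F * G)) p) r = fps_nth (fps_nth (outer F * outer G) p) r"
      by (cases r) (simp_all add: fps_mult_nth[of F] fps_mult_nth[of "outer F"] fps_sum_nth)
  qed
qed (auto intro!: fps_ext simp: fps_one_nth)

lemma inner_simps:
  "inner_ser (F + G) = inner_ser F + inner_ser G" "inner_ser (F - G) = inner_ser F - inner_ser G"
  "inner_ser (- F) = - inner_ser F" "inner_ser 0 = 0" "inner_ser 1 = 1"
  "inner_ser (F * G) = inner_ser F * inner_ser G"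
  by (simp_all add: inner_ser_def)

lemma outer_2: "outer 2 = 2" and inner_2: "inner_ser 2 = 2"
  using outer_simps(1)[of 1 1] inner_simps(1)[of 1 1] by (simp_all add: outer_simps inner_simps)

lemma outer_power: "outer (F ^ n) = outer F ^ n"
  by (induction n) (simp_all add: outer_simps)

lemma inner_power: "inner_ser (F ^ n) = inner_ser F ^ n"
  by (induction n) (simp_all add: inner_simps)

lemma outer_mult_inner_nth:
  "fps_nth (fps_nth (outer F * inner_ser G) p) r = fps_nth F p * fps_nth G r"
  by (simp add: inner_ser_def)

definition outer_var :: "complex fps fps" where "outer_var = fps_X"
definition inner_var :: "complex fps fps" where "inner_var = fps_const fps_X"

lemma outer_var_mult_nth:
  "fps_nth (fps_nth (outer_var * X) p) r = (if p = 0 then 0 else fps_nth (fps_nth X (p - 1)) r)"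
  by (simp add: outer_var_def)

lemma inner_var_mult_nth:
  "fps_nth (fps_nth (inner_var * X) p) r = (if r = 0 then 0 else fps_nth (fps_nth X p) (r - 1))"
  by (simp add: inner_var_def)

lemma outer_var_neq_inner_var: "outer_var - inner_var \<noteq> 0"
proof
  assume "outer_var - inner_var = 0"
  then have "fps_nth (fps_nth (outer_var - inner_var) 1) 0 = 0" by simp
  then show False by (simp add: outer_var_def inner_var_def)
qed

text \<open>The vanishing cases concern series of degree at most 1 in one of the variables. They
  remove the unmixed terms when coefficients of the bracket identities are read off.\<close>

lemma product_nth:
  "fps_nth (fps_nth (outer_var * outer F * outer G) (Suc p)) (Suc r) = 0"
  "fps_nth (fps_nth (inner_var * inner_ser F * inner_ser G) (Suc p)) (Suc r) = 0"
  "fps_nth (fps_nth (outer_var * inner_ser F * inner_ser G) (Suc (Suc p))) r = 0"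
  "fps_nth (fps_nth (inner_var * outer F * outer G) p) (Suc (Suc r)) = 0"
  "fps_nth (fps_nth (2 * outer_var * outer F * inner_ser G) (Suc p)) r = 2 * fps_nth F p *
      fps_nth G r"
  "fps_nth (fps_nth (2 * inner_var * outer F * inner_ser G) p) (Suc r) = 2 * fps_nth F p *
      fps_nth G r"
proof -
  have double: "2 * v * X * Y = v * (X * Y) + v * (X * Y)" for v X Y :: "complex fps fps"
    by (simp only: mult_2 mult.assoc distrib_right)
  show "fps_nth (fps_nth (2 * outer_var * outer F * inner_ser G) (Suc p)) r = 2 * fps_nth F p *
      fps_nth G r"
    "fps_nth (fps_nth (2 * inner_var * outer F * inner_ser G) p) (Suc r) = 2 * fps_nth F p *
        fps_nth G r"
    unfolding double fps_add_nth outer_var_mult_nth inner_var_mult_nth outer_mult_inner_nth by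
        simp_all
  show "fps_nth (fps_nth (outer_var * outer F * outer G) (Suc p)) (Suc r) = 0"
    "fps_nth (fps_nth (inner_var * outer F * outer G) p) (Suc (Suc r)) = 0"
    unfolding mult.assoc outer_simps(6)[symmetric] outer_var_mult_nth inner_var_mult_nth by simp_all
  show "fps_nth (fps_nth (inner_var * inner_ser F * inner_ser G) (Suc p)) (Suc r) = 0"
    "fps_nth (fps_nth (outer_var * inner_ser F * inner_ser G) (Suc (Suc p))) r = 0"
    unfolding mult.assoc inner_simps(6)[symmetric] outer_var_mult_nth inner_var_mult_nth
    by (simp_all add: inner_ser_def)
qed

text \<open>
  The truncation \<open>(\<lambda>\<^sup>k F)\<^sub>\<le>\<^sub>0\<close>, or \<open>(\<lambda>\<^sup>k F)\<^sub><\<^sub>0\<close> if the flag is set, as a series in \<open>\<lambda>\<^sup>-\<^sup>1\<close>.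
\<close>

definition trunc :: "bool \<Rightarrow> int \<Rightarrow> complex fps \<Rightarrow> complex fps" where
  "trunc s k F = (if s then strict_part (lam_pow k * fps_to_fls F)
     else fls_regpart (lam_pow k * fps_to_fls F))"

lemma trunc_nth:
  "fps_nth (trunc s k F) p = (if s \<and> p = 0 \<or> int p + k < 0 then 0 else fps_nth F (nat (int p + k)))"
  unfolding trunc_def strict_part_def
  by (auto simp: lam_pow_mult_nth[simplified])

text \<open>Without flags this is the divided difference of the series \<lambda>^-1 F(\<lambda>). A
  flag removes the terms of degree 0 in its variable, as a strict truncation does.\<close>

definition hankel :: "bool \<Rightarrow> bool \<Rightarrow> complex fps \<Rightarrow> complex fps fps" where
  "hankel s s' F = Abs_fps (\<lambda>p. Abs_fps (\<lambda>r. if s \<and> p = 0 \<or> s' \<and> r = 0 then 0 else fps_nth F (p +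
      r)))"

lemma hankel_nth:
  "fps_nth (fps_nth (hankel s s' F) p) r = (if s \<and> p = 0 \<or> s' \<and> r = 0 then 0 else fps_nth F (p +
      r))"
  by (simp add: hankel_def)

lemma hankel_mult_diff:
  "(outer_var - inner_var) * hankel False False F = outer_var * outer F - inner_var * inner_ser F"
proof (rule series2_eqI)
  fix p r
  show "fps_nth (fps_nth ((outer_var - inner_var) * hankel False False F) p) r =
      fps_nth (fps_nth (outer_var * outer F - inner_var * inner_ser F) p) r"
    unfolding left_diff_distrib fps_sub_nth outer_var_mult_nth inner_var_mult_nth
    by (cases p; cases r) (auto simp: hankel_nth inner_ser_def)
qed

text \<open>With both flags the corner coefficient would be subtracted twice, hence the condition
  that it is 0.\<close>

lemma hankel_flags:
  "hankel True False F = hankel False False F - inner_ser F"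
  "hankel False True F = hankel False False F - outer F"
  "fps_nth F 0 = 0 \<Longrightarrow> hankel True True F = hankel False False F - outer F - inner_ser F"
  by (rule series2_eqI; auto simp: hankel_nth inner_ser_def)+

lemma hankel_mult_diff_flags:
  "(outer_var - inner_var) * hankel True False F = outer_var * (outer F - inner_ser F)"
  "(outer_var - inner_var) * hankel False True F = inner_var * (outer F - inner_ser F)"
  "fps_nth F 0 = 0 \<Longrightarrow>
    (outer_var - inner_var) * hankel True True F = inner_var * outer F - outer_var * inner_ser F"
  unfolding hankel_flags
  using hankel_mult_diff[of F] by (simp_all add: hankel_flags algebra_simps)

text \<open>A sum cut off at \<open>n\<close> has the correct coefficients only up to degree
  \<open>n\<close> in each variable. Such agreement is stable under ring operations and for all
  \<open>n\<close> amounts to equality.\<close>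

definition agree :: "nat \<Rightarrow> complex fps fps \<Rightarrow> complex fps fps \<Rightarrow> bool" where
  "agree n X Y \<longleftrightarrow> (\<forall>p\<le>n. \<forall>r\<le>n. fps_nth (fps_nth X p) r = fps_nth (fps_nth Y p) r)"

lemma agree_add: "agree n X Y \<Longrightarrow> agree n X' Y' \<Longrightarrow> agree n (X + X') (Y + Y')"
  and agree_diff: "agree n X Y \<Longrightarrow> agree n X' Y' \<Longrightarrow> agree n (X - X') (Y - Y')"
  by (simp_all add: agree_def)

lemma agree_mult: "agree n X Y \<Longrightarrow> agree n (Z * X) (Z * Y)"
  by (simp add: agree_def fps_mult_nth fps_sum_nth)

lemma agree_all: "(\<And>n. agree n X Y) \<Longrightarrow> X = Y"
  by (rule series2_eqI) (meson agree_def max.cobounded1 max.cobounded2)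

definition pairing :: "nat \<Rightarrow> (int \<Rightarrow> complex fps) \<Rightarrow> (int \<Rightarrow> complex fps) \<Rightarrow> complex fps fps" where
  "pairing n e f = (\<Sum>k\<in>{- int n..int n}. outer (e k) * inner_ser (f (- k)))"

lemma pairing_nth:
  "fps_nth (fps_nth (pairing n e f) p) r = (\<Sum>k\<in>{- int n..int n}. fps_nth (e k) p * fps_nth (f
      (- k)) r)"
  by (simp add: pairing_def fps_sum_nth outer_mult_inner_nth)

lemma pairing_linear:
  "pairing n (\<lambda>k. e k + e' k) f = pairing n e f + pairing n e' f"
  "pairing n (\<lambda>k. e k - e' k) f = pairing n e f - pairing n e' f"
  "pairing n (\<lambda>k. F * e k) f = outer F * pairing n e f"
  "pairing n e (\<lambda>k. f k + f' k) = pairing n e f + pairing n e f'"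
  "pairing n e (\<lambda>k. f k - f' k) = pairing n e f - pairing n e f'"
  "pairing n e (\<lambda>k. F * f k) = inner_ser F * pairing n e f"
  by (simp_all add: pairing_def outer_simps inner_simps distrib_left distrib_right
      right_diff_distrib
      left_diff_distrib sum.distrib sum_subtractf sum_distrib_left mult_ac)

text \<open>Summing the truncations over \<open>k\<close> turns the pairing into a convolution.\<close>

lemma agree_pairing_trunc:
  "agree n (pairing n (\<lambda>k. trunc s k F) (\<lambda>k. trunc s' k G)) (hankel s s' (F * G))"
  unfolding agree_def
proof (intro allI impI)
  fix p r assume pr: "p \<le> n" "r \<le> n"
  show "fps_nth (fps_nth (pairing n (\<lambda>k. trunc s k F) (\<lambda>k. trunc s' k G)) p) r =
      fps_nth (fps_nth (hankel s s' (F * G)) p) r"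
  proof (cases "s \<and> p = 0 \<or> s' \<and> r = 0")
    case True
    then show ?thesis by (auto simp: pairing_nth trunc_nth hankel_nth intro!: sum.neutral)
  next
    case False
    have "fps_nth (fps_nth (pairing n (\<lambda>k. trunc s k F) (\<lambda>k. trunc s' k G)) p) r =
        (\<Sum>k\<in>{- int n..int n}. fps_nth (trunc s k F) p * fps_nth (trunc s' (- k) G) r)"
      by (rule pairing_nth)
    \<comment> \<open>The factors are coefficients of \<open>F\<close> at \<open>p + k\<close> and
      of \<open>G\<close> at \<open>r - k\<close>; both indices are nonnegative only in this
      range.\<close>
    also have "\<dots> = (\<Sum>k\<in>{- int p..int r}. fps_nth (trunc s k F) p * fps_nth (trunc s' (- k) G) r)"
      using pr by (intro sum.mono_neutral_right) (auto simp: trunc_nth)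
    also have "\<dots> = (\<Sum>i=0..p + r. fps_nth F i * fps_nth G (p + r - i))"
      using False
      by (intro sum.reindex_bij_witness[of _ "\<lambda>i. int i - int p" "\<lambda>k. nat (k + int p)"])
        (auto simp: trunc_nth nat_diff_distrib' intro!: arg_cong2[where f =
            "(*)"] arg_cong2[where f = fps_nth])
    finally show ?thesis using False by (auto simp: hankel_nth fps_mult_nth)
  qed
qed

text \<open>For \<open>supported\<close> families the coefficient at \<open>(p, r)\<close> no longer
  changes once the cutoff reaches \<open>max p r\<close>.\<close>

definition pairing_series :: "(int \<Rightarrow> complex fps) \<Rightarrow> (int \<Rightarrow> complex fps) \<Rightarrow> complex fps fps" where
  "pairing_series e f = Abs_fps (\<lambda>p. Abs_fps (\<lambda>r. fps_nth (fps_nth (pairing (max p r) e f) p) r))"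

definition supported :: "(int \<Rightarrow> complex fps) \<Rightarrow> bool" where
  "supported e \<longleftrightarrow> (\<forall>k p. k < - int p \<longrightarrow> fps_nth (e k) p = 0)"

lemma agree_pairing_series:
  assumes "supported e" "supported f"
  shows "agree n (pairing_series e f) (pairing n e f)"
  unfolding agree_def pairing_series_def fps_nth_Abs_fps pairing_nth
proof (intro allI impI sum.mono_neutral_left)
  fix p r assume "p \<le> n" "r \<le> n"
  then show "{- int (max p r)..int (max p r)} \<subseteq> {- int n..int n}" by auto
  show "\<forall>k\<in>{- int n..int n} - {- int (max p r)..int (max p r)}. fps_nth (e k) p * fps_nth (f
      (- k)) r = 0"
    using assms by (auto simp: supported_def not_le)
qed simp

lemma supported_trunc: "supported (\<lambda>k. trunc s k F)"
  by (auto simp: supported_def trunc_nth)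

lemma supported_linear:
  "supported e \<Longrightarrow> supported f \<Longrightarrow> supported (\<lambda>k. e k + f k)"
  "supported e \<Longrightarrow> supported f \<Longrightarrow> supported (\<lambda>k. e k - f k)"
  by (auto simp: supported_def)

lemma supported_mult:
  assumes "supported e"
  shows "supported (\<lambda>k. F * e k)"
  unfolding supported_def fps_mult_nth
proof (intro allI impI sum.neutral ballI)
  fix k p i assume "k < - int p" "i \<in> {0..p}"
  then have "k < - int (p - i)" by auto
  then show "fps_nth F i * fps_nth (e k) (p - i) = 0" using assms by (simp add: supported_def)
qed

locale cell_point =
  fixes A B C D :: "complex fps"
  assumes det: "A * D - B * C = 1" and B0: "fps_nth B 0 = 0"
begin

text \<open>
  The variations of \<open>u\<close> and \<open>y\<close> along the left translates of \<open>e \<lambda>\<^sup>k\<close> and \<open>f \<lambda>\<^sup>k\<close> have this form; the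
  coefficients \<open>a\<close>, \<open>b\<close>, \<open>c\<close> and the factor \<open>N\<close> are those in \<open>cell_deriv_coord\<close>.
\<close>

definition E_series :: "complex fps \<Rightarrow> complex fps \<Rightarrow> complex fps \<Rightarrow> complex fps \<Rightarrow> int \<Rightarrow> complex
    fps" where
  "E_series a b c N k = N * (a * trunc False k (C * D) + b * trunc True k (D * D) - c *
      trunc False k (C * C))"

definition F_series :: "complex fps \<Rightarrow> complex fps \<Rightarrow> complex fps \<Rightarrow> complex fps \<Rightarrow> int \<Rightarrow> complex
    fps" where
  "F_series a b c N k = N * (c * trunc False k (A * A) - a * trunc False k (A * B) - b *
      trunc True k (B * B))"

lemma supported_E_series: "supported (E_series a b c N)"
  and supported_F_series: "supported (F_series a b c N)"
  unfolding E_series_def F_series_def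
  by (intro supported_mult supported_linear supported_trunc)+

text \<open>The pairing of the truncations is a combination of nine divided differences.
  Multiplication by \<lambda>^-1 - \<mu>^-1 separates each into a part at \<lambda> and a part at
  \<mu>, and the flags decide which variable stands in front.\<close>

lemma pairing_series_formula:
  "(outer_var - inner_var) * pairing_series (E_series a b c N) (F_series a' b' c' N') =
    outer N * inner_ser N' *
     ((outer a * outer C * outer D + outer b * outer D * outer D - outer c * outer C * outer C) *
      (outer_var * inner_ser c' * outer A * outer A - outer_var * inner_ser a' * outer A * outer B
        - inner_var * inner_ser b' * outer B * outer B) -
      (inner_var * outer a * inner_ser C * inner_ser D + outer_var * outer b * inner_ser D *
          inner_ser D
        - inner_var * outer c * inner_ser C * inner_ser C) *
      (inner_ser c' * inner_ser A * inner_ser A - inner_ser a' * inner_ser A * inner_ser B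
        - inner_ser b' * inner_ser B * inner_ser B))"
proof -
  let ?h = "\<lambda>s s' F G. hankel s s' (F * G)"
  let ?H = "outer N * (inner_ser N' *
     (outer a * (inner_ser c' * ?h False False (C * D) (A * A) - inner_ser a' * ?h False False
         (C * D) (A * B)
         - inner_ser b' * ?h False True (C * D) (B * B))
      + outer b * (inner_ser c' * ?h True False (D * D) (A * A) - inner_ser a' * ?h True False
          (D * D) (A * B)
         - inner_ser b' * ?h True True (D * D) (B * B))
      - outer c * (inner_ser c' * ?h False False (C * C) (A * A) - inner_ser a' * ?h False False
          (C * C) (A * B)
         - inner_ser b' * ?h False True (C * C) (B * B))))"
  have "agree n (pairing n (E_series a b c N) (F_series a' b' c' N')) ?H" for n
  proof -
    let ?p = "\<lambda>s s' F G. pairing n (\<lambda>k. trunc s k F) (\<lambda>k. trunc s' k G)"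
    have "pairing n (E_series a b c N) (F_series a' b' c' N') = outer N * (inner_ser N' *
     (outer a * (inner_ser c' * ?p False False (C * D) (A * A) - inner_ser a' * ?p False False
         (C * D) (A * B)
         - inner_ser b' * ?p False True (C * D) (B * B))
      + outer b * (inner_ser c' * ?p True False (D * D) (A * A) - inner_ser a' * ?p True False
          (D * D) (A * B)
         - inner_ser b' * ?p True True (D * D) (B * B))
      - outer c * (inner_ser c' * ?p False False (C * C) (A * A) - inner_ser a' * ?p False False
          (C * C) (A * B)
         - inner_ser b' * ?p False True (C * C) (B * B))))"
      unfolding E_series_def[abs_def] F_series_def[abs_def] pairing_linear
      by (simp only: algebra_simps)
    then show ?thesis
      by (simp only:) (intro agree_mult agree_add agree_diff agree_pairing_trunc)
  qed
  moreover have "agree n (pairing_series (E_series a b c N) (F_series a' b' c' N'))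
      (pairing n (E_series a b c N) (F_series a' b' c' N'))" for n
    by (rule agree_pairing_series[OF supported_E_series supported_F_series])
  ultimately have "agree n (pairing_series (E_series a b c N) (F_series a' b' c' N')) ?H" for n
    unfolding agree_def by simp
  then have S: "pairing_series (E_series a b c N) (F_series a' b' c' N') = ?H"
    by (rule agree_all)
  \<comment> \<open>The condition for the divided difference with both flags.\<close>
  have B: "fps_nth (D * D * (B * B)) 0 = 0" by (simp add: B0)
  let ?d = "outer_var - inner_var"
  have "?d * ?H = outer N * (inner_ser N' *
     (outer a * (inner_ser c' * (?d * ?h False False (C * D) (A * A)) - inner_ser a' * (?d *
         ?h False False (C * D) (A * B))
         - inner_ser b' * (?d * ?h False True (C * D) (B * B)))
      + outer b * (inner_ser c' * (?d * ?h True False (D * D) (A * A)) - inner_ser a' * (?d *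
          ?h True False (D * D) (A * B))
         - inner_ser b' * (?d * ?h True True (D * D) (B * B)))
      - outer c * (inner_ser c' * (?d * ?h False False (C * C) (A * A)) - inner_ser a' * (?d *
          ?h False False (C * C) (A * B))
         - inner_ser b' * (?d * ?h False True (C * C) (B * B)))))"
    by (simp only: distrib_left right_diff_distrib mult.left_commute[of ?d])
  then show ?thesis
    unfolding S hankel_mult_diff hankel_mult_diff_flags(1,2) hankel_mult_diff_flags(3)[OF B]
      outer_simps inner_simps
    by (simp add: algebra_simps)
qed

lemma nonzero_at_0: "fps_nth A 0 \<noteq> 0" "fps_nth D 0 \<noteq> 0"
  using arg_cong[OF det, of "\<lambda>f. fps_nth f 0"] B0 by auto

lemma inverse_A: "A * inverse A = 1" and inverse_D: "D * inverse D = 1"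
  using nonzero_at_0 by (simp_all add: inverse_mult_eq_1')

abbreviation "Eu \<equiv> E_series (2 * C * D) (- C\<^sup>2) (D\<^sup>2) ((inverse D)\<^sup>2)"
abbreviation "Fu \<equiv> F_series (2 * C * D) (- C\<^sup>2) (D\<^sup>2) ((inverse D)\<^sup>2)"
abbreviation "Ey \<equiv> E_series (- (2 * A * B)) (A\<^sup>2) (- B\<^sup>2) ((inverse A)\<^sup>2)"
abbreviation "Fy \<equiv> F_series (- (2 * A * B)) (A\<^sup>2) (- B\<^sup>2) ((inverse A)\<^sup>2)"
abbreviation "u_pt \<equiv> C * inverse D"
abbreviation "y_pt \<equiv> B * inverse A"

lemma outer_det: "outer A * outer D - outer B * outer C = 1"
  and inner_det: "inner_ser A * inner_ser D - inner_ser B * inner_ser C = 1"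
  by (simp_all add: det outer_simps(5) inner_simps(5) flip: outer_simps(2,6) inner_simps(2,6))

lemma outer_inverse: "outer A * outer (inverse A) = 1" "outer D * outer (inverse D) = 1"
  and inner_inverse: "inner_ser A * inner_ser (inverse A) = 1" "inner_ser D * inner_ser
      (inverse D) = 1"
  by (simp_all add: inverse_A inverse_D outer_simps(5) inner_simps(5) flip: outer_simps(6)
      inner_simps(6))

text \<open>For the coefficients of u the form evaluated at \<lambda> vanishes identically, and the
  form at \<mu> is the square of the determinant, hence 1. Only mixed products remain, and the
  inverses turn them into products of \<open>u_pt\<close>.\<close>

lemma pairing_uu:
  "(outer_var - inner_var) * pairing_series Eu Fu =
    outer_var * outer u_pt * outer u_pt + inner_var * inner_ser u_pt * inner_ser u_pt - 2 *
        inner_var * outer u_pt * inner_ser u_pt"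
proof -
  \<comment> \<open>A ring identity for the substitution below: plain letters are entries at
    \<lambda>, primed ones at \<mu>, \<open>i\<close> and \<open>i'\<close> the inverses of
    \<open>d\<close> and \<open>d'\<close>, \<open>t\<close> and \<open>s\<close> the outer and
    inner variable, and \<open>z\<close> the expression multiplied by 0.\<close>
  have *: "i\<^sup>2 * i'\<^sup>2 * ((2 * c * d * c * d + - c\<^sup>2 * d * d - d\<^sup>2 * c * c) * z -
      (s * (2 * c * d) * c' * d' + t * (- c\<^sup>2) * d' * d' - s * d\<^sup>2 * c' * c') *
      (d'\<^sup>2 * a' * a' - 2 * c' * d' * a' * b' - (- c'\<^sup>2) * b' * b')) =
    t * (c * i) * (c * i) + s * (c' * i') * (c' * i') - 2 * s * (c * i) * (c' * i')"
    if "d * i = 1" "d' * i' = 1" "a' * d' - b' * c' = 1"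
    for a' b' c d c' d' i i' s t z :: "complex fps fps"
  proof -
    have "(d'\<^sup>2 * a' * a' - 2 * c' * d' * a' * b' - (- c'\<^sup>2) * b' * b') = (a' * d' - b' * c')\<^sup>2"
      by (simp add: power2_eq_square algebra_simps)
    then have 1: "(d'\<^sup>2 * a' * a' - 2 * c' * d' * a' * b' - (- c'\<^sup>2) * b' * b') = 1"
      by (simp add: that)
    have 2: "2 * c * d * c * d + - c\<^sup>2 * d * d - d\<^sup>2 * c * c = 0"
      by (simp add: power2_eq_square algebra_simps)
    have "i\<^sup>2 * i'\<^sup>2 * (0 * z - (s * (2 * c * d) * c' * d' + t * (- c\<^sup>2) * d' * d' - s * d\<^sup>2 * c' *
        c') * 1) =
      t * (c * i) * (c * i) * (d' * i')\<^sup>2 + s * (c' * i') * (c' * i') * (d * i)\<^sup>2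
        - 2 * s * (c * i) * (c' * i') * (d * i) * (d' * i')"
      by (simp add: power2_eq_square algebra_simps)
    then show ?thesis unfolding 1 2 by (simp add: that)
  qed
  show ?thesis
    unfolding pairing_series_formula outer_simps inner_simps outer_2 inner_2 outer_power inner_power
    by (rule *[OF outer_inverse(2) inner_inverse(2) inner_det])
qed

text \<open>Both products contain a vanishing form, the first at \<lambda> because of u and the
  second at \<mu> because of y.\<close>

lemma pairing_uy: "(outer_var - inner_var) * pairing_series Eu Fy = 0"
proof -
  have "2 * c * d * c * d + - c\<^sup>2 * d * d - d\<^sup>2 * c * c = 0"
    "(- b'\<^sup>2 * a' * a' - - (2 * a' * b') * a' * b' - a'\<^sup>2 * b' * b') = 0"
    for a' b' c d :: "complex fps fps"
    by (simp_all add: power2_eq_square algebra_simps)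
  then show ?thesis
    unfolding pairing_series_formula outer_simps inner_simps outer_2 inner_2 outer_power inner_power
    by simp
qed

text \<open>Both forms are squares of determinants and equal 1. In the difference of the remaining
  factors the pure squares cancel, and the cross terms contain the factor \<lambda>^-1 -
  \<mu>^-1.\<close>

lemma pairing_yu:
  "(outer_var - inner_var) * pairing_series Ey Fu = (outer_var - inner_var) * (- 2 * outer y_pt *
      inner_ser u_pt)"
proof -
  have *: "i\<^sup>2 * i'\<^sup>2 * ((- (2 * a * b) * c * d + a\<^sup>2 * d * d - - b\<^sup>2 * c * c) *
      (t * d'\<^sup>2 * a * a - t * (2 * c' * d') * a * b - s * (- c'\<^sup>2) * b * b) -
      (s * (- (2 * a * b)) * c' * d' + t * a\<^sup>2 * d' * d' - s * (- b\<^sup>2) * c' * c') *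
      (d'\<^sup>2 * a' * a' - 2 * c' * d' * a' * b' - (- c'\<^sup>2) * b' * b')) =
    (t - s) * (- 2 * (b * i) * (c' * i'))"
    if "a * i = 1" "d' * i' = 1" "a * d - b * c = 1" "a' * d' - b' * c' = 1"
    for a b c d a' b' c' d' i i' s t :: "complex fps fps"
  proof -
    have "(d'\<^sup>2 * a' * a' - 2 * c' * d' * a' * b' - (- c'\<^sup>2) * b' * b') = (a' * d' - b' * c')\<^sup>2"
      "(- (2 * a * b) * c * d + a\<^sup>2 * d * d - - b\<^sup>2 * c * c) = (a * d - b * c)\<^sup>2"
      by (simp_all add: power2_eq_square algebra_simps)
    then have 1: "(d'\<^sup>2 * a' * a' - 2 * c' * d' * a' * b' - (- c'\<^sup>2) * b' * b') = 1"
      "(- (2 * a * b) * c * d + a\<^sup>2 * d * d - - b\<^sup>2 * c * c) = 1"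
      by (simp_all add: that)
    have "i\<^sup>2 * i'\<^sup>2 * (1 *
      (t * d'\<^sup>2 * a * a - t * (2 * c' * d') * a * b - s * (- c'\<^sup>2) * b * b) -
      (s * (- (2 * a * b)) * c' * d' + t * a\<^sup>2 * d' * d' - s * (- b\<^sup>2) * c' * c') * 1) =
      (t - s) * (- 2 * (b * i) * (c' * i')) * (a * i) * (d' * i')"
      by (simp add: power2_eq_square algebra_simps)
    then show ?thesis unfolding 1 by (simp add: that)
  qed
  show ?thesis
    unfolding pairing_series_formula outer_simps inner_simps outer_2 inner_2 outer_power inner_power
    by (rule *[OF outer_inverse(1) inner_inverse(2) outer_det inner_det])
qed

lemma pairing_yy:
  "(outer_var - inner_var) * pairing_series Ey Fy =
    2 * outer_var * outer y_pt * inner_ser y_pt - inner_var * outer y_pt * outer y_pt -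
        outer_var * inner_ser y_pt * inner_ser y_pt"
proof -
  have *: "i\<^sup>2 * i'\<^sup>2 * ((- (2 * a * b) * c * d + a\<^sup>2 * d * d - - b\<^sup>2 * c * c) *
      (t * (- b'\<^sup>2) * a * a - t * (- (2 * a' * b')) * a * b - s * a'\<^sup>2 * b * b) -
      z * (- b'\<^sup>2 * a' * a' - - (2 * a' * b') * a' * b' - a'\<^sup>2 * b' * b')) =
    2 * t * (b * i) * (b' * i') - s * (b * i) * (b * i) - t * (b' * i') * (b' * i')"
    if "a * i = 1" "a' * i' = 1" "a * d - b * c = 1"
    for a b c d a' b' i i' s t z :: "complex fps fps"
  proof -
    have "(- (2 * a * b) * c * d + a\<^sup>2 * d * d - - b\<^sup>2 * c * c) = (a * d - b * c)\<^sup>2"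
      by (simp_all add: power2_eq_square algebra_simps)
    then have 1: "(- (2 * a * b) * c * d + a\<^sup>2 * d * d - - b\<^sup>2 * c * c) = 1"
      by (simp_all add: that)
    have 2: "(- b'\<^sup>2 * a' * a' - - (2 * a' * b') * a' * b' - a'\<^sup>2 * b' * b') = 0"
      by (simp add: power2_eq_square algebra_simps)
    have "i\<^sup>2 * i'\<^sup>2 * (1 *
      (t * (- b'\<^sup>2) * a * a - t * (- (2 * a' * b')) * a * b - s * a'\<^sup>2 * b * b) - z * 0) =
      2 * t * (b * i) * (b' * i') * (a * i) * (a' * i') - s * (b * i) * (b * i) * (a' * i')\<^sup>2
        - t * (b' * i') * (b' * i') * (a * i)\<^sup>2"
      by (simp add: power2_eq_square algebra_simps)
    then show ?thesis unfolding 1 2 by (simp add: that)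
  qed
  show ?thesis
    unfolding pairing_series_formula outer_simps inner_simps outer_2 inner_2 outer_power inner_power
    by (rule *[OF outer_inverse(1) inner_inverse(1) outer_det])
qed

definition S :: "(int \<Rightarrow> complex fps) \<Rightarrow> (int \<Rightarrow> complex fps) \<Rightarrow> nat \<Rightarrow> nat \<Rightarrow> complex" where
  "S e f p r = fps_nth (fps_nth (pairing_series e f) p) r"

text \<open>Multiplication by \<lambda>^-1 - \<mu>^-1 becomes a difference along an antidiagonal,
  the shape of the recursion in \<open>D_quadratic\<close>.\<close>

lemma S_mult_diff:
  "fps_nth (fps_nth ((outer_var - inner_var) * pairing_series e f) (Suc p)) (Suc r) =
     S e f p (Suc r) - S e f (Suc p) r"
  by (simp add: left_diff_distrib outer_var_mult_nth inner_var_mult_nth S_def)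

lemma S_uu: "S Eu Fu p (Suc r) - S Eu Fu (Suc p) r = - (2 * fps_nth u_pt (Suc p) * fps_nth u_pt r)"
  unfolding S_mult_diff[symmetric] pairing_uu fps_add_nth fps_sub_nth product_nth by simp

text \<open>The indices start one higher than for u because m_i is, up to sign, the coefficient of y
  at i + 1; at these degrees the unmixed terms are absent.\<close>

lemma S_yy:
  "S Ey Fy (Suc p) (Suc (Suc r)) - S Ey Fy (Suc (Suc p)) (Suc r) =
     2 * fps_nth y_pt (Suc p) * fps_nth y_pt (Suc (Suc r))"
  unfolding S_mult_diff[symmetric] pairing_yy fps_add_nth fps_sub_nth product_nth by simp

lemma S_uy: "S Eu Fy p r = 0"
  using pairing_uy outer_var_neq_inner_var by (simp add: S_def)

lemma S_yu: "S Ey Fu p r = - 2 * fps_nth y_pt p * fps_nth u_pt r"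
proof -
  have "pairing_series Ey Fu = - 2 * outer y_pt * inner_ser u_pt"
    using pairing_yu mult_left_cancel[OF outer_var_neq_inner_var] by blast
  also have "\<dots> = outer (- (2 * y_pt)) * inner_ser u_pt"
    by (simp add: outer_simps outer_2)
  finally show ?thesis by (simp add: S_def outer_mult_inner_nth numeral_fps_const)
qed

end

section \<open>The Poisson bracket\<close>

definition eval_fun :: "qfun \<Rightarrow> loop_mat \<Rightarrow> complex" where
  "eval_fun x = (\<lambda>b\<in>B_minus. qeval (\<lambda>g. coord g b) x)"

lemma eval_fun_add: "eval_fun (x + y) = (\<lambda>b\<in>B_minus. eval_fun x b + eval_fun y b)"
  and eval_fun_mult: "eval_fun (x * y) = (\<lambda>b\<in>B_minus. eval_fun x b * eval_fun y b)"
  and eval_fun_scale: "eval_fun (qscale c x) = (\<lambda>b\<in>B_minus. (\<lambda>b\<in>B_minus. at_one c) b *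
      eval_fun x b)"
  and eval_fun_1: "eval_fun 1 = (\<lambda>b\<in>B_minus. 1)"
  by (auto simp: eval_fun_def qeval_add qeval_mult qeval_scale)

lemma eval_fun_gen: "eval_fun (q_gen g) = coord g"
  by (cases g) (auto simp: eval_fun_def u_coord_def m_coord_def)

lemma eval_fun_app: "b \<in> B_minus \<Longrightarrow> eval_fun x b = qeval (\<lambda>g. coord g b) x"
  by (simp add: eval_fun_def)

lemma H_minus_mult_B_minus: "h \<in> H_minus \<Longrightarrow> b \<in> B_minus \<Longrightarrow> h ** b \<in> B_minus"
  using H_minus_subset_B_minus B_minus_mult by blast

lemma quotient_functions_add:
  "\<phi> \<in> quotient_functions \<Longrightarrow> \<psi> \<in> quotient_functions \<Longrightarrow> (\<lambda>b\<in>B_minus. \<phi> b + \<psi> b) \<in> quotient_functions"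
  and quotient_functions_mult:
  "\<phi> \<in> quotient_functions \<Longrightarrow> \<psi> \<in> quotient_functions \<Longrightarrow> (\<lambda>b\<in>B_minus. \<phi> b * \<psi> b) \<in> quotient_functions"
  and quotient_functions_const: "(\<lambda>b\<in>B_minus. c) \<in> quotient_functions"
  by (simp_all add: quotient_functions_def regular_functions.intros H_minus_mult_B_minus)

lemma eval_fun_quotient_functions: "eval_fun x \<in> quotient_functions"
proof (induction x rule: qfun_word_induct)
  case (word c ws)
  have "coord g \<in> quotient_functions" for g
    by (cases g) (simp_all add: coords_quotient_functions)
  then have "eval_fun (qword ws) \<in> quotient_functions"
    by (induction ws) (simp_all add: qword_Cons eval_fun_1 eval_fun_mult eval_fun_gen
        quotient_functions_const quotient_functions_mult)
  then show ?case
    unfolding eval_fun_scale by (intro quotient_functions_mult quotient_functions_const)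
next
  case (add x y)
  then show ?case unfolding eval_fun_add by (rule quotient_functions_add)
qed

lemma eval_fun_regular: "eval_fun x \<in> regular_functions"
  using eval_fun_quotient_functions by (simp add: quotient_functions_def)

lemma quotient_functions_eq_range: "quotient_functions = range eval_fun"
proof
  show "quotient_functions \<subseteq> range eval_fun"
  proof
    fix \<phi> assume \<phi>: "\<phi> \<in> quotient_functions"
    then obtain x where x: "\<And>b. b \<in> B_minus \<Longrightarrow> \<phi> b = qeval (\<lambda>g. coord g b) x"
      using quotient_function_polynomial unfolding polynomial_fun_def by blast
    have "\<phi> \<in> regular_functions" using \<phi> by (simp add: quotient_functions_def)
    then have "\<phi> \<in> extensional B_minus" by (cases rule: regular_functions.cases) auto
    then have "\<phi> = eval_fun x"
      using x by (intro extensionalityI[of _ B_minus]) (auto simp: eval_fun_def)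
    then show "\<phi> \<in> range eval_fun" by blast
  qed
qed (use eval_fun_quotient_functions in blast)

text \<open>Derivative along the infinitesimal left multiplication by \<open>Y\<close>, the
  direction in which \<open>r_infty\<close> acts. Taking an element of \<open>qfun\<close> as
  argument lets derivations be handled by induction on words.\<close>

definition left_deriv :: "loop_mat \<Rightarrow> loop_mat \<Rightarrow> qfun \<Rightarrow> complex" where
  "left_deriv b Y x = cell_deriv (eval_fun x) b (Y ** b)"

text \<open>Since Yb = b (b^-1 Y b), the vector is brought to the form in which the lower part can
  be taken.\<close>

definition conj_by :: "loop_mat \<Rightarrow> loop_mat \<Rightarrow> loop_mat" where
  "conj_by b Y = adj b ** Y ** b"

lemma mult_conj_by: "b \<in> B_minus \<Longrightarrow> b ** conj_by b Y = Y ** b"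
  by (simp add: conj_by_def matrix_mul_assoc adj_inverse det_B_minus)

lemma conj_by_loop:
  fixes A B C D :: "complex fps"
  defines "L \<equiv> \<lambda>k F. lam_pow k * fps_to_fls F"
  shows "conj_by (fps_mat A B C D) (E_loop k) = mat22 (L k (C * D)) (L k (D * D)) (- L k (C * C))
      (- L k (C * D))"
    and "conj_by (fps_mat A B C D) (F_loop k) = mat22 (- L k (A * B)) (- L k (B * B)) (L k (A *
        A)) (L k (A * B))"
    and "conj_by (fps_mat A B C D) (H_loop k) =
      mat22 (L k (A * D + B * C)) (L k (2 * (B * D))) (- L k (2 * (A * C))) (- L k (A * D + B * C))"
proof -
  define l where "l = lam_pow k"
  show "conj_by (fps_mat A B C D) (E_loop k) = mat22 (L k (C * D)) (L k (D * D)) (- L k (C * C))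
      (- L k (C * D))"
    "conj_by (fps_mat A B C D) (F_loop k) = mat22 (- L k (A * B)) (- L k (B * B)) (L k (A * A))
        (L k (A * B))"
    "conj_by (fps_mat A B C D) (H_loop k) =
      mat22 (L k (A * D + B * C)) (L k (2 * (B * D))) (- L k (2 * (A * C))) (- L k (A * D + B * C))"
    unfolding conj_by_def E_loop_def F_loop_def H_loop_def L_def fps_mat_def adj_mat22 mat22_mult
        l_def[symmetric]
    by (simp_all add: fls_times_fps_to_fls algebra_simps)
qed

lemma traceless_mat22: "traceless (mat22 a b c (- a))" "traceless (mat22 (- a) b c a)"
  by (simp_all add: traceless_def)

lemma traceless_conj_by:
  assumes "b \<in> B_minus"
  shows "traceless (conj_by b (E_loop k))" "traceless (conj_by b (F_loop k))" "traceless
      (conj_by b (H_loop k))"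
  using assms by (elim B_minus_cases; simp only: conj_by_loop traceless_mat22)+

lemma left_deriv_derivation:
  assumes b: "b \<in> B_minus" and X: "traceless (conj_by b Y)"
  shows "left_deriv b Y (x + y) = left_deriv b Y x + left_deriv b Y y"
    and "left_deriv b Y (x * y) =
      qeval (\<lambda>g. coord g b) x * left_deriv b Y y + left_deriv b Y x * qeval (\<lambda>g. coord g b) y"
    and "left_deriv b Y (qscale c x) = at_one c * left_deriv b Y x"
    and "left_deriv b Y 1 = 0"
proof -
  note d = left_deriv_def mult_conj_by[OF b, symmetric]
  show "left_deriv b Y (x + y) = left_deriv b Y x + left_deriv b Y y"
    unfolding d eval_fun_add by (rule cell_deriv_add[OF eval_fun_regular eval_fun_regular b X])
  show "left_deriv b Y (x * y) =
      qeval (\<lambda>g. coord g b) x * left_deriv b Y y + left_deriv b Y x * qeval (\<lambda>g. coord g b) y"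
    unfolding d eval_fun_mult eval_fun_app[OF b, symmetric]
    by (rule cell_deriv_mult[OF eval_fun_regular eval_fun_regular b X])
  show "left_deriv b Y (qscale c x) = at_one c * left_deriv b Y x"
    unfolding d eval_fun_scale cell_deriv_mult[OF regular_functions.const eval_fun_regular b X]
    by (simp add: cell_deriv_const b X)
  show "left_deriv b Y 1 = 0"
    unfolding d eval_fun_1 by (rule cell_deriv_const[OF b X])
qed

lemma left_deriv_eq_0:
  assumes "b \<in> B_minus" "traceless (conj_by b Y)" and gens: "\<And>g. left_deriv b Y (q_gen g) = 0"
  shows "left_deriv b Y x = 0"
proof (induction x rule: qfun_word_induct)
  case (word c ws)
  have "left_deriv b Y (qword ws) = 0"
    by (induction ws) (simp_all add: left_deriv_derivation assms qword_Cons)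
  then show ?case by (simp add: left_deriv_derivation assms)
qed (simp add: left_deriv_derivation assms)

context cell_point
begin

abbreviation "b \<equiv> fps_mat A B C D"
abbreviation "t \<equiv> \<lambda>g. coord g b"

lemma b_in: "b \<in> B_minus"
  by (simp add: fps_mat_B_minus_iff det B0)

lemma trunc_uminus:
  "fls_regpart (lam_pow k * fps_to_fls F) = trunc False k F"
  "strict_part (lam_pow k * fps_to_fls F) = trunc True k F"
  "fls_regpart (- (lam_pow k * fps_to_fls F)) = - trunc False k F"
  "strict_part (- (lam_pow k * fps_to_fls F)) = - trunc True k F"
  by (auto simp: trunc_def strict_part_def intro!: fps_ext)

lemma left_deriv_E:
  "left_deriv b (E_loop k) (q_gen (GenU p)) = (- 1) ^ p * fps_nth (Eu k) p"
  "left_deriv b (E_loop k) (q_gen (GenM p)) = - ((- 1) ^ p * fps_nth (Ey k) (Suc p))"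
  unfolding left_deriv_def eval_fun_gen mult_conj_by[OF b_in, symmetric] coord.simps
    cell_deriv_coord[OF refl b_in traceless_conj_by(1)[OF b_in]]
  by (simp_all only: conj_by_loop mat22_nth trunc_uminus E_series_def) (simp_all add: algebra_simps)

lemma left_deriv_F:
  "left_deriv b (F_loop k) (q_gen (GenU p)) = (- 1) ^ p * fps_nth (Fu k) p"
  "left_deriv b (F_loop k) (q_gen (GenM p)) = - ((- 1) ^ p * fps_nth (Fy k) (Suc p))"
  unfolding left_deriv_def eval_fun_gen mult_conj_by[OF b_in, symmetric] coord.simps
    cell_deriv_coord[OF refl b_in traceless_conj_by(2)[OF b_in]]
  by (simp_all only: conj_by_loop mat22_nth trunc_uminus F_series_def) (simp_all add: algebra_simps)

lemma trunc_negative: "k < 0 \<Longrightarrow> trunc s k F = fps_X ^ nat (- k) * F"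
  by (rule fps_ext) (auto simp: trunc_nth fps_X_power_mult_nth nat_diff_distrib intro!:
      arg_cong[where f = "fps_nth F"])

text \<open>For \<open>k < 0\<close> this is the infinitesimal left action of
  \<open>H_minus\<close>, under which the coordinates are invariant. In the computation negative
  \<open>k\<close> means that the truncations cut nothing off.\<close>

lemma left_deriv_H:
  assumes "k < 0"
  shows "left_deriv b (H_loop k) x = 0"
proof (rule left_deriv_eq_0[OF b_in traceless_conj_by(3)[OF b_in]])
  fix g
  let ?X = "fps_X ^ nat (- k) :: complex fps"
  have "(2 * C * D * (?X * (A * D + B * C)) - C\<^sup>2 * (?X * (2 * (B * D))) + D\<^sup>2 * - (?X * (2 * (A *
      C)))) = 0"
    "(- (2 * A * B) * (?X * (A * D + B * C)) + A\<^sup>2 * (?X * (2 * (B * D))) - B\<^sup>2 * - (?X * (2 * (A *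
        C)))) = 0"
    by (simp_all add: power2_eq_square algebra_simps)
  then show "left_deriv b (H_loop k) (q_gen g) = 0"
    unfolding left_deriv_def eval_fun_gen mult_conj_by[OF b_in, symmetric]
    by (cases g; simp only: coord.simps cell_deriv_coord[OF refl b_in traceless_conj_by(3)[OF
        b_in]])
      (simp_all only: conj_by_loop mat22_nth trunc_uminus trunc_negative[OF assms] mult_zero_left
          mult_zero_right fps_zero_nth minus_zero)
qed

text \<open>The series of the generators are divisible by high powers of \<lambda>^-1 for very
  negative \<open>k\<close>, and the Leibniz rule passes the bound to products. Hence the sum over
  all integers in the bracket is finite.\<close>

lemma left_deriv_supported:
  "\<exists>n. \<forall>k < - int n. left_deriv b (E_loop k) x = 0 \<and> left_deriv b (F_loop k) x = 0"
proof (induction x rule: qfun_word_induct)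
  case (word c ws)
  have gen: "\<exists>n. \<forall>k < - int n. left_deriv b (E_loop k) (q_gen g) = 0 \<and> left_deriv b (F_loop k)
      (q_gen g) = 0" for g
  proof (cases g)
    case (GenU p)
    then show ?thesis
      using supported_E_series supported_F_series
      by (intro exI[of _ p]) (simp add: left_deriv_E left_deriv_F supported_def)
  next
    case (GenM p)
    then show ?thesis
      using supported_E_series supported_F_series
      by (intro exI[of _ "Suc p"]) (simp add: left_deriv_E left_deriv_F supported_def)
  qed
  have "\<exists>n. \<forall>k < - int n. left_deriv b (E_loop k) (qword ws) = 0 \<and> left_deriv b (F_loop k)
      (qword ws) = 0"
  proof (induction ws)
    case Nil
    show ?case by (simp add: left_deriv_derivation b_in traceless_conj_by)
  next
    case (Cons g ws)
    then obtain n where "\<forall>k < - int n. left_deriv b (E_loop k) (qword ws) = 0 \<and> left_deriv b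
        (F_loop k) (qword ws) = 0"
      by blast
    moreover obtain m where "\<forall>k < - int m. left_deriv b (E_loop k) (q_gen g) = 0 \<and> left_deriv b
        (F_loop k) (q_gen g) = 0"
      using gen by blast
    ultimately show ?case
      by (intro exI[of _ "max m n"]) (simp add: qword_Cons left_deriv_derivation b_in
          traceless_conj_by)
  qed
  then show ?case by (simp add: left_deriv_derivation b_in traceless_conj_by) blast
next
  case (add x y)
  then obtain n m where "\<forall>k < - int n. left_deriv b (E_loop k) x = 0 \<and> left_deriv b
      (F_loop k) x = 0"
    "\<forall>k < - int m. left_deriv b (E_loop k) y = 0 \<and> left_deriv b (F_loop k) y = 0" by blast
  then show ?case
    by (intro exI[of _ "max m n"]) (simp add: left_deriv_derivation b_in traceless_conj_by)
qed

text \<open>The contribution of the e and f terms of \<open>r_infty\<close>, cut off at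
  \<open>n\<close>. The factor is the 1/2 in \<open>r_infty\<close> with the minus sign of the right
  translate in \<open>P_infty\<close>.\<close>

definition bracket_sum :: "nat \<Rightarrow> qfun \<Rightarrow> qfun \<Rightarrow> complex" where
  "bracket_sum n x y = - (1/2) * (\<Sum>k\<in>{- int n..int n}.
     left_deriv b (E_loop k) x * left_deriv b (F_loop (- k)) y -
     left_deriv b (F_loop (- k)) x * left_deriv b (E_loop k) y)"

definition point_bracket :: "qfun \<Rightarrow> qfun \<Rightarrow> complex" where
  "point_bracket x y = bracket_infty (eval_fun x) (eval_fun y) b"

lemma lam_pow_nth: "fls_nth (lam_pow k) n = (if n = - k then 1 else 0)"
  by auto

lemma loop_upper:
  "0 \<le> k \<Longrightarrow> E_loop k \<in> upper_algebra" "1 \<le> k \<Longrightarrow> F_loop k \<in> upper_algebra"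
  "1 \<le> k \<Longrightarrow> H_loop k \<in> upper_algebra"
  unfolding E_loop_def F_loop_def H_loop_def upper_algebra_def polys_def mem_Collect_eq forall_2
      mat22_nth
    fls_uminus_nth lam_pow_nth fls_zero_nth
  by auto

lemma traceless_loop: "traceless (E_loop k)" "traceless (F_loop k)" "traceless (H_loop k)"
  by (simp_all add: E_loop_def F_loop_def H_loop_def traceless_def)

lemma cell_deriv_upper_loop:
  "0 \<le> k \<Longrightarrow> cell_deriv (eval_fun x) b (b ** E_loop k) = 0"
  "1 \<le> k \<Longrightarrow> cell_deriv (eval_fun x) b (b ** F_loop k) = 0"
  "1 \<le> k \<Longrightarrow> cell_deriv (eval_fun x) b (b ** H_loop k) = 0"
  by (auto intro!: cell_deriv_upper eval_fun_regular b_in traceless_loop lower_part_upper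
      loop_upper)

text \<open>
  Each summand of the standard \<open>r\<close>-matrix has a factor in the Lie algebra of \<open>N\<^sub>+\<close>,
      whose left invariant
  fields kill right invariant functions.
\<close>

lemma r_std_vanishes: "r_std (\<lambda>X Y. wedge_pairing (eval_fun x) (eval_fun y) b (b ** X)
    (b ** Y)) = 0"
proof -
  have "(\<Sum>\<^sub>\<infinity>k\<in>{0..}. wedge_pairing (eval_fun x) (eval_fun y) b (b ** E_loop k) (b ** F_loop
      (- k))) = 0"
    "(\<Sum>\<^sub>\<infinity>k\<in>{1..}. wedge_pairing (eval_fun x) (eval_fun y) b (b ** F_loop k) (b ** E_loop (- k))) = 0"
    "(\<Sum>\<^sub>\<infinity>k\<in>{1..}. wedge_pairing (eval_fun x) (eval_fun y) b (b ** H_loop k) (b ** H_loop (- k))) = 0"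
    by (auto intro!: infsum_0 simp: wedge_pairing_def cell_deriv_upper_loop)
  then show ?thesis
    unfolding r_std_def by (simp only: mult_zero_right add.right_neutral)
qed

lemma point_bracket_eq:
  "\<exists>N. \<forall>n\<ge>N. point_bracket x y = bracket_sum n x y"
proof -
  obtain l where l: "\<And>k. k < - int l \<Longrightarrow> left_deriv b (E_loop k) x = 0 \<and> left_deriv b
      (F_loop k) x = 0"
    using left_deriv_supported by blast
  obtain m where m: "\<And>k. k < - int m \<Longrightarrow> left_deriv b (E_loop k) y = 0 \<and> left_deriv b
      (F_loop k) y = 0"
    using left_deriv_supported by blast
  let ?w = "\<lambda>X Y. wedge_pairing (eval_fun x) (eval_fun y) b (X ** b) (Y ** b)"
  let ?T = "\<lambda>k. left_deriv b (E_loop k) x * left_deriv b (F_loop (- k)) y -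
     left_deriv b (F_loop (- k)) x * left_deriv b (E_loop k) y"
  have H: "(\<Sum>\<^sub>\<infinity>k\<in>{1..}. ?w (H_loop k) (H_loop (- k))) = 0"
  proof (rule infsum_0)
    fix k :: int assume "k \<in> {1..}"
    then have "left_deriv b (H_loop (- k)) z = 0" for z by (intro left_deriv_H) simp
    then show "?w (H_loop k) (H_loop (- k)) = 0"
      by (simp add: wedge_pairing_def left_deriv_def)
  qed
  have EF: "(\<Sum>\<^sub>\<infinity>k\<in>UNIV. ?w (E_loop k) (F_loop (- k))) = (\<Sum>k\<in>{- int n..int n}. ?T k)" if
      "max l m \<le> n" for n
  proof -
    have w: "?w (E_loop k) (F_loop (- k)) = ?T k" for k
      by (simp add: wedge_pairing_def left_deriv_def)
    have "(\<Sum>\<^sub>\<infinity>k\<in>UNIV. ?T k) = (\<Sum>\<^sub>\<infinity>k\<in>{- int n..int n}. ?T k)"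
    proof (rule infsum_cong_neutral)
      fix k assume "k \<in> UNIV - {- int n..int n}"
      \<comment> \<open>Each product has one factor from \<open>E_loop k\<close> and one from
        \<open>F_loop (- k)\<close>: the first vanishes below the range, the second above
        it.\<close>
      then have "k < - int l \<and> k < - int m \<or> - k < - int l \<and> - k < - int m" using that by auto
      then show "?T k = 0" using l m by auto
    qed auto
    then show ?thesis by (simp only: w) simp
  qed
  have "point_bracket x y = bracket_sum n x y" if "max l m \<le> n" for n
    unfolding point_bracket_def
    by (simp add: bracket_infty_def P_infty_def r_std_vanishes b_in r_infty_def H EF[OF that]
        bracket_sum_def)
  then show ?thesis by blast
qed

text \<open>A common cutoff reduces additivity, the scalar rule and the Leibniz rule of the bracket
  to identities between finite sums.\<close>

lemma point_bracket_eq3: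
  "\<exists>n\<ge>m. point_bracket x y = bracket_sum n x y \<and> point_bracket x' y' = bracket_sum n x' y' \<and>
     point_bracket x'' y'' = bracket_sum n x'' y''"
proof -
  obtain a where "\<forall>n\<ge>a. point_bracket x y = bracket_sum n x y" using point_bracket_eq by blast
  moreover obtain b' where "\<forall>n\<ge>b'. point_bracket x' y' = bracket_sum n x' y'"
      using point_bracket_eq by blast
  moreover obtain c where "\<forall>n\<ge>c. point_bracket x'' y'' = bracket_sum n x'' y''"
      using point_bracket_eq by blast
  ultimately show ?thesis by (intro exI[of _ "m + a + b' + c"]) auto
qed

lemma S_eq_sum:
  assumes "max p r \<le> n"
  shows "(\<Sum>k\<in>{- int n..int n}. fps_nth (E_series a b' c N k) p * fps_nth (F_series a' b'' c' N'
      (- k)) r) =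
    S (E_series a b' c N) (F_series a' b'' c' N') p r"
  using agree_pairing_series[OF supported_E_series supported_F_series,
      of n a b' c N a' b'' c' N'] assms
  unfolding agree_def S_def by (simp add: pairing_nth)

lemma bracket_uu:
  "point_bracket (q_gen (GenU p)) (q_gen (GenU r)) = - (1/2) * (- 1) ^ (p + r) * (S Eu Fu p r -
      S Eu Fu r p)"
proof -
  obtain n where n: "max p r \<le> n"
    "point_bracket (q_gen (GenU p)) (q_gen (GenU r)) = bracket_sum n (q_gen (GenU p)) (q_gen
        (GenU r))"
    using point_bracket_eq3 by blast
  have "bracket_sum n (q_gen (GenU p)) (q_gen (GenU r)) = - (1/2) * (- 1) ^ (p + r) *
      ((\<Sum>k\<in>{- int n..int n}. fps_nth (Eu k) p * fps_nth (Fu (- k)) r) -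
       (\<Sum>k\<in>{- int n..int n}. fps_nth (Eu k) r * fps_nth (Fu (- k)) p))"
    unfolding bracket_sum_def left_deriv_E left_deriv_F
    by (simp add: sum_subtractf sum_distrib_left power_add algebra_simps)
  then show ?thesis using n by (simp add: S_eq_sum)
qed

lemma bracket_mm:
  "point_bracket (q_gen (GenM p)) (q_gen (GenM r)) =
     - (1/2) * (- 1) ^ (p + r) * (S Ey Fy (Suc p) (Suc r) - S Ey Fy (Suc r) (Suc p))"
proof -
  obtain n where n: "max (Suc p) (Suc r) \<le> n"
    "point_bracket (q_gen (GenM p)) (q_gen (GenM r)) = bracket_sum n (q_gen (GenM p)) (q_gen
        (GenM r))"
    using point_bracket_eq3 by blast
  have "bracket_sum n (q_gen (GenM p)) (q_gen (GenM r)) = - (1/2) * (- 1) ^ (p + r) *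
      ((\<Sum>k\<in>{- int n..int n}. fps_nth (Ey k) (Suc p) * fps_nth (Fy (- k)) (Suc r)) -
       (\<Sum>k\<in>{- int n..int n}. fps_nth (Ey k) (Suc r) * fps_nth (Fy (- k)) (Suc p)))"
    unfolding bracket_sum_def left_deriv_E left_deriv_F
    by (simp add: sum_subtractf sum_distrib_left power_add algebra_simps)
  then show ?thesis using n by (simp add: S_eq_sum)
qed

lemma bracket_um:
  "point_bracket (q_gen (GenU p)) (q_gen (GenM r)) =
     (1/2) * (- 1) ^ (p + r) * (S Eu Fy p (Suc r) - S Ey Fu (Suc r) p)"
proof -
  obtain n where n: "max p (Suc r) \<le> n"
    "point_bracket (q_gen (GenU p)) (q_gen (GenM r)) = bracket_sum n (q_gen (GenU p)) (q_gen
        (GenM r))"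
    using point_bracket_eq3 by blast
  have "bracket_sum n (q_gen (GenU p)) (q_gen (GenM r)) = (1/2) * (- 1) ^ (p + r) *
      ((\<Sum>k\<in>{- int n..int n}. fps_nth (Eu k) p * fps_nth (Fy (- k)) (Suc r)) -
       (\<Sum>k\<in>{- int n..int n}. fps_nth (Ey k) (Suc r) * fps_nth (Fu (- k)) p))"
    unfolding bracket_sum_def left_deriv_E left_deriv_F
    by (simp add: sum_subtractf sum_distrib_left sum_negf power_add algebra_simps)
  then show ?thesis using n by (simp add: S_eq_sum)
qed

lemma coord_b: "t (GenU p) = (- 1) ^ p * fps_nth u_pt p" "t (GenM p) = - ((- 1) ^ p *
    fps_nth y_pt (Suc p))"
  by (simp_all add: u_coord_eq[OF b_in] m_coord_eq[OF b_in] u_ser_def y_ser_def)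

lemma commutator_bracket: "commutator_bracket t point_bracket"
proof
  fix x y z :: qfun and a :: laurent and c :: bool and k l i j :: nat
  note der = left_deriv_derivation[OF b_in] traceless_conj_by[OF b_in]
  obtain n where n: "point_bracket x y = bracket_sum n x y" "point_bracket y x = bracket_sum n y x"
    using point_bracket_eq3 by blast
  show "point_bracket x y = - point_bracket y x"
    unfolding n bracket_sum_def by (simp add: sum_subtractf algebra_simps)
  obtain n where n: "point_bracket (x + y) z = bracket_sum n (x + y) z" "point_bracket x z =
      bracket_sum n x z"
    "point_bracket y z = bracket_sum n y z"
    using point_bracket_eq3 by blast
  show "point_bracket (x + y) z = point_bracket x z + point_bracket y z"
    unfolding n bracket_sum_def by (simp add: der sum_subtractf sum.distrib algebra_simps)
  obtain n where n: "point_bracket (qscale a x) z = bracket_sum n (qscale a x) z"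
      "point_bracket x z = bracket_sum n x z"
    using point_bracket_eq3 by blast
  show "point_bracket (qscale a x) z = at_one a * point_bracket x z"
    unfolding n bracket_sum_def by (simp add: der sum_subtractf sum_distrib_left algebra_simps)
  obtain n where n: "point_bracket (x * y) z = bracket_sum n (x * y) z" "point_bracket x z =
      bracket_sum n x z"
    "point_bracket y z = bracket_sum n y z"
    using point_bracket_eq3 by blast
  show "point_bracket (x * y) z = qeval t x * point_bracket y z + point_bracket x z * qeval t y"
    unfolding n bracket_sum_def
    by (simp add: der sum_subtractf sum.distrib sum_distrib_left sum_distrib_right algebra_simps)
  show "point_bracket (q_gen (gen_of c k)) (q_gen (gen_of c (Suc l))) =
      point_bracket (q_gen (gen_of c (Suc k))) (q_gen (gen_of c l)) + (if c then 1 else - 1) *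
        (t (gen_of c k) * t (gen_of c (Suc l)) + t (gen_of c (Suc k)) * t (gen_of c l))"
  proof (cases c)
    case True
    then have c: "c = True" by simp
    \<comment> \<open>The recursion is used at \<open>(k, l)\<close> and at \<open>(l, k)\<close>:
      antisymmetrization of the bracket combines the two corrections into the symmetric quadratic
      term.\<close>
    have S: "S Eu Fu k (Suc l) = S Eu Fu (Suc k) l - 2 * fps_nth u_pt (Suc k) * fps_nth u_pt l"
      "S Eu Fu l (Suc k) = S Eu Fu (Suc l) k - 2 * fps_nth u_pt (Suc l) * fps_nth u_pt k"
      using S_uu[of k l] S_uu[of l k] by (simp_all add: algebra_simps)
    show ?thesis
      unfolding c gen_of.simps bracket_uu coord_b S by (simp add: power_add algebra_simps)
  next
    case False
    then have c: "c = False" by simp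
    have S: "S Ey Fy (Suc k) (Suc (Suc l)) = S Ey Fy (Suc (Suc k)) (Suc l) + 2 * fps_nth y_pt
        (Suc k) * fps_nth y_pt (Suc (Suc l))"
      "S Ey Fy (Suc l) (Suc (Suc k)) = S Ey Fy (Suc (Suc l)) (Suc k) + 2 * fps_nth y_pt (Suc l) *
          fps_nth y_pt (Suc (Suc k))"
      using S_yy[of k l] S_yy[of l k] by (simp_all add: algebra_simps)
    show ?thesis
      unfolding c gen_of.simps bracket_mm coord_b S by (simp add: power_add algebra_simps)
  qed
  show "point_bracket (q_gen (GenU i)) (q_gen (GenM j)) = - t (GenU i) * t (GenM j)"
    unfolding bracket_um S_uy S_yu coord_b by (simp add: power_add)
qed

end

lemma bracket_infty_commutator:
  assumes "x * y - y * x = qscale (qpow 1 - 1) c"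
  shows "bracket_infty (eval_fun x) (eval_fun y) = eval_fun c"
proof (rule extensionalityI[of _ B_minus])
  show "bracket_infty (eval_fun x) (eval_fun y) \<in> extensional B_minus"
    by (simp add: bracket_infty_def)
  show "eval_fun c \<in> extensional B_minus"
    by (simp add: eval_fun_def)
  fix b assume b: "b \<in> B_minus"
  then obtain A B C D where *: "b = fps_mat A B C D" "A * D - B * C = 1" "fps_nth B 0 = 0"
    using B_minus_cases by metis
  interpret cell_point A B C D by standard (fact *)+
  interpret commutator_bracket "\<lambda>g. coord g b" point_bracket
    using commutator_bracket by (simp add: *(1))
  show "bracket_infty (eval_fun x) (eval_fun y) b = eval_fun c b"
    using qeval_commutator[OF assms] b by (simp add: eval_fun_app point_bracket_def *(1))
qed

lemma point_bracket_at:
  assumes "b \<in> B_minus"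
  shows "commutator_bracket (\<lambda>g. coord g b) (\<lambda>x y. bracket_infty (eval_fun x) (eval_fun y) b)"
proof -
  obtain A B C D where *: "b = fps_mat A B C D" "A * D - B * C = 1" "fps_nth B 0 = 0"
    using B_minus_cases[OF assms] by metis
  interpret cell_point A B C D by standard (fact *)+
  show ?thesis
    using commutator_bracket unfolding point_bracket_def[abs_def] *(1) .
qed

lemma commutator_divisible: "\<exists>c. x * y - y * x = qscale (qpow 1 - 1) c"
  by (rule qeval_eq_0_imp_divisible) (simp add: qeval_diff qeval_mult)

text \<open>Nested brackets are represented by double commutators divided twice by
  \<open>q - 1\<close>. The cyclic sum of the commutators is 0, and torsion-freeness allows both
  factors to be cancelled.\<close>

lemma bracket_jacobi:
  "bracket_infty (eval_fun x) (bracket_infty (eval_fun y) (eval_fun z)) b +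
   bracket_infty (eval_fun y) (bracket_infty (eval_fun z) (eval_fun x)) b +
   bracket_infty (eval_fun z) (bracket_infty (eval_fun x) (eval_fun y)) b = 0" if b: "b \<in> B_minus"
proof -
  let ?q = "qpow 1 - 1"
  obtain a1 a2 a3 where a: "y * z - z * y = qscale ?q a1" "z * x - x * z = qscale ?q a2" "x * y -
      y * x = qscale ?q a3"
    using commutator_divisible by metis
  obtain c1 c2 c3 where c: "x * a1 - a1 * x = qscale ?q c1" "y * a2 - a2 * y = qscale ?q c2" "z *
      a3 - a3 * z = qscale ?q c3"
    using commutator_divisible by metis
  have step: "qscale ?q (qscale ?q c) = v * w - w * v" if "v * a - a * v = qscale ?q c" "w =
      qscale ?q a" for v a c w
    using that by (simp add: qmod.scale_right_diff_distrib flip: that(1))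
  have "qscale ?q (qscale ?q (c1 + c2 + c3)) =
      (x * (y * z - z * y) - (y * z - z * y) * x) + (y * (z * x - x * z) - (z * x - x * z) * y) +
      (z * (x * y - y * x) - (x * y - y * x) * z)"
    unfolding qmod.scale_right_distrib step[OF c(1) a(1)] step[OF c(2) a(2)] step[OF c(3) a(3)] ..
  also have "\<dots> = 0" by (simp add: algebra_simps)
  finally have "qscale ?q (c1 + c2 + c3) = 0"
    using qfun_torsion_free[OF _ qpow_minus_1_neq_0] by blast
  then have 0: "c1 + c2 + c3 = 0"
    using qfun_torsion_free[OF _ qpow_minus_1_neq_0] by blast
  have "bracket_infty (eval_fun x) (bracket_infty (eval_fun y) (eval_fun z)) b +
     bracket_infty (eval_fun y) (bracket_infty (eval_fun z) (eval_fun x)) b +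
     bracket_infty (eval_fun z) (bracket_infty (eval_fun x) (eval_fun y)) b =
     eval_fun c1 b + eval_fun c2 b + eval_fun c3 b"
    by (simp only: bracket_infty_commutator[OF a(1)] bracket_infty_commutator[OF a(2)]
        bracket_infty_commutator[OF a(3)] bracket_infty_commutator[OF c(1)]
        bracket_infty_commutator[OF c(2)] bracket_infty_commutator[OF c(3)])
  also have "\<dots> = qeval (\<lambda>g. coord g b) (c1 + c2 + c3)"
    by (simp add: eval_fun_app[OF b] qeval_add)
  finally show ?thesis by (simp add: 0)
qed

lemma poisson_algebra_quotient: "poisson_algebra B_minus quotient_functions bracket_infty"
  unfolding poisson_algebra_def
proof (intro conjI ballI allI)
  show "quotient_functions \<subseteq> extensional B_minus"
    by (auto simp: quotient_functions_eq_range eval_fun_def)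
  show "(\<lambda>s\<in>B_minus. c) \<in> quotient_functions" for c
    by (rule quotient_functions_const)
  fix \<phi> \<psi> assume "\<phi> \<in> quotient_functions" "\<psi> \<in> quotient_functions"
  then obtain x y where xy: "\<phi> = eval_fun x" "\<psi> = eval_fun y"
    by (auto simp: quotient_functions_eq_range)
  show "(\<lambda>s\<in>B_minus. \<phi> s + \<psi> s) \<in> quotient_functions" "(\<lambda>s\<in>B_minus. \<phi> s * \<psi> s) \<in> quotient_functions"
    unfolding xy eval_fun_add[symmetric] eval_fun_mult[symmetric] by
        (rule eval_fun_quotient_functions)+
  \<comment> \<open>Closure under the bracket comes from the algebra: the bracket is the function of
    the divided commutator.\<close>
  obtain c where "x * y - y * x = qscale (qpow 1 - 1) c" using commutator_divisible by blast
  then show "bracket_infty \<phi> \<psi> \<in> quotient_functions"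
    unfolding xy by (simp add: bracket_infty_commutator eval_fun_quotient_functions)
  fix \<rho> c s assume "\<rho> \<in> quotient_functions" and s: "s \<in> B_minus"
  then obtain z where z: "\<rho> = eval_fun z"
    by (auto simp: quotient_functions_eq_range)
  interpret commutator_bracket "\<lambda>g. coord g s" "\<lambda>x y. bracket_infty (eval_fun x) (eval_fun y) s"
    by (rule point_bracket_at[OF s])
  show "bracket_infty \<phi> \<psi> s = - bracket_infty \<psi> \<phi> s"
    unfolding xy by (rule D_antisym)
  show "bracket_infty (\<lambda>s\<in>B_minus. \<phi> s + \<psi> s) \<rho> s = bracket_infty \<phi> \<rho> s + bracket_infty \<psi> \<rho> s"
    unfolding xy z eval_fun_add[symmetric] by (rule D_add)
  have "(\<lambda>s\<in>B_minus. c * \<phi> s) = eval_fun (qscale (laurent_const c) x)"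
    by (auto simp: xy eval_fun_scale)
  then show "bracket_infty (\<lambda>s\<in>B_minus. c * \<phi> s) \<rho> s = c * bracket_infty \<phi> \<rho> s"
    using D_scale[of "laurent_const c" x z] by (simp add: xy z)
  show "bracket_infty (\<lambda>s\<in>B_minus. \<phi> s * \<psi> s) \<rho> s = \<phi> s * bracket_infty \<psi> \<rho> s +
      bracket_infty \<phi> \<rho> s * \<psi> s"
    using D_mult[of x y z] by (simp add: xy z eval_fun_app[OF s] flip: eval_fun_mult)
  show "bracket_infty \<phi> (bracket_infty \<psi> \<rho>) s + bracket_infty \<psi> (bracket_infty \<rho> \<phi>) s +
      bracket_infty \<rho> (bracket_infty \<phi> \<psi>) s = 0"
    unfolding xy z by (rule bracket_jacobi[OF s])
qed

text \<open>Since the coordinates take arbitrary values on \<open>B_minus\<close>, equal functions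
  have equal values under every character, so the difference is divisible by
  \<open>q - 1\<close>.\<close>

lemma eval_fun_eq_iff: "eval_fun x = eval_fun y \<longleftrightarrow> (x, y) \<in> cong_q1 qscale"
proof
  assume eq: "eval_fun x = eval_fun y"
  have "qeval t (x - y) = 0" for t
  proof -
    obtain b where b: "b \<in> B_minus" "\<And>g. coord g b = t g" using coord_surjective by blast
    have "qeval (\<lambda>g. coord g b) x = qeval (\<lambda>g. coord g b) y"
      using arg_cong[OF eq, of "\<lambda>f. f b"] by (simp add: eval_fun_app b(1))
    then show ?thesis by (simp add: b(2) qeval_diff)
  qed
  then show "(x, y) \<in> cong_q1 qscale"
    using qeval_eq_0_imp_divisible by (simp add: cong_q1_def)
next
  assume "(x, y) \<in> cong_q1 qscale"
  then obtain z where "x - y = qscale (qpow 1 - 1) z" by (auto simp: cong_q1_def)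
  then have "qeval t (x - y) = 0" for t by (simp add: qeval_scale at_one_diff)
  then show "eval_fun x = eval_fun y" by (simp add: eval_fun_def qeval_diff)
qed

text \<open>The representative is immaterial on congruence classes, because \<open>eval_fun\<close>
  is constant on them.\<close>

definition specialization :: "qfun set \<Rightarrow> loop_mat \<Rightarrow> complex" where
  "specialization X = eval_fun (SOME x. x \<in> X)"

lemma class_q1_eq: "class_q1 qscale x = {y. eval_fun x = eval_fun y}"
  by (auto simp: class_q1_def eval_fun_eq_iff)

lemma specialization_class: "specialization (class_q1 qscale x) = eval_fun x"
proof -
  have "(SOME y. y \<in> class_q1 qscale x) \<in> class_q1 qscale x"
    by (rule someI[of _ x]) (simp add: class_q1_eq)
  then show ?thesis by (simp add: specialization_def class_q1_eq)
qed

lemma specialization_iso: "specialization_iso qscale B_minus quotient_functions specialization"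
  unfolding specialization_iso_def specialization_class
proof (intro conjI allI)
  have classes: "UNIV // cong_q1 qscale = range (class_q1 qscale)"
    by (auto simp: quotient_def class_q1_def)
  show "bij_betw specialization (UNIV // cong_q1 qscale) quotient_functions"
    unfolding classes bij_betw_def quotient_functions_eq_range
  proof
    show "inj_on specialization (range (class_q1 qscale))"
    proof (rule inj_onI, elim rangeE)
      fix X Y x y
      assume "specialization X = specialization Y" "X = class_q1 qscale x" "Y = class_q1 qscale y"
      then have "eval_fun x = eval_fun y" by (simp add: specialization_class)
      then show "X = Y"
        by (simp add: \<open>X = _\<close> \<open>Y = _\<close> class_q1_eq)
    qed
  qed (simp add: image_image specialization_class)
qed (auto simp: eval_fun_1 eval_fun_add eval_fun_mult eval_fun_scale)

theorem proposition5:
  "\<exists>\<theta>. quantum_deformation qscale B_minus quotient_functions bracket_infty \<theta> \<and>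
     (\<forall>i. \<theta> (class_q1 qscale (q_gen (GenU i))) = u_coord i) \<and>
     (\<forall>i. \<theta> (class_q1 qscale (q_gen (GenM i))) = m_coord i)"
proof (intro exI conjI allI)
  show "quantum_deformation qscale B_minus quotient_functions bracket_infty specialization"
    unfolding quantum_deformation_def specialization_class
    using poisson_algebra_quotient laurent_algebra_qscale free_module_qscale specialization_iso
      bracket_infty_commutator by blast
qed (simp_all add: specialization_class eval_fun_gen)

end
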